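(* Let $k$ be a commutative ring and let $(T,\mu)$ be a $k$-torsor such that $T$ is faithfully flat as a $k$-module. Write $\mu(x)=x^{(1)}\otimes x^{(2)}\otimes x^{(3)}$. Then $$H:=\{x\otimes y\in T\otimes T\mid xy^{(1)}\otimes y^{(2)}\otimes y^{(3)}=1\otimes x\otimes y \text{ in } T\otimes T\otimes T\}$$ is a Hopf algebra over $k$. Its algebra structure is that of a subalgebra of $T^{\mathrm{op}}\otimes T$, and its comultiplication and counit are given, for $x\otimes y\in H$, by $$\Delta(x\otimes y)=x\otimes y^{(1)}\otimes y^{(2)}\otimes y^{(3)},\qquad \varepsilon(x\otimes y)=xy.$$ Moreover, $T$ is a right $H$-Galois object under the coaction $\delta\colon T\to T\otimes H$ given by $$\delta(x)=x^{(1)}\otimes x^{(2)}\otimes x^{(3)}.$$ (It is part of the assertion that these formulas are well defined, i.e. that $\Delta$ takes values in $H\otimes H\subset T\otimes T\otimes T\otimes T$, that $\varepsilon$ takes values in $k\subset T$, and that $\delta$ takes values in $T\otimes H\subset T\otimes T\otimes T$.)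
   Context: All algebras are associative and unital over the commutative base ring $k$; $\otimes$ means $\otimes_k$; $T^{\mathrm{op}}$ is the opposite algebra of $T$. An element of a tensor product $V\otimes W$ is written $v\otimes w$ even when it is not a simple tensor, i.e. a sum of simple tensors is suppressed in the notation. Thus $H$ is the set of all $t\in T\otimes T$ with $D(t)=1\otimes t$, where $D\colon T\otimes T\to T\otimes T\otimes T$ is the $k$-linear map $D=(\nabla\otimes T\otimes T)(T\otimes\mu)$, $\nabla\colon T\otimes T\to T$ is the multiplication of $T$, and an object name in a tensor product of maps denotes its identity map. A (noncommutative) $k$-torsor is a $k$-algebra $T$ with an algebra map $\mu\colon T\to T\otimes T^{\mathrm{op}}\otimes T$, written $\mu(x)=x^{(1)}\otimes x^{(2)}\otimes x^{(3)}$, such that for all $x\in T$: (i) $\mu(x^{(1)})\otimes x^{(2)}\otimes x^{(3)}=x^{(1)}\otimes x^{(2)}\otimes\mu(x^{(3)})$; (ii) $x^{(1)}x^{(2)}\otimes x^{(3)}=1\otimes x$ in $T\otimes T$; (iii) $x^{(1)}\otimes x^{(2)}x^{(3)}=x\otimes 1$ in $T\otimes T$. (The products in (ii) and (iii) are taken in $T$.) For a Hopf algebra $H$ over $k$, a right $H$-Galois object is a right $H$-comodule algebra $A$, with coaction $\delta\colon A\to A\otimes H$, $\delta(x)=x_{(0)}\otimes x_{(1)}$, such that the Galois map $\beta\colon A\otimes A\to A\otimes H$, $\beta(x\otimes y)=xy_{(0)}\otimes y_{(1)}$, is bijective and $A^{\mathrm{co}H}:=\{x\in A\mid\delta(x)=x\otimes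 1\}=k$. *)

theory Defs
  imports "HOL-Algebra.Module" "HOL-Algebra.Subrings"
begin

section \<open>Modules and (noncommutative) algebras over a commutative ring\<close>

definition linear_maps ::
  "('r, 'x) ring_scheme \<Rightarrow> ('r, 'm, 'y) module_scheme \<Rightarrow> ('r, 'n, 'z) module_scheme
    \<Rightarrow> ('m \<Rightarrow> 'n) set" where
  "linear_maps R M N =
    {f \<in> carrier M \<rightarrow> carrier N.
      (\<forall>x\<in>carrier M. \<forall>y\<in>carrier M. f (x \<oplus>\<^bsub>M\<^esub> y) = f x \<oplus>\<^bsub>N\<^esub> f y) \<and>
      (\<forall>r\<in>carrier R. \<forall>x\<in>carrier M. f (r \<odot>\<^bsub>M\<^esub> x) = r \<odot>\<^bsub>N\<^esub> f x)}"

(* The locale algebra of HOL-Algebra.Module is restricted to commutative algebras. *)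
locale nc_algebra = module R A + ring A for R (structure) and A (structure) +
  assumes smult_mult_left:
      "\<lbrakk>r \<in> carrier R; x \<in> carrier A; y \<in> carrier A\<rbrakk> \<Longrightarrow>
        (r \<odot>\<^bsub>A\<^esub> x) \<otimes>\<^bsub>A\<^esub> y = r \<odot>\<^bsub>A\<^esub> (x \<otimes>\<^bsub>A\<^esub> y)"
    and smult_mult_right:
      "\<lbrakk>r \<in> carrier R; x \<in> carrier A; y \<in> carrier A\<rbrakk> \<Longrightarrow>
        x \<otimes>\<^bsub>A\<^esub> (r \<odot>\<^bsub>A\<^esub> y) = r \<odot>\<^bsub>A\<^esub> (x \<otimes>\<^bsub>A\<^esub> y)"

definition algebra_homs ::
  "('r, 'x) ring_scheme \<Rightarrow> ('r, 'a, 'y) module_scheme \<Rightarrow> ('r, 'b, 'z) module_scheme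
    \<Rightarrow> ('a \<Rightarrow> 'b) set" where
  "algebra_homs R A B = linear_maps R A B \<inter> ring_hom A B"

definition base_algebra :: "('r, 'x) ring_scheme \<Rightarrow> ('r, 'r) module" where
  "base_algebra R = \<lparr>carrier = carrier R, mult = mult R, one = one R,
     zero = zero R, add = add R, smult = mult R\<rparr>"

definition opposite :: "('r, 'a, 'y) module_scheme \<Rightarrow> ('r, 'a, 'y) module_scheme" where
  "opposite A = A\<lparr>mult := (\<lambda>x y. y \<otimes>\<^bsub>A\<^esub> x)\<rparr>"


section \<open>Tensor products\<close>

(* A formal sum m1 (x) n1 + ... + mk (x) nk is encoded as the list of the pairs (mi, ni);
   tensor_rel is the congruence on formal sums generated by commutativity and bilinearity.
   Additive inverses exist automatically: [(m, n), (- m, n)] ~ [(0, n)] ~ []. *)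
inductive tensor_rel ::
  "('r, 'x) ring_scheme \<Rightarrow> ('r, 'm, 'y) module_scheme \<Rightarrow> ('r, 'n, 'z) module_scheme
    \<Rightarrow> ('m \<times> 'n) list \<Rightarrow> ('m \<times> 'n) list \<Rightarrow> bool"
  for R and M and N where
  refl: "set xs \<subseteq> carrier M \<times> carrier N \<Longrightarrow> tensor_rel R M N xs xs"
| sym: "tensor_rel R M N xs ys \<Longrightarrow> tensor_rel R M N ys xs"
| trans: "tensor_rel R M N xs ys \<Longrightarrow> tensor_rel R M N ys zs \<Longrightarrow> tensor_rel R M N xs zs"
| append: "tensor_rel R M N xs xs' \<Longrightarrow> tensor_rel R M N ys ys' \<Longrightarrow>
    tensor_rel R M N (xs @ ys) (xs' @ ys')"
| commute: "set xs \<subseteq> carrier M \<times> carrier N \<Longrightarrow> set ys \<subseteq> carrier M \<times> carrier N \<Longrightarrow>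
    tensor_rel R M N (xs @ ys) (ys @ xs)"
| zero: "n \<in> carrier N \<Longrightarrow> tensor_rel R M N [(\<zero>\<^bsub>M\<^esub>, n)] []"
| add_left: "m \<in> carrier M \<Longrightarrow> m' \<in> carrier M \<Longrightarrow> n \<in> carrier N \<Longrightarrow>
    tensor_rel R M N [(m \<oplus>\<^bsub>M\<^esub> m', n)] [(m, n), (m', n)]"
| add_right: "m \<in> carrier M \<Longrightarrow> n \<in> carrier N \<Longrightarrow> n' \<in> carrier N \<Longrightarrow>
    tensor_rel R M N [(m, n \<oplus>\<^bsub>N\<^esub> n')] [(m, n), (m, n')]"
| balanced: "r \<in> carrier R \<Longrightarrow> m \<in> carrier M \<Longrightarrow> n \<in> carrier N \<Longrightarrow>
    tensor_rel R M N [(r \<odot>\<^bsub>M\<^esub> m, n)] [(m, r \<odot>\<^bsub>N\<^esub> n)]"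

definition tensor_class ::
  "('r, 'x) ring_scheme \<Rightarrow> ('r, 'm, 'y) module_scheme \<Rightarrow> ('r, 'n, 'z) module_scheme
    \<Rightarrow> ('m \<times> 'n) list \<Rightarrow> ('m \<times> 'n) list set" where
  "tensor_class R M N xs = {ys. tensor_rel R M N xs ys}"

definition formal_sum :: "('m \<times> 'n) list set \<Rightarrow> ('m \<times> 'n) list" where
  "formal_sum X = (SOME xs. xs \<in> X)"

(* mult and one are those of the tensor product algebra; they are meaningful only
   if M and N are algebras. *)
definition tensor ::
  "('r, 'x) ring_scheme \<Rightarrow> ('r, 'm, 'y) module_scheme \<Rightarrow> ('r, 'n, 'z) module_scheme
    \<Rightarrow> ('r, ('m \<times> 'n) list set) module" where
  "tensor R M N =
    \<lparr>carrier = tensor_class R M N ` {xs. set xs \<subseteq> carrier M \<times> carrier N},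
     mult = (\<lambda>X Y. tensor_class R M N
       [(m \<otimes>\<^bsub>M\<^esub> m', n \<otimes>\<^bsub>N\<^esub> n'). (m, n) \<leftarrow> formal_sum X, (m', n') \<leftarrow> formal_sum Y]),
     one = tensor_class R M N [(\<one>\<^bsub>M\<^esub>, \<one>\<^bsub>N\<^esub>)],
     zero = tensor_class R M N [],
     add = (\<lambda>X Y. tensor_class R M N (formal_sum X @ formal_sum Y)),
     smult = (\<lambda>r X. tensor_class R M N (map (\<lambda>(m, n). (r \<odot>\<^bsub>M\<^esub> m, n)) (formal_sum X)))\<rparr>"

definition simple_tensor ::
  "('r, 'x) ring_scheme \<Rightarrow> ('r, 'm, 'y) module_scheme \<Rightarrow> ('r, 'n, 'z) module_scheme
    \<Rightarrow> 'm \<Rightarrow> 'n \<Rightarrow> ('m \<times> 'n) list set" where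
  "simple_tensor R M N m n = tensor_class R M N [(m, n)]"

(* The linear map with values in P induced by a bilinear map f (junk if f is not bilinear). *)
definition tensor_lift ::
  "('r, 'p, 'x) module_scheme \<Rightarrow> ('m \<Rightarrow> 'n \<Rightarrow> 'p) \<Rightarrow> ('m \<times> 'n) list set \<Rightarrow> 'p" where
  "tensor_lift P f X = foldr (\<lambda>(m, n) s. f m n \<oplus>\<^bsub>P\<^esub> s) (formal_sum X) \<zero>\<^bsub>P\<^esub>"

(* f (x) g with values in the tensor product of P and Q *)
definition tensor_map ::
  "('r, 'x) ring_scheme \<Rightarrow> ('r, 'p, 'y) module_scheme \<Rightarrow> ('r, 'q, 'z) module_scheme
    \<Rightarrow> ('m \<Rightarrow> 'p) \<Rightarrow> ('n \<Rightarrow> 'q) \<Rightarrow> ('m \<times> 'n) list set \<Rightarrow> ('p \<times> 'q) list set" where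
  "tensor_map R P Q f g X = tensor_class R P Q (map (map_prod f g) (formal_sum X))"

(* The canonical isomorphism (L (x) M) (x) N -> L (x) (M (x) N). Iterated tensor products
   written without brackets are always bracketed to the right. *)
definition tensor_assoc ::
  "('r, 'w) ring_scheme \<Rightarrow> ('r, 'l, 'x) module_scheme \<Rightarrow> ('r, 'm, 'y) module_scheme
    \<Rightarrow> ('r, 'n, 'z) module_scheme
    \<Rightarrow> (('l \<times> 'm) list set \<times> 'n) list set \<Rightarrow> ('l \<times> ('m \<times> 'n) list set) list set" where
  "tensor_assoc R L M N =
    (let P = tensor R L (tensor R M N) in
      tensor_lift P (\<lambda>X n. tensor_lift P
        (\<lambda>l m. simple_tensor R L (tensor R M N) l (simple_tensor R M N m n)) X))"

definition tensor_assoc_inv ::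
  "('r, 'w) ring_scheme \<Rightarrow> ('r, 'l, 'x) module_scheme \<Rightarrow> ('r, 'm, 'y) module_scheme
    \<Rightarrow> ('r, 'n, 'z) module_scheme
    \<Rightarrow> ('l \<times> ('m \<times> 'n) list set) list set \<Rightarrow> (('l \<times> 'm) list set \<times> 'n) list set" where
  "tensor_assoc_inv R L M N =
    (let P = tensor R (tensor R L M) N in
      tensor_lift P (\<lambda>l. tensor_lift P
        (\<lambda>m n. simple_tensor R (tensor R L M) N (simple_tensor R L M l m) n)))"

definition mult_map :: "('r, 'a, 'x) module_scheme \<Rightarrow> ('a \<times> 'a) list set \<Rightarrow> 'a" where
  "mult_map A = tensor_lift A (\<lambda>x y. x \<otimes>\<^bsub>A\<^esub> y)"


section \<open>Faithfully flat modules\<close>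

definition exact_at ::
  "('r, 'm, 'x) module_scheme \<Rightarrow> ('r, 'n, 'y) module_scheme \<Rightarrow> ('r, 'p, 'z) module_scheme
    \<Rightarrow> ('m \<Rightarrow> 'n) \<Rightarrow> ('n \<Rightarrow> 'p) \<Rightarrow> bool" where
  "exact_at M' M M'' f g \<longleftrightarrow> f ` carrier M' = {m \<in> carrier M. g m = \<zero>\<^bsub>M''\<^esub>}"

(* HOL cannot quantify over modules of all types inside a formula, so the test modules have
   their elements in a fixed type 'u. *)
definition faithfully_flat ::
  "'u itself \<Rightarrow> ('r, 'x) ring_scheme \<Rightarrow> ('r, 'a, 'y) module_scheme \<Rightarrow> bool" where
  "faithfully_flat U R T \<longleftrightarrow> module R T \<and>
    (\<forall>(M' :: ('r, 'u) module) (M :: ('r, 'u) module) (M'' :: ('r, 'u) module) f g.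
      module R M' \<and> module R M \<and> module R M'' \<and>
      f \<in> linear_maps R M' M \<and> g \<in> linear_maps R M M'' \<longrightarrow>
      (exact_at M' M M'' f g \<longleftrightarrow>
       exact_at (tensor R T M') (tensor R T M) (tensor R T M'')
         (tensor_map R T M id f) (tensor_map R T M'' id g)))"

(* Every R-module of cardinality at most max(aleph_0, |R|, |T|) is isomorphic to one whose
   elements have this type. In particular, all finitely generated R-modules are covered,
   and flatness and faithful flatness can be tested on finitely generated modules, so
   faithful flatness with respect to this type is faithful flatness with respect to all
   modules. *)
datatype ('r, 'a) small = Scalar 'r | Element 'a | Tuple "('r, 'a) small list"


section \<open>Hopf algebras and Galois objects\<close>

locale hopf_algebra = nc_algebra R H
  for R (structure) and H :: "('r, 'h, 'y) module_scheme" (structure)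
    and \<Delta> :: "'h \<Rightarrow> ('h \<times> 'h) list set" and \<epsilon> :: "'h \<Rightarrow> 'r" +
  assumes comult_hom: "\<Delta> \<in> algebra_homs R H (tensor R H H)"
    and counit_hom: "\<epsilon> \<in> algebra_homs R H (base_algebra R)"
    and coassociative: "h \<in> carrier H \<Longrightarrow>
      tensor_assoc R H H H (tensor_map R (tensor R H H) H \<Delta> id (\<Delta> h))
        = tensor_map R H (tensor R H H) id \<Delta> (\<Delta> h)"
    and counit_left: "h \<in> carrier H \<Longrightarrow> tensor_lift H (\<lambda>a b. \<epsilon> a \<odot>\<^bsub>H\<^esub> b) (\<Delta> h) = h"
    and counit_right: "h \<in> carrier H \<Longrightarrow> tensor_lift H (\<lambda>a b. \<epsilon> b \<odot>\<^bsub>H\<^esub> a) (\<Delta> h) = h"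
    and antipode: "\<exists>S \<in> linear_maps R H H. \<forall>h\<in>carrier H.
      tensor_lift H (\<lambda>a b. S a \<otimes>\<^bsub>H\<^esub> b) (\<Delta> h) = \<epsilon> h \<odot>\<^bsub>H\<^esub> \<one>\<^bsub>H\<^esub> \<and>
      tensor_lift H (\<lambda>a b. a \<otimes>\<^bsub>H\<^esub> S b) (\<Delta> h) = \<epsilon> h \<odot>\<^bsub>H\<^esub> \<one>\<^bsub>H\<^esub>"

locale right_comodule_algebra = H: hopf_algebra R H \<Delta> \<epsilon> + A: nc_algebra R A
  for R (structure) and H :: "('r, 'h, 'y) module_scheme" (structure)
    and \<Delta> \<epsilon> and A :: "('r, 'a, 'z) module_scheme" (structure)
    and \<delta> :: "'a \<Rightarrow> ('a \<times> 'h) list set" +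
  assumes coaction_hom: "\<delta> \<in> algebra_homs R A (tensor R A H)"
    and coaction_coassociative: "x \<in> carrier A \<Longrightarrow>
      tensor_assoc R A H H (tensor_map R (tensor R A H) H \<delta> id (\<delta> x))
        = tensor_map R A (tensor R H H) id \<Delta> (\<delta> x)"
    and coaction_counit: "x \<in> carrier A \<Longrightarrow>
      tensor_lift A (\<lambda>a h. \<epsilon> h \<odot>\<^bsub>A\<^esub> a) (\<delta> x) = x"

definition galois_map ::
  "('r, 'x) ring_scheme \<Rightarrow> ('r, 'h, 'y) module_scheme \<Rightarrow> ('r, 'a, 'z) module_scheme
    \<Rightarrow> ('a \<Rightarrow> ('a \<times> 'h) list set) \<Rightarrow> ('a \<times> 'a) list set \<Rightarrow> ('a \<times> 'h) list set" where
  "galois_map R H A \<delta> = tensor_lift (tensor R A H)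
     (\<lambda>x y. tensor_map R A H (\<lambda>a. x \<otimes>\<^bsub>A\<^esub> a) id (\<delta> y))"

definition coinvariants ::
  "('r, 'x) ring_scheme \<Rightarrow> ('r, 'h, 'y) module_scheme \<Rightarrow> ('r, 'a, 'z) module_scheme
    \<Rightarrow> ('a \<Rightarrow> ('a \<times> 'h) list set) \<Rightarrow> 'a set" where
  "coinvariants R H A \<delta> = {x \<in> carrier A. \<delta> x = simple_tensor R A H x \<one>\<^bsub>H\<^esub>}"

(* The condition A^{co H} = k means that the unit map k -> A is a bijection onto A^{co H}. *)
locale right_galois_object = right_comodule_algebra +
  assumes galois_map_bij:
      "bij_betw (galois_map R H A \<delta>) (carrier (tensor R A A)) (carrier (tensor R A H))"
    and coinvariants_base:
      "bij_betw (\<lambda>r. r \<odot>\<^bsub>A\<^esub> \<one>\<^bsub>A\<^esub>) (carrier R) (coinvariants R H A \<delta>)"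


section \<open>Torsors\<close>

(* nabla on the first two factors of A (x) (A (x) M) *)
definition mult_first ::
  "('r, 'x) ring_scheme \<Rightarrow> ('r, 'a, 'y) module_scheme \<Rightarrow> ('r, 'm, 'z) module_scheme
    \<Rightarrow> ('a \<times> ('a \<times> 'm) list set) list set \<Rightarrow> ('a \<times> 'm) list set" where
  "mult_first R A M X = tensor_map R A M (mult_map A) id (tensor_assoc_inv R A A M X)"

(* The opposite algebra matters only for the multiplication: the underlying module of
   tensor R T (tensor R (opposite T) T) is that of tensor R T (tensor R T T). *)
locale torsor = nc_algebra R T
  for R (structure) and T :: "('r, 'a, 'y) module_scheme" (structure)
    and \<mu> :: "'a \<Rightarrow> ('a \<times> ('a \<times> 'a) list set) list set" +
  assumes torsor_hom: "\<mu> \<in> algebra_homs R T (tensor R T (tensor R (opposite T) T))"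
    and torsor_assoc: "x \<in> carrier T \<Longrightarrow>
      tensor_map R T (tensor R T (tensor R T (tensor R T T))) id (tensor_assoc R T T (tensor R T T))
        (tensor_assoc R T (tensor R T T) (tensor R T T)
          (tensor_map R (tensor R T (tensor R T T)) (tensor R T T) \<mu> id (\<mu> x)))
      = tensor_map R T (tensor R T (tensor R T (tensor R T T))) id
          (tensor_map R T (tensor R T (tensor R T T)) id \<mu>) (\<mu> x)"
    and torsor_left: "x \<in> carrier T \<Longrightarrow>
      mult_first R T T (\<mu> x) = simple_tensor R T T \<one>\<^bsub>T\<^esub> x"
    and torsor_right: "x \<in> carrier T \<Longrightarrow>
      tensor_map R T T id (mult_map T) (\<mu> x) = simple_tensor R T T x \<one>\<^bsub>T\<^esub>"

definition torsor_D ::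
  "('r, 'x) ring_scheme \<Rightarrow> ('r, 'a, 'y) module_scheme
    \<Rightarrow> ('a \<Rightarrow> ('a \<times> ('a \<times> 'a) list set) list set)
    \<Rightarrow> ('a \<times> 'a) list set \<Rightarrow> ('a \<times> ('a \<times> 'a) list set) list set" where
  "torsor_D R T \<mu> t = mult_first R T (tensor R T T)
     (tensor_map R T (tensor R T (tensor R T T)) id \<mu> t)"

definition torsor_H_carrier ::
  "('r, 'x) ring_scheme \<Rightarrow> ('r, 'a, 'y) module_scheme
    \<Rightarrow> ('a \<Rightarrow> ('a \<times> ('a \<times> 'a) list set) list set) \<Rightarrow> ('a \<times> 'a) list set set" where
  "torsor_H_carrier R T \<mu> =
    {t \<in> carrier (tensor R T T). torsor_D R T \<mu> t = simple_tensor R T (tensor R T T) \<one>\<^bsub>T\<^esub> t}"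

definition torsor_H ::
  "('r, 'x) ring_scheme \<Rightarrow> ('r, 'a, 'y) module_scheme
    \<Rightarrow> ('a \<Rightarrow> ('a \<times> ('a \<times> 'a) list set) list set) \<Rightarrow> ('r, ('a \<times> 'a) list set) module" where
  "torsor_H R T \<mu> = (tensor R (opposite T) T)\<lparr>carrier := torsor_H_carrier R T \<mu>\<rparr>"

(* The maps T (x) H -> T (x) T (x) T and H (x) H -> T (x) T (x) T (x) T induced by the
   inclusion of H in T (x) T. *)
definition TH_inclusion ::
  "('r, 'x) ring_scheme \<Rightarrow> ('r, 'a, 'y) module_scheme
    \<Rightarrow> ('a \<times> ('a \<times> 'a) list set) list set \<Rightarrow> ('a \<times> ('a \<times> 'a) list set) list set" where
  "TH_inclusion R T = tensor_map R T (tensor R T T) id id"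

definition HH_inclusion ::
  "('r, 'x) ring_scheme \<Rightarrow> ('r, 'a, 'y) module_scheme
    \<Rightarrow> (('a \<times> 'a) list set \<times> ('a \<times> 'a) list set) list set
    \<Rightarrow> ('a \<times> ('a \<times> ('a \<times> 'a) list set) list set) list set" where
  "HH_inclusion R T X =
     tensor_assoc R T T (tensor R T T) (tensor_map R (tensor R T T) (tensor R T T) id id X)"

end

theory Submission
  imports Defs
begin

text \<open>
  Write \<open>\<beta>\<close> for the Galois map of \<open>T\<close>. Composed with the inclusion of \<open>T \<otimes> H\<close> in \<open>T \<otimes> T \<otimes> T\<close> it is \<open>D\<close>, and
  \<open>t \<otimes> (x \<otimes> y) \<mapsto> tx \<otimes> y\<close> is its inverse. So \<open>T \<otimes> H \<cong> T \<otimes> T\<close>, which makes \<open>H\<close> flat; as \<open>H\<close> is a kernel,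
  flatness then identifies \<open>T \<otimes> H\<close> and \<open>H \<otimes> H\<close> with kernels inside tensor powers of \<open>T\<close>. This is how
  \<open>\<delta>\<close> and \<open>\<Delta>\<close> are obtained, while \<open>\<epsilon>\<close> comes from the descent criterion \<open>1 \<otimes> x = x \<otimes> 1 \<Longrightarrow> x \<in> k\<close>. All
  identities between these maps are checked after inclusion in tensor powers of \<open>T\<close>, where they
  reduce to the torsor axioms.

  For the antipode consider the Galois map \<open>can(g \<otimes> h) = g h\<^sub>1 \<otimes> h\<^sub>2\<close> of \<open>H\<close>. The two bijections
  \<open>x \<otimes> y \<otimes> z \<mapsto> x y\<^sub>0 z\<^sub>0 \<otimes> y\<^sub>1 \<otimes> z\<^sub>1\<close> and \<open>x \<otimes> y \<otimes> z \<mapsto> x y\<^sub>0 z\<^sub>0 \<otimes> y\<^sub>1 z\<^sub>1 \<otimes> z\<^sub>2\<close> from \<open>T \<otimes> T \<otimes> T\<close> to \<open>T \<otimes> H \<otimes> H\<close>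
  differ by \<open>T \<otimes> can\<close>, so \<open>can\<close> is bijective by faithful flatness, and a bialgebra whose Galois map is
  bijective has an antipode.
\<close>

section \<open>Tensor products of modules\<close>

text \<open>The proof is shaped by the fact that \<open>T (x) H\<close> and \<open>H (x) H\<close>
  are not subsets of tensor powers of \<open>T\<close>: a tensor is a class of formal sums, and the
  class of a sum over \<open>H\<close> in general differs from its class over
  \<open>T (x) T\<close>. The inclusions are therefore maps whose injectivity needs flatness, and
  \<open>\<delta>\<close>, \<open>\<Delta>\<close>, \<open>\<epsilon>\<close> arise by factoring
  known maps through injective ones. The kernel in question is that of \<open>D - (1 (x) -)\<close>.
  Its exact sequence survives \<open>T (x) -\<close> by assumption, and \<open>H (x) -\<close>
  because exactness may be tested after a further \<open>T (x) -\<close>, which turns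
  \<open>H\<close> into \<open>T\<close>. Axioms (i) and (iii) put the values of
  \<open>\<mu>\<close> into the kernel that is \<open>T (x) H\<close>; axiom (ii) gives one half of
  the invertibility of the Galois map, the definition of \<open>H\<close> the other. The antipode is
  not written in terms of \<open>\<mu>\<close> but read off the inverse of \<open>can\<close>.
  Faithful flatness is given only for test modules inside the type \<open>small\<close>, so each
  module it is applied to must be embedded there; closure of \<open>small\<close> under tuples
  allows this for iterated tensor products of \<open>k\<close>, \<open>T\<close> and
  \<open>H\<close>.\<close>

context cring
begin

abbreviation lin :: "('a, 'm, 'x) module_scheme \<Rightarrow> ('a, 'n, 'y) module_scheme \<Rightarrow> ('m \<Rightarrow> 'n) set" where
  "lin M N \<equiv> linear_maps R M N"

abbreviation tens :: "('a, 'm, 'x) module_scheme \<Rightarrow> ('a, 'n, 'y) module_scheme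
    \<Rightarrow> ('a, ('m \<times> 'n) list set) module" (infixr \<open>\<boxtimes>\<close> 75) where
  "M \<boxtimes> N \<equiv> tensor R M N"

abbreviation "simple \<equiv> simple_tensor R"
abbreviation "cls \<equiv> tensor_class R"
abbreviation "tmap \<equiv> tensor_map R"
abbreviation "lift \<equiv> tensor_lift"

definition bilin :: "('a, 'm, 'x) module_scheme \<Rightarrow> ('a, 'n, 'y) module_scheme
    \<Rightarrow> ('a, 'p, 'z) module_scheme \<Rightarrow> ('m \<Rightarrow> 'n \<Rightarrow> 'p) set" where
  "bilin M N P = {f. (\<forall>m\<in>carrier M. f m \<in> lin N P) \<and> (\<forall>n\<in>carrier N. (\<lambda>m. f m n) \<in> lin M P)}"

text \<open>The fold inside \<open>tensor_lift\<close>, taken over an explicit formal sum instead of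
  the representative picked by \<open>formal_sum\<close>; in this form its invariance under
  \<open>tensor_rel\<close> can be stated.\<close>

definition lsum :: "('a, 'p, 'x) module_scheme \<Rightarrow> ('m \<Rightarrow> 'n \<Rightarrow> 'p) \<Rightarrow> ('m \<times> 'n) list \<Rightarrow> 'p" where
  "lsum P f xs = foldr (\<lambda>(m, n) s. f m n \<oplus>\<^bsub>P\<^esub> s) xs \<zero>\<^bsub>P\<^esub>"

lemma linI:
  assumes "\<And>x. x \<in> carrier M \<Longrightarrow> f x \<in> carrier N"
    and "\<And>x y. x \<in> carrier M \<Longrightarrow> y \<in> carrier M \<Longrightarrow> f (x \<oplus>\<^bsub>M\<^esub> y) = f x \<oplus>\<^bsub>N\<^esub> f y"
    and "\<And>r x. r \<in> carrier R \<Longrightarrow> x \<in> carrier M \<Longrightarrow> f (r \<odot>\<^bsub>M\<^esub> x) = r \<odot>\<^bsub>N\<^esub> f x"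
  shows "f \<in> lin M N"
  using assms by (auto simp: linear_maps_def)

lemma lin_closed: "f \<in> lin M N \<Longrightarrow> x \<in> carrier M \<Longrightarrow> f x \<in> carrier N"
  and lin_add: "f \<in> lin M N \<Longrightarrow> x \<in> carrier M \<Longrightarrow> y \<in> carrier M \<Longrightarrow> f (x \<oplus>\<^bsub>M\<^esub> y) = f x \<oplus>\<^bsub>N\<^esub> f y"
  and lin_smult: "f \<in> lin M N \<Longrightarrow> r \<in> carrier R \<Longrightarrow> x \<in> carrier M \<Longrightarrow> f (r \<odot>\<^bsub>M\<^esub> x) = r \<odot>\<^bsub>N\<^esub> f x"
  by (auto simp: linear_maps_def)

lemma lin_zero:
  assumes "f \<in> lin M N" "module R M" "module R N"
  shows "f \<zero>\<^bsub>M\<^esub> = \<zero>\<^bsub>N\<^esub>"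
proof -
  interpret M: module R M by fact
  interpret N: module R N by fact
  have "f \<zero>\<^bsub>M\<^esub> = f (\<zero> \<odot>\<^bsub>M\<^esub> \<zero>\<^bsub>M\<^esub>)" by simp
  also have "\<dots> = \<zero>\<^bsub>N\<^esub>"
    using lin_smult[OF assms(1), of \<zero> "\<zero>\<^bsub>M\<^esub>"] lin_closed[OF assms(1), of "\<zero>\<^bsub>M\<^esub>"] by simp
  finally show ?thesis .
qed

lemma lin_minus:
  assumes "f \<in> lin M N" "module R M" "module R N" "x \<in> carrier M"
  shows "f (\<ominus>\<^bsub>M\<^esub> x) = \<ominus>\<^bsub>N\<^esub> f x"
proof -
  interpret M: module R M by fact
  interpret N: module R N by fact
  have "f (\<ominus>\<^bsub>M\<^esub> x) \<oplus>\<^bsub>N\<^esub> f x = \<zero>\<^bsub>N\<^esub>"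
    using lin_add[OF assms(1), of "\<ominus>\<^bsub>M\<^esub> x" x] assms lin_zero[OF assms(1-3)] by (simp add: M.l_neg)
  then show ?thesis
    using lin_closed[OF assms(1)] assms(4) by (simp add: N.minus_equality)
qed

lemma lin_id: "id \<in> lin M M"
  by (auto intro: linI)

lemma lin_comp: "g \<in> lin M N \<Longrightarrow> f \<in> lin N P \<Longrightarrow> f \<circ> g \<in> lin M P"
  by (rule linI) (auto simp: lin_closed lin_add lin_smult)

lemma lin_cong: "f \<in> lin M N \<Longrightarrow> (\<And>x. x \<in> carrier M \<Longrightarrow> f x = g x) \<Longrightarrow> module R M \<Longrightarrow> g \<in> lin M N"
proof (rule linI)
  assume f: "f \<in> lin M N" and eq: "\<And>x. x \<in> carrier M \<Longrightarrow> f x = g x" and "module R M"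
  then interpret M: module R M by simp
  fix x y r
  show "x \<in> carrier M \<Longrightarrow> g x \<in> carrier N" using f eq lin_closed by metis
  show "x \<in> carrier M \<Longrightarrow> y \<in> carrier M \<Longrightarrow> g (x \<oplus>\<^bsub>M\<^esub> y) = g x \<oplus>\<^bsub>N\<^esub> g y"
    using lin_add[OF f] by (simp flip: eq)
  show "r \<in> carrier R \<Longrightarrow> x \<in> carrier M \<Longrightarrow> g (r \<odot>\<^bsub>M\<^esub> x) = r \<odot>\<^bsub>N\<^esub> g x"
    using lin_smult[OF f] by (simp flip: eq)
qed

lemma bilinI:
  assumes "\<And>m. m \<in> carrier M \<Longrightarrow> f m \<in> lin N P" "\<And>n. n \<in> carrier N \<Longrightarrow> (\<lambda>m. f m n) \<in> lin M P"
  shows "f \<in> bilin M N P"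
  using assms by (auto simp: bilin_def)

lemma bilinI':
  assumes "\<And>m n. m \<in> carrier M \<Longrightarrow> n \<in> carrier N \<Longrightarrow> f m n \<in> carrier P"
    and "\<And>m m' n. m \<in> carrier M \<Longrightarrow> m' \<in> carrier M \<Longrightarrow> n \<in> carrier N \<Longrightarrow> f (m \<oplus>\<^bsub>M\<^esub> m') n = f m n \<oplus>\<^bsub>P\<^esub> f m' n"
    and "\<And>m n n'. m \<in> carrier M \<Longrightarrow> n \<in> carrier N \<Longrightarrow> n' \<in> carrier N \<Longrightarrow> f m (n \<oplus>\<^bsub>N\<^esub> n') = f m n \<oplus>\<^bsub>P\<^esub> f m n'"
    and "\<And>r m n. r \<in> carrier R \<Longrightarrow> m \<in> carrier M \<Longrightarrow> n \<in> carrier N \<Longrightarrow> f (r \<odot>\<^bsub>M\<^esub> m) n = r \<odot>\<^bsub>P\<^esub> f m n"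
    and "\<And>r m n. r \<in> carrier R \<Longrightarrow> m \<in> carrier M \<Longrightarrow> n \<in> carrier N \<Longrightarrow> f m (r \<odot>\<^bsub>N\<^esub> n) = r \<odot>\<^bsub>P\<^esub> f m n"
  shows "f \<in> bilin M N P"
  using assms by (auto simp: bilin_def intro!: linI)

lemma bilinD:
  assumes "f \<in> bilin M N P"
  shows "\<And>m. m \<in> carrier M \<Longrightarrow> f m \<in> lin N P" "\<And>n. n \<in> carrier N \<Longrightarrow> (\<lambda>m. f m n) \<in> lin M P"
    "\<And>m n. m \<in> carrier M \<Longrightarrow> n \<in> carrier N \<Longrightarrow> f m n \<in> carrier P"
    "\<And>m m' n. m \<in> carrier M \<Longrightarrow> m' \<in> carrier M \<Longrightarrow> n \<in> carrier N \<Longrightarrow> f (m \<oplus>\<^bsub>M\<^esub> m') n = f m n \<oplus>\<^bsub>P\<^esub> f m' n"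
    "\<And>m n n'. m \<in> carrier M \<Longrightarrow> n \<in> carrier N \<Longrightarrow> n' \<in> carrier N \<Longrightarrow> f m (n \<oplus>\<^bsub>N\<^esub> n') = f m n \<oplus>\<^bsub>P\<^esub> f m n'"
    "\<And>r m n. r \<in> carrier R \<Longrightarrow> m \<in> carrier M \<Longrightarrow> n \<in> carrier N \<Longrightarrow> f (r \<odot>\<^bsub>M\<^esub> m) n = r \<odot>\<^bsub>P\<^esub> f m n"
    "\<And>r m n. r \<in> carrier R \<Longrightarrow> m \<in> carrier M \<Longrightarrow> n \<in> carrier N \<Longrightarrow> f m (r \<odot>\<^bsub>N\<^esub> n) = r \<odot>\<^bsub>P\<^esub> f m n"
  using assms by (auto simp: bilin_def linear_maps_def Pi_iff)

lemma bilin_zero: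
  assumes "f \<in> bilin M N P" "module R M" "module R N" "module R P"
  shows "m \<in> carrier M \<Longrightarrow> f m \<zero>\<^bsub>N\<^esub> = \<zero>\<^bsub>P\<^esub>" "n \<in> carrier N \<Longrightarrow> f \<zero>\<^bsub>M\<^esub> n = \<zero>\<^bsub>P\<^esub>"
  using lin_zero[OF bilinD(1)[OF assms(1)] assms(3,4)] lin_zero[OF bilinD(2)[OF assms(1)] assms(2,4)] by auto

lemma lsum_simps [simp]:
  "lsum P f [] = \<zero>\<^bsub>P\<^esub>" "lsum P f ((m, n) # xs) = f m n \<oplus>\<^bsub>P\<^esub> lsum P f xs"
  by (simp_all add: lsum_def)

lemma lsum_closed:
  assumes "f \<in> bilin M N P" "module R P" "set xs \<subseteq> carrier M \<times> carrier N"
  shows "lsum P f xs \<in> carrier P"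
proof -
  interpret P: module R P by fact
  show ?thesis using assms(3) by (induction xs) (auto simp: bilinD(3)[OF assms(1)])
qed

lemma lsum_append:
  assumes "f \<in> bilin M N P" "module R P" "set xs \<subseteq> carrier M \<times> carrier N" "set ys \<subseteq> carrier M \<times> carrier N"
  shows "lsum P f (xs @ ys) = lsum P f xs \<oplus>\<^bsub>P\<^esub> lsum P f ys"
proof -
  interpret P: module R P by fact
  show ?thesis using assms(3)
    by (induction xs) (auto simp: bilinD(3)[OF assms(1)] lsum_closed[OF assms(1,2)] assms(4) P.a_assoc)
qed

context
  fixes M :: "('a, 'm, 'x) module_scheme" and N :: "('a, 'n, 'y) module_scheme"
  assumes MM: "module R M" and NN: "module R N"
begin

private abbreviation "MN \<equiv> M \<boxtimes> N"

interpretation M: module R M by (fact MM)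
interpretation N: module R N by (fact NN)

lemma tensor_rel_carrier:
  "tensor_rel R M N xs ys \<Longrightarrow> set xs \<subseteq> carrier M \<times> carrier N \<and> set ys \<subseteq> carrier M \<times> carrier N"
  by (induction rule: tensor_rel.induct) auto

lemma cls_eqI: "tensor_rel R M N xs ys \<Longrightarrow> cls M N xs = cls M N ys"
  unfolding tensor_class_def by (auto intro: tensor_rel.sym tensor_rel.trans)

text \<open>The operations on tensors work on a representative picked by choice. This links the pick
  to any given representative, and all the \<open>_cls\<close> computation rules rest on it.\<close>

lemma formal_sum_cls:
  assumes "set xs \<subseteq> carrier M \<times> carrier N"
  shows "tensor_rel R M N xs (formal_sum (cls M N xs))"
proof -
  have "xs \<in> cls M N xs" by (simp add: tensor_class_def tensor_rel.refl assms)
  then have "formal_sum (cls M N xs) \<in> cls M N xs" unfolding formal_sum_def by (rule someI)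
  then show ?thesis by (simp add: tensor_class_def)
qed

lemma formal_sum_carrier:
  assumes "X \<in> carrier MN"
  shows "set (formal_sum X) \<subseteq> carrier M \<times> carrier N" "cls M N (formal_sum X) = X"
proof -
  obtain xs where xs: "set xs \<subseteq> carrier M \<times> carrier N" "X = cls M N xs"
    using assms by (auto simp: tensor_def)
  note r = formal_sum_cls[OF xs(1)]
  show "set (formal_sum X) \<subseteq> carrier M \<times> carrier N" "cls M N (formal_sum X) = X"
    using tensor_rel_carrier[OF r] cls_eqI[OF r] xs(2) by simp_all
qed

lemma cls_closed: "set xs \<subseteq> carrier M \<times> carrier N \<Longrightarrow> cls M N xs \<in> carrier MN"
  by (auto simp: tensor_def)

lemma cls_E:
  assumes "X \<in> carrier MN"
  obtains xs where "set xs \<subseteq> carrier M \<times> carrier N" "X = cls M N xs"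
  using assms by (auto simp: tensor_def)

text \<open>Well-definedness behind the universal property: each generator of the congruence is one
  of the laws of a bilinear map, or commutativity of addition in \<open>P\<close>.\<close>

lemma lsum_rel:
  assumes f: "f \<in> bilin M N P" and P: "module R P"
    and rel: "tensor_rel R M N xs ys"
  shows "lsum P f xs = lsum P f ys"
proof -
  interpret P: module R P by fact
  note [simp] = bilinD(3-7)[OF f] bilin_zero[OF f MM NN P]
  show ?thesis using rel
  proof (induction rule: tensor_rel.induct)
    case (append xs xs' ys ys')
    then show ?case using tensor_rel_carrier lsum_append[OF f P] by metis
  next
    case (commute xs ys)
    then show ?case by (simp add: lsum_append[OF f P] P.a_comm lsum_closed[OF f P])
  qed (auto simp: P.a_assoc)
qed

lemma lift_cls:
  assumes "f \<in> bilin M N P" "module R P" "set xs \<subseteq> carrier M \<times> carrier N"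
  shows "lift P f (cls M N xs) = lsum P f xs"
  using lsum_rel[OF assms(1,2) formal_sum_cls[OF assms(3)]] by (simp add: tensor_lift_def lsum_def)

lemma map_rel:
  assumes f: "f \<in> lin M P" and g: "g \<in> lin N Q" and P: "module R P" and Q: "module R Q"
    and rel: "tensor_rel R M N xs ys"
  shows "tensor_rel R P Q (map (map_prod f g) xs) (map (map_prod f g) ys)"
proof -
  note [simp] = lin_closed[OF f] lin_add[OF f] lin_smult[OF f] lin_zero[OF f MM P]
    lin_closed[OF g] lin_add[OF g] lin_smult[OF g]
  have c: "set (map (map_prod f g) zs) \<subseteq> carrier P \<times> carrier Q" if "set zs \<subseteq> carrier M \<times> carrier N" for zs
    using that by (induction zs) auto
  show ?thesis using rel
  proof (induction rule: tensor_rel.induct)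
    case (trans xs ys zs)
    then show ?case by (blast intro: tensor_rel.trans)
  next
    case (append xs xs' ys ys')
    then show ?case by (simp add: tensor_rel.append)
  next
    case (sym xs ys)
    show ?case by (rule tensor_rel.sym) (rule sym.IH)
  next
    case (commute xs ys)
    then show ?case by (simp add: tensor_rel.commute c del: set_map)
  next
    case (refl xs)
    then show ?case by (simp add: tensor_rel.refl c del: set_map)
  qed (auto intro: tensor_rel.refl tensor_rel.zero tensor_rel.add_left tensor_rel.add_right tensor_rel.balanced)
qed

lemma tmap_cls:
  assumes "f \<in> lin M P" "g \<in> lin N Q" "module R P" "module R Q" "set xs \<subseteq> carrier M \<times> carrier N"
  shows "tmap P Q f g (cls M N xs) = cls P Q (map (map_prod f g) xs)"
  unfolding tensor_map_def tensor_class_def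
  using map_rel[OF assms(1-4) formal_sum_cls[OF assms(5)]]
  by (auto simp: tensor_class_def intro: tensor_rel.sym tensor_rel.trans)

lemma add_cls:
  assumes "set xs \<subseteq> carrier M \<times> carrier N" "set ys \<subseteq> carrier M \<times> carrier N"
  shows "cls M N xs \<oplus>\<^bsub>MN\<^esub> cls M N ys = cls M N (xs @ ys)"
  using assms by (auto simp: tensor_def intro!: cls_eqI tensor_rel.append formal_sum_cls[THEN tensor_rel.sym])

lemma zero_cls: "\<zero>\<^bsub>MN\<^esub> = cls M N []"
  by (simp add: tensor_def)

text \<open>Scaling is \<open>tensor_map\<close> of the linear map \<open>m \<mapsto> r m\<close>
  with the identity, so independence of the representative is already contained in
  \<open>tmap_cls\<close>. That scaling is linear uses commutativity of \<open>R\<close>.\<close>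

lemma smult_cls:
  assumes "r \<in> carrier R" "set xs \<subseteq> carrier M \<times> carrier N"
  shows "r \<odot>\<^bsub>MN\<^esub> cls M N xs = cls M N (map (\<lambda>(m, n). (r \<odot>\<^bsub>M\<^esub> m, n)) xs)"
proof -
  have "(\<lambda>m. r \<odot>\<^bsub>M\<^esub> m) \<in> lin M M"
    using assms(1) by (intro linI) (auto simp: M.smult_r_distr M.smult_assoc1[symmetric] m_comm)
  from tmap_cls[OF this lin_id MM NN assms(2)] show ?thesis
    by (simp add: tensor_def tensor_map_def map_prod_def id_def)
qed

lemma cls_Cons:
  assumes "m \<in> carrier M" "n \<in> carrier N" "set xs \<subseteq> carrier M \<times> carrier N"
  shows "cls M N ((m, n) # xs) = simple M N m n \<oplus>\<^bsub>MN\<^esub> cls M N xs"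
  using assms by (simp add: simple_tensor_def add_cls)

lemma simple_closed: "m \<in> carrier M \<Longrightarrow> n \<in> carrier N \<Longrightarrow> simple M N m n \<in> carrier MN"
  by (simp add: simple_tensor_def cls_closed)

lemma simple_add_left:
  "m \<in> carrier M \<Longrightarrow> m' \<in> carrier M \<Longrightarrow> n \<in> carrier N \<Longrightarrow>
    simple M N (m \<oplus>\<^bsub>M\<^esub> m') n = simple M N m n \<oplus>\<^bsub>MN\<^esub> simple M N m' n"
  by (simp add: simple_tensor_def add_cls cls_eqI tensor_rel.add_left)

lemma simple_add_right:
  "m \<in> carrier M \<Longrightarrow> n \<in> carrier N \<Longrightarrow> n' \<in> carrier N \<Longrightarrow>
    simple M N m (n \<oplus>\<^bsub>N\<^esub> n') = simple M N m n \<oplus>\<^bsub>MN\<^esub> simple M N m n'"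
  by (simp add: simple_tensor_def add_cls cls_eqI tensor_rel.add_right)

lemma simple_smult_left:
  "r \<in> carrier R \<Longrightarrow> m \<in> carrier M \<Longrightarrow> n \<in> carrier N \<Longrightarrow>
    simple M N (r \<odot>\<^bsub>M\<^esub> m) n = r \<odot>\<^bsub>MN\<^esub> simple M N m n"
  by (simp add: simple_tensor_def smult_cls)

lemma simple_smult_right:
  "r \<in> carrier R \<Longrightarrow> m \<in> carrier M \<Longrightarrow> n \<in> carrier N \<Longrightarrow>
    simple M N m (r \<odot>\<^bsub>N\<^esub> n) = r \<odot>\<^bsub>MN\<^esub> simple M N m n"
  unfolding simple_smult_left[symmetric]
  by (simp add: simple_tensor_def cls_eqI tensor_rel.balanced tensor_rel.sym)

lemma tensor_abelian_monoid: "abelian_monoid MN"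
proof (rule abelian_monoidI)
  fix x y z
  assume "x \<in> carrier MN" "y \<in> carrier MN" "z \<in> carrier MN"
  then obtain xs ys zs where *: "set xs \<subseteq> carrier M \<times> carrier N" "set ys \<subseteq> carrier M \<times> carrier N"
    "set zs \<subseteq> carrier M \<times> carrier N" "x = cls M N xs" "y = cls M N ys" "z = cls M N zs"
    by (auto simp: tensor_def)
  then show "(x \<oplus>\<^bsub>MN\<^esub> y) \<oplus>\<^bsub>MN\<^esub> z = x \<oplus>\<^bsub>MN\<^esub> (y \<oplus>\<^bsub>MN\<^esub> z)"
    by (simp add: add_cls)
  show "x \<oplus>\<^bsub>MN\<^esub> y = y \<oplus>\<^bsub>MN\<^esub> x"
    using * by (simp add: add_cls cls_eqI tensor_rel.commute)
qed (auto elim!: cls_E simp: zero_cls add_cls cls_closed)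

text \<open>The congruence has no rule for negatives. Negating the left entries works, since
  \<open>(-m, n), (m, n)\<close> is congruent to \<open>(0, n)\<close> and thus to the empty
  sum.\<close>

lemma cls_neg:
  assumes "set xs \<subseteq> carrier M \<times> carrier N"
  shows "\<exists>y\<in>carrier MN. y \<oplus>\<^bsub>MN\<^esub> cls M N xs = \<zero>\<^bsub>MN\<^esub>"
proof -
  interpret X: abelian_monoid "M \<boxtimes> N" by (rule tensor_abelian_monoid)
  show ?thesis using assms
  proof (induction xs)
    case Nil
    show ?case by (rule bexI[of _ "\<zero>\<^bsub>MN\<^esub>"]) (auto simp: zero_cls[symmetric])
  next
    case (Cons p xs)
    obtain m n where p: "p = (m, n)" "m \<in> carrier M" "n \<in> carrier N" using Cons.prems by auto
    obtain y where y: "y \<in> carrier MN" "y \<oplus>\<^bsub>MN\<^esub> cls M N xs = \<zero>\<^bsub>MN\<^esub>" using Cons by auto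
    have n0: "simple M N (\<ominus>\<^bsub>M\<^esub> m) n \<oplus>\<^bsub>MN\<^esub> simple M N m n = \<zero>\<^bsub>MN\<^esub>"
      using p by (simp add: simple_add_left[symmetric] M.l_neg)
        (simp add: simple_tensor_def zero_cls cls_eqI tensor_rel.zero)
    have c: "simple M N (\<ominus>\<^bsub>M\<^esub> m) n \<in> carrier MN" "simple M N m n \<in> carrier MN" "cls M N xs \<in> carrier MN"
      using p Cons.prems by (auto intro: simple_closed cls_closed)
    have "(y \<oplus>\<^bsub>MN\<^esub> simple M N (\<ominus>\<^bsub>M\<^esub> m) n) \<oplus>\<^bsub>MN\<^esub> (simple M N m n \<oplus>\<^bsub>MN\<^esub> cls M N xs)
      = (simple M N (\<ominus>\<^bsub>M\<^esub> m) n \<oplus>\<^bsub>MN\<^esub> simple M N m n) \<oplus>\<^bsub>MN\<^esub> (y \<oplus>\<^bsub>MN\<^esub> cls M N xs)"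
      using c y(1) by (simp add: X.a_ac)
    then show ?case using p n0 y c Cons.prems
      by (intro bexI[of _ "y \<oplus>\<^bsub>MN\<^esub> simple M N (\<ominus>\<^bsub>M\<^esub> m) n"]) (auto simp: cls_Cons)
  qed
qed

lemma tensor_module: "module R MN"
proof (rule moduleI)
  interpret X: abelian_monoid "M \<boxtimes> N" by (rule tensor_abelian_monoid)
  show "cring R" ..
  have neg: "\<exists>y\<in>carrier MN. y \<oplus>\<^bsub>MN\<^esub> x = \<zero>\<^bsub>MN\<^esub>" if "x \<in> carrier MN" for x
    using that cls_neg by (auto elim: cls_E)
  show "abelian_group MN"
    by (rule abelian_groupI) (simp_all add: X.a_assoc neg, simp add: X.a_comm)
  show "\<one> \<odot>\<^bsub>MN\<^esub> x = x" if x: "x \<in> carrier MN" for x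
  proof -
    obtain xs where xs: "set xs \<subseteq> carrier M \<times> carrier N" "x = cls M N xs" using x by (rule cls_E)
    have "map (\<lambda>(m, n). (\<one> \<odot>\<^bsub>M\<^esub> m, n)) xs = xs"
      using xs(1) by (induction xs) auto
    then show ?thesis using xs by (simp add: smult_cls)
  qed
  fix a b x y
  assume a: "a \<in> carrier R" and b: "b \<in> carrier R" and x: "x \<in> carrier MN" and y: "y \<in> carrier MN"
  from x y obtain xs ys where xs: "set xs \<subseteq> carrier M \<times> carrier N" "x = cls M N xs"
    and ys: "set ys \<subseteq> carrier M \<times> carrier N" "y = cls M N ys" by (auto simp: tensor_def)
  have c: "set (map (\<lambda>(m, n). (r \<odot>\<^bsub>M\<^esub> m, n)) zs) \<subseteq> carrier M \<times> carrier N"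
    if "r \<in> carrier R" "set zs \<subseteq> carrier M \<times> carrier N" for r zs using that by auto
  show "a \<odot>\<^bsub>MN\<^esub> x \<in> carrier MN" using a xs c by (simp add: smult_cls cls_closed)
  show "a \<odot>\<^bsub>MN\<^esub> (x \<oplus>\<^bsub>MN\<^esub> y) = a \<odot>\<^bsub>MN\<^esub> x \<oplus>\<^bsub>MN\<^esub> a \<odot>\<^bsub>MN\<^esub> y"
    using a xs ys c[OF a] by (simp add: smult_cls add_cls)
  show "(a \<otimes> b) \<odot>\<^bsub>MN\<^esub> x = a \<odot>\<^bsub>MN\<^esub> (b \<odot>\<^bsub>MN\<^esub> x)"
    using a b xs c[OF b] by (simp add: smult_cls) (auto simp: M.smult_assoc1 dest!: subsetD[OF xs(1)] intro!: arg_cong[where f = "cls M N"])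
  \<comment> \<open>The sum with entries \<open>(a + b) m\<close> is not literally the concatenation
    of the other two, only congruent to a permutation of it; the induction splits one entry at a
    time.\<close>
  have "cls M N (map (\<lambda>(m, n). ((a \<oplus> b) \<odot>\<^bsub>M\<^esub> m, n)) xs) =
    cls M N (map (\<lambda>(m, n). (a \<odot>\<^bsub>M\<^esub> m, n)) xs) \<oplus>\<^bsub>MN\<^esub> cls M N (map (\<lambda>(m, n). (b \<odot>\<^bsub>M\<^esub> m, n)) xs)"
    using xs(1)
  proof (induction xs)
    case Nil show ?case by (simp add: zero_cls[symmetric])
  next
    case (Cons p xs)
    obtain m n where p: "p = (m, n)" "m \<in> carrier M" "n \<in> carrier N" using Cons.prems by auto
    then have "cls M N (map (\<lambda>(m, n). ((a \<oplus> b) \<odot>\<^bsub>M\<^esub> m, n)) (p # xs)) =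
      (simple M N (a \<odot>\<^bsub>M\<^esub> m) n \<oplus>\<^bsub>MN\<^esub> simple M N (b \<odot>\<^bsub>M\<^esub> m) n) \<oplus>\<^bsub>MN\<^esub>
      (cls M N (map (\<lambda>(m, n). (a \<odot>\<^bsub>M\<^esub> m, n)) xs) \<oplus>\<^bsub>MN\<^esub> cls M N (map (\<lambda>(m, n). (b \<odot>\<^bsub>M\<^esub> m, n)) xs))"
      using Cons a b c[of _ xs] by (simp add: cls_Cons M.smult_l_distr simple_add_left)
    then show ?case using p a b Cons.prems c[of _ xs]
      by (simp add: cls_Cons simple_closed cls_closed X.a_ac)
  qed
  then show "(a \<oplus> b) \<odot>\<^bsub>MN\<^esub> x = a \<odot>\<^bsub>MN\<^esub> x \<oplus>\<^bsub>MN\<^esub> b \<odot>\<^bsub>MN\<^esub> x"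
    using a b xs by (simp add: smult_cls)
qed

lemma tensor_induct_aux [consumes 1, case_names zero simple add]:
  assumes "X \<in> carrier MN" "Q \<zero>\<^bsub>MN\<^esub>"
    and s: "\<And>m n. m \<in> carrier M \<Longrightarrow> n \<in> carrier N \<Longrightarrow> Q (simple M N m n)"
    and a: "\<And>x y. x \<in> carrier MN \<Longrightarrow> y \<in> carrier MN \<Longrightarrow> Q x \<Longrightarrow> Q y \<Longrightarrow> Q (x \<oplus>\<^bsub>MN\<^esub> y)"
  shows "Q X"
proof -
  obtain xs where xs: "set xs \<subseteq> carrier M \<times> carrier N" "X = cls M N xs" using assms(1) by (rule cls_E)
  have "Q (cls M N xs)" using xs(1)
  proof (induction xs)
    case Nil show ?case using assms(2) by (simp add: zero_cls)
  next
    case (Cons p xs)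
    then show ?case by (cases p) (auto simp: cls_Cons simple_closed cls_closed s intro!: a)
  qed
  then show ?thesis by (simp add: xs)
qed

lemma simple_bilin: "simple M N \<in> bilin M N MN"
  by (rule bilinI') (simp_all add: simple_closed simple_add_left simple_add_right simple_smult_left simple_smult_right)

lemma lift_simple:
  assumes "f \<in> bilin M N P" "module R P" "m \<in> carrier M" "n \<in> carrier N"
  shows "lift P f (simple M N m n) = f m n"
proof -
  interpret P: module R P by fact
  show ?thesis using assms by (simp add: simple_tensor_def lift_cls bilinD(3)[OF assms(1)])
qed

lemma lift_lin:
  assumes f: "f \<in> bilin M N P" and P: "module R P"
  shows "lift P f \<in> lin MN P"
proof -
  interpret P: module R P by fact
  show ?thesis
  proof (rule linI)
    fix r x assume r: "r \<in> carrier R" and "x \<in> carrier MN"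
    then obtain xs where xs: "set xs \<subseteq> carrier M \<times> carrier N" "x = cls M N xs" by (auto elim: cls_E)
    have c: "set (map (\<lambda>(m, n). (r \<odot>\<^bsub>M\<^esub> m, n)) xs) \<subseteq> carrier M \<times> carrier N"
      using r xs(1) by auto
    have "lsum P f (map (\<lambda>(m, n). (r \<odot>\<^bsub>M\<^esub> m, n)) xs) = r \<odot>\<^bsub>P\<^esub> lsum P f xs"
      using xs(1) r
      by (induction xs) (auto simp: bilinD(3,6)[OF f] lsum_closed[OF f P] P.smult_r_distr)
    then show "lift P f (r \<odot>\<^bsub>MN\<^esub> x) = r \<odot>\<^bsub>P\<^esub> lift P f x"
      using xs c r by (simp add: smult_cls lift_cls[OF f P])
  qed (auto elim!: cls_E simp: add_cls lift_cls[OF f P] lsum_append[OF f P] lsum_closed[OF f P])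
qed

text \<open>The device behind almost every identity below. The quantified conclusion lets
  unification read off \<open>F\<close> and \<open>G\<close>, usually compositions, from a stated
  equation of maps before an element is supplied.\<close>

lemma tensor_eqI:
  assumes F: "F \<in> lin MN P" and G: "G \<in> lin MN P" and P: "module R P"
    and eq: "\<And>m n. m \<in> carrier M \<Longrightarrow> n \<in> carrier N \<Longrightarrow> F (simple M N m n) = G (simple M N m n)"
  shows "\<forall>z\<in>carrier MN. F z = G z"
proof
  fix z assume "z \<in> carrier MN"
  then show "F z = G z"
    by (induction rule: tensor_induct_aux)
      (simp_all add: eq lin_add[OF F] lin_add[OF G] lin_zero[OF F tensor_module P] lin_zero[OF G tensor_module P])
qed

lemma tmap_simple:
  assumes "f \<in> lin M P" "g \<in> lin N Q" "module R P" "module R Q" "m \<in> carrier M" "n \<in> carrier N"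
  shows "tmap P Q f g (simple M N m n) = simple P Q (f m) (g n)"
  using tmap_cls[OF assms(1-4), of "[(m, n)]"] assms(5,6) by (simp add: simple_tensor_def)

end

lemmas tensor_induct [consumes 3, case_names zero simple add] = tensor_induct_aux

lemma bilin_cong:
  assumes "f \<in> bilin M N P" "\<And>m n. m \<in> carrier M \<Longrightarrow> n \<in> carrier N \<Longrightarrow> f m n = g m n" "module R M" "module R N"
  shows "g \<in> bilin M N P"
  using assms by (auto intro!: bilinI intro: lin_cong[OF bilinD(1)[OF assms(1)]] lin_cong[OF bilinD(2)[OF assms(1)]])

lemma tmap_lin:
  assumes f: "f \<in> lin M P" and g: "g \<in> lin N Q" and M: "module R M" "module R N" "module R P" "module R Q"
  shows "tmap P Q f g \<in> lin (M \<boxtimes> N) (P \<boxtimes> Q)"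
proof (rule linI)
  have c: "set (map (map_prod f g) xs) \<subseteq> carrier P \<times> carrier Q" if "set xs \<subseteq> carrier M \<times> carrier N" for xs
    using that lin_closed[OF f] lin_closed[OF g] by auto
  fix x y r assume x: "x \<in> carrier (M \<boxtimes> N)"
  then obtain xs where xs: "set xs \<subseteq> carrier M \<times> carrier N" "x = cls M N xs" by (auto elim: cls_E[OF M(1,2)])
  note t = tmap_cls[OF M(1,2) f g M(3,4)]
  show "tmap P Q f g x \<in> carrier (P \<boxtimes> Q)"
    using xs c by (simp add: t cls_closed[OF M(3,4)])
  { assume "y \<in> carrier (M \<boxtimes> N)"
    then obtain ys where ys: "set ys \<subseteq> carrier M \<times> carrier N" "y = cls M N ys" by (auto elim: cls_E[OF M(1,2)])
    show "tmap P Q f g (x \<oplus>\<^bsub>M \<boxtimes> N\<^esub> y) = tmap P Q f g x \<oplus>\<^bsub>P \<boxtimes> Q\<^esub> tmap P Q f g y"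
      using xs ys c[OF xs(1)] c[OF ys(1)] by (simp add: t add_cls M) }
  { assume r: "r \<in> carrier R"
    interpret M: module R M by fact
    have c': "set (map (\<lambda>(m, n). (r \<odot>\<^bsub>M\<^esub> m, n)) xs) \<subseteq> carrier M \<times> carrier N"
      using r xs(1) by auto
    show "tmap P Q f g (r \<odot>\<^bsub>M \<boxtimes> N\<^esub> x) = r \<odot>\<^bsub>P \<boxtimes> Q\<^esub> tmap P Q f g x"
      using xs r c[OF xs(1)] c'
      by (simp add: smult_cls[OF M(1,2)] smult_cls[OF M(3,4)] t)
        (auto simp: lin_smult[OF f] dest!: subsetD[OF xs(1)] intro!: arg_cong[where f = "cls P Q"]) }
qed


declare tensor_module [simp]

section \<open>Associativity, symmetry and linear isomorphisms of tensor products\<close>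

abbreviation "assoc \<equiv> tensor_assoc R"
abbreviation "assoc_inv \<equiv> tensor_assoc_inv R"

lemma simple_lin_right: "module R M \<Longrightarrow> module R N \<Longrightarrow> m \<in> carrier M \<Longrightarrow> simple M N m \<in> lin N (M \<boxtimes> N)"
  and simple_lin_left: "module R M \<Longrightarrow> module R N \<Longrightarrow> n \<in> carrier N \<Longrightarrow> (\<lambda>m. simple M N m n) \<in> lin M (M \<boxtimes> N)"
  by (auto intro: bilinD(1)[OF simple_bilin] bilinD(2)[OF simple_bilin])

lemma lin_plus:
  assumes f: "f \<in> lin M N" and g: "g \<in> lin M N" and N: "module R N"
  shows "(\<lambda>x. f x \<oplus>\<^bsub>N\<^esub> g x) \<in> lin M N"
proof -
  interpret N: module R N by fact
  show ?thesis
    by (rule linI) (simp_all add: lin_add[OF f] lin_add[OF g] lin_smult[OF f] lin_smult[OF g]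
        lin_closed[OF f] lin_closed[OF g] N.a_ac N.smult_r_distr)
qed

lemma lin_scale:
  assumes f: "f \<in> lin M N" and r: "r \<in> carrier R" and N: "module R N"
  shows "(\<lambda>x. r \<odot>\<^bsub>N\<^esub> f x) \<in> lin M N"
proof -
  interpret N: module R N by fact
  show ?thesis
    by (rule linI) (simp_all add: lin_add[OF f] lin_smult[OF f] r m_comm
        lin_closed[OF f] N.smult_assoc1[symmetric] N.smult_r_distr)
qed

lemma lin_diff:
  assumes f: "f \<in> lin M N" and g: "g \<in> lin M N" and N: "module R N"
  shows "(\<lambda>x. f x \<ominus>\<^bsub>N\<^esub> g x) \<in> lin M N"
proof -
  interpret N: module R N by fact
  show ?thesis
    by (rule linI) (simp_all add: lin_add[OF f] lin_add[OF g] lin_smult[OF f] lin_smult[OF g]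
        lin_closed[OF f] lin_closed[OF g] N.a_ac N.smult_r_distr N.smult_r_minus N.minus_add a_minus_def)
qed

lemma lin_zero_map: "module R N \<Longrightarrow> (\<lambda>x. \<zero>\<^bsub>N\<^esub>) \<in> lin M N"
proof -
  assume "module R N"
  then interpret N: module R N by simp
  show ?thesis by (rule linI) simp_all
qed

text \<open>Linearity in the parameter \<open>n\<close> is an equation between maps that are linear
  in \<open>X\<close>, so it may be checked on simple tensors. Associativity maps and the product of
  a tensor algebra are nested lifts of this kind.\<close>

lemma bilin_lift_left:
  assumes M: "module R L" "module R M" "module R P"
    and h: "\<And>n. n \<in> carrier N \<Longrightarrow> h n \<in> bilin L M P"
    and h': "\<And>l m. l \<in> carrier L \<Longrightarrow> m \<in> carrier M \<Longrightarrow> (\<lambda>n. h n l m) \<in> lin N P"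
    and N: "module R N"
  shows "(\<lambda>X n. lift P (h n) X) \<in> bilin (L \<boxtimes> M) N P"
proof (rule bilinI)
  interpret N: module R N by fact
  show "(\<lambda>X. lift P (h n) X) \<in> lin (L \<boxtimes> M) P" if "n \<in> carrier N" for n
    using lift_lin[OF M(1,2) h M(3)] that by simp
  fix X assume X: "X \<in> carrier (L \<boxtimes> M)"
  note [simp] = lift_simple[OF M(1,2) h M(3)] lin_closed[OF h'] lin_add[OF h'] lin_smult[OF h']
  note ll = lift_lin[OF M(1,2) h M(3)]
  show "(\<lambda>n. lift P (h n) X) \<in> lin N P"
  proof (rule linI)
    show "n \<in> carrier N \<Longrightarrow> lift P (h n) X \<in> carrier P" for n using ll X lin_closed by metis
    show "lift P (h (n \<oplus>\<^bsub>N\<^esub> n')) X = lift P (h n) X \<oplus>\<^bsub>P\<^esub> lift P (h n') X"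
      if "n \<in> carrier N" "n' \<in> carrier N" for n n'
      by (rule bspec[OF tensor_eqI[OF M(1,2) ll lin_plus[OF ll ll] M(3)]]) (use that X in \<open>simp_all add: M\<close>)
    show "lift P (h (r \<odot>\<^bsub>N\<^esub> n)) X = r \<odot>\<^bsub>P\<^esub> lift P (h n) X"
      if "r \<in> carrier R" "n \<in> carrier N" for r n
      by (rule bspec[OF tensor_eqI[OF M(1,2) ll lin_scale[OF ll] M(3)]]) (use that X in \<open>simp_all add: M\<close>)
  qed
qed

lemma bilin_flip: "f \<in> bilin M N P \<Longrightarrow> (\<lambda>n m. f m n) \<in> bilin N M P"
  by (auto simp: bilin_def)

lemma bilin_lift_right:
  assumes M: "module R L" "module R M" "module R P"
    and h: "\<And>n. n \<in> carrier N \<Longrightarrow> h n \<in> bilin L M P"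
    and h': "\<And>l m. l \<in> carrier L \<Longrightarrow> m \<in> carrier M \<Longrightarrow> (\<lambda>n. h n l m) \<in> lin N P"
    and N: "module R N"
  shows "(\<lambda>n X. lift P (h n) X) \<in> bilin N (L \<boxtimes> M) P"
  using bilin_flip[OF bilin_lift_left[OF assms]] .

lemma bilin_comp:
  assumes f: "f \<in> bilin M N P" and a: "a \<in> lin M' M" and b: "b \<in> lin N' N" and c: "c \<in> lin P P'"
  shows "(\<lambda>m n. c (f (a m) (b n))) \<in> bilin M' N' P'"
  by (rule bilinI') (simp_all add: bilinD(3-7)[OF f] lin_closed[OF a] lin_closed[OF b] lin_closed[OF c]
      lin_add[OF a] lin_add[OF b] lin_add[OF c] lin_smult[OF a] lin_smult[OF b] lin_smult[OF c])

lemma bilin_simple_nest_right: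
  assumes "module R L" "module R M" "module R N"
  shows "n \<in> carrier N \<Longrightarrow> (\<lambda>l m. simple L (M \<boxtimes> N) l (simple M N m n)) \<in> bilin L M (L \<boxtimes> (M \<boxtimes> N))"
    "m \<in> carrier M \<Longrightarrow> (\<lambda>l n. simple L (M \<boxtimes> N) l (simple M N m n)) \<in> bilin L N (L \<boxtimes> (M \<boxtimes> N))"
  using assms
  by (auto intro!: bilinI' simp: simple_closed simple_add_left simple_add_right simple_smult_left simple_smult_right)

lemma bilin_simple_nest_left:
  assumes "module R L" "module R M" "module R N"
  shows "l \<in> carrier L \<Longrightarrow> (\<lambda>m n. simple (L \<boxtimes> M) N (simple L M l m) n) \<in> bilin M N ((L \<boxtimes> M) \<boxtimes> N)"
    "m \<in> carrier M \<Longrightarrow> (\<lambda>l n. simple (L \<boxtimes> M) N (simple L M l m) n) \<in> bilin L N ((L \<boxtimes> M) \<boxtimes> N)"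
  using assms
  by (auto intro!: bilinI' simp: simple_closed simple_add_left simple_add_right simple_smult_left simple_smult_right)

context
  fixes L :: "('a, 'l, 'w) module_scheme" and M :: "('a, 'm, 'x) module_scheme"
    and N :: "('a, 'n, 'y) module_scheme"
  assumes M: "module R L" "module R M" "module R N"
begin

private lemma assoc_bilin:
  "(\<lambda>X n. lift (L \<boxtimes> M \<boxtimes> N) (\<lambda>l m. simple L (M \<boxtimes> N) l (simple M N m n)) X) \<in> bilin (L \<boxtimes> M) N (L \<boxtimes> M \<boxtimes> N)"
  using M by (intro bilin_lift_left)
    (auto intro: bilin_simple_nest_right bilinD(1)[OF bilin_simple_nest_right(1)] bilinD(1)[OF bilin_simple_nest_right(2)])

private lemma assoc_inv_bilin:
  "(\<lambda>l X. lift ((L \<boxtimes> M) \<boxtimes> N) (\<lambda>m n. simple (L \<boxtimes> M) N (simple L M l m) n) X) \<in> bilin L (M \<boxtimes> N) ((L \<boxtimes> M) \<boxtimes> N)"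
  using M by (intro bilin_lift_right)
    (auto intro: bilin_simple_nest_left bilinD(2)[OF bilin_simple_nest_left(2)])

lemma assoc_lin: "assoc L M N \<in> lin ((L \<boxtimes> M) \<boxtimes> N) (L \<boxtimes> M \<boxtimes> N)"
  unfolding tensor_assoc_def Let_def using M by (intro lift_lin assoc_bilin) simp_all

lemma assoc_inv_lin: "assoc_inv L M N \<in> lin (L \<boxtimes> M \<boxtimes> N) ((L \<boxtimes> M) \<boxtimes> N)"
  unfolding tensor_assoc_inv_def Let_def using M by (intro lift_lin assoc_inv_bilin) simp_all

lemma assoc_simple:
  "l \<in> carrier L \<Longrightarrow> m \<in> carrier M \<Longrightarrow> n \<in> carrier N \<Longrightarrow>
    assoc L M N (simple (L \<boxtimes> M) N (simple L M l m) n) = simple L (M \<boxtimes> N) l (simple M N m n)"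
  using M by (simp add: tensor_assoc_def Let_def lift_simple[OF _ _ assoc_bilin] simple_closed
      lift_simple[OF _ _ bilin_simple_nest_right(1)])

lemma assoc_inv_simple:
  "l \<in> carrier L \<Longrightarrow> m \<in> carrier M \<Longrightarrow> n \<in> carrier N \<Longrightarrow>
    assoc_inv L M N (simple L (M \<boxtimes> N) l (simple M N m n)) = simple (L \<boxtimes> M) N (simple L M l m) n"
  using M by (simp add: tensor_assoc_inv_def Let_def lift_simple[OF _ _ assoc_inv_bilin] simple_closed
      lift_simple[OF _ _ bilin_simple_nest_left(1)])

lemma tensor_eqI_right:
  assumes F: "F \<in> lin (L \<boxtimes> M \<boxtimes> N) P" and G: "G \<in> lin (L \<boxtimes> M \<boxtimes> N) P" and P: "module R P"
    and eq: "\<And>l m n. l \<in> carrier L \<Longrightarrow> m \<in> carrier M \<Longrightarrow> n \<in> carrier N \<Longrightarrow>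
      F (simple L (M \<boxtimes> N) l (simple M N m n)) = G (simple L (M \<boxtimes> N) l (simple M N m n))"
  shows "\<forall>z\<in>carrier (L \<boxtimes> M \<boxtimes> N). F z = G z"
proof (rule tensor_eqI[OF _ _ F G P])
  fix l w assume l: "l \<in> carrier L" and w: "w \<in> carrier (M \<boxtimes> N)"
  have s: "simple L (M \<boxtimes> N) l \<in> lin (M \<boxtimes> N) (L \<boxtimes> M \<boxtimes> N)" using M l by (simp add: simple_lin_right)
  show "F (simple L (M \<boxtimes> N) l w) = G (simple L (M \<boxtimes> N) l w)"
    using bspec[OF tensor_eqI[OF M(2,3) lin_comp[OF s F] lin_comp[OF s G] P] w] eq[OF l] by simp
qed (simp_all add: M)

lemma tensor_eqI_left:
  assumes F: "F \<in> lin ((L \<boxtimes> M) \<boxtimes> N) P" and G: "G \<in> lin ((L \<boxtimes> M) \<boxtimes> N) P" and P: "module R P"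
    and eq: "\<And>l m n. l \<in> carrier L \<Longrightarrow> m \<in> carrier M \<Longrightarrow> n \<in> carrier N \<Longrightarrow>
      F (simple (L \<boxtimes> M) N (simple L M l m) n) = G (simple (L \<boxtimes> M) N (simple L M l m) n)"
  shows "\<forall>z\<in>carrier ((L \<boxtimes> M) \<boxtimes> N). F z = G z"
proof (rule tensor_eqI[OF _ _ F G P])
  fix n w assume n: "n \<in> carrier N" and w: "w \<in> carrier (L \<boxtimes> M)"
  have s: "(\<lambda>w. simple (L \<boxtimes> M) N w n) \<in> lin (L \<boxtimes> M) ((L \<boxtimes> M) \<boxtimes> N)" using M n by (simp add: simple_lin_left)
  show "F (simple (L \<boxtimes> M) N w n) = G (simple (L \<boxtimes> M) N w n)"
    using bspec[OF tensor_eqI[OF M(1,2) lin_comp[OF s F] lin_comp[OF s G] P] w] eq[OF _ _ n] by simp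
qed (simp_all add: M)

end

text \<open>The flatness statements always tensor with a fixed module on the left; the flip carries
  them over to maps that act on the left factor.\<close>

definition swap :: "('a, 'm, 'x) module_scheme \<Rightarrow> ('a, 'n, 'y) module_scheme \<Rightarrow> ('m \<times> 'n) list set \<Rightarrow> ('n \<times> 'm) list set" where
  "swap M N = lift (N \<boxtimes> M) (\<lambda>m n. simple N M n m)"

lemma swap_lin: "module R M \<Longrightarrow> module R N \<Longrightarrow> swap M N \<in> lin (M \<boxtimes> N) (N \<boxtimes> M)"
  unfolding swap_def by (intro lift_lin bilin_flip[OF simple_bilin]) simp_all

lemma swap_simple:
  "module R M \<Longrightarrow> module R N \<Longrightarrow> m \<in> carrier M \<Longrightarrow> n \<in> carrier N \<Longrightarrow> swap M N (simple M N m n) = simple N M n m"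
  unfolding swap_def by (simp add: lift_simple[OF _ _ bilin_flip[OF simple_bilin]])

lemmas lin_intros = lin_id lin_comp tmap_lin assoc_lin assoc_inv_lin swap_lin tensor_module lift_lin simple_lin_right
declare assoc_lin [simp] assoc_inv_lin [simp] swap_lin [simp] lin_id [simp] tmap_lin [simp]
  simple_closed [simp] assoc_simple [simp] assoc_inv_simple [simp] swap_simple [simp]
  simple_lin_right [simp] simple_lin_left [simp]

lemma tmap_id:
  assumes "module R M" "module R N" "z \<in> carrier (M \<boxtimes> N)"
  shows "tmap M N id id z = z"
  using tensor_eqI[of M N "tmap M N id id" "M \<boxtimes> N" id] assms by (simp add: tmap_simple)

lemma tmap_tmap:
  assumes "f \<in> lin M P" "g \<in> lin N Q" "f' \<in> lin P P'" "g' \<in> lin Q Q'"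
    and "module R M" "module R N" "module R P" "module R Q" "module R P'" "module R Q'"
    and "z \<in> carrier (M \<boxtimes> N)"
  shows "tmap P' Q' f' g' (tmap P Q f g z) = tmap P' Q' (f' \<circ> f) (g' \<circ> g) z"
proof -
  have "\<forall>z\<in>carrier (M \<boxtimes> N). (tmap P' Q' f' g' \<circ> tmap P Q f g) z = tmap P' Q' (f' \<circ> f) (g' \<circ> g) z"
    by (rule tensor_eqI; (rule lin_intros assms | simp add: assms tmap_simple[OF _ _ assms(1,2)]
        tmap_simple[OF _ _ assms(3,4)] tmap_simple[OF _ _ lin_comp[OF assms(1,3)] lin_comp[OF assms(2,4)]]
        lin_closed[OF assms(1)] lin_closed[OF assms(2)])+)
  then show ?thesis using assms by simp
qed

text \<open>\<open>tensor_map\<close> evaluates its two maps only at the entries of the chosen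
  formal sum, and these lie in the carriers.\<close>

lemma tmap_cong:
  assumes "f \<in> lin M P" "g \<in> lin N Q" "module R M" "module R N" "module R P" "module R Q"
    and "\<And>x. x \<in> carrier M \<Longrightarrow> f x = f' x" "\<And>x. x \<in> carrier N \<Longrightarrow> g x = g' x" "z \<in> carrier (M \<boxtimes> N)"
  shows "tmap P Q f g z = tmap P Q f' g' z"
proof -
  have "map (map_prod f g) (formal_sum z) = map (map_prod f' g') (formal_sum z)"
    using formal_sum_carrier(1)[OF assms(3,4,9)] assms(7,8) by (intro map_cong) auto
  then show ?thesis unfolding tensor_map_def by (rule arg_cong)
qed

definition lin_iso :: "('a, 'm, 'x) module_scheme \<Rightarrow> ('a, 'n, 'y) module_scheme \<Rightarrow> ('m \<Rightarrow> 'n) set" where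
  "lin_iso M N = {f \<in> lin M N. bij_betw f (carrier M) (carrier N)}"

lemma lin_isoI:
  assumes "f \<in> lin M N" "g \<in> lin N M" "\<And>x. x \<in> carrier M \<Longrightarrow> g (f x) = x" "\<And>y. y \<in> carrier N \<Longrightarrow> f (g y) = y"
  shows "f \<in> lin_iso M N"
  using assms by (auto simp: lin_iso_def lin_closed intro!: bij_betw_byWitness[where f' = g])

lemma lin_isoD: "f \<in> lin_iso M N \<Longrightarrow> f \<in> lin M N" "f \<in> lin_iso M N \<Longrightarrow> bij_betw f (carrier M) (carrier N)"
  by (auto simp: lin_iso_def)

lemma lin_iso_inv:
  assumes f: "f \<in> lin_iso M N" and M: "module R M"
  shows "inv_into (carrier M) f \<in> lin N M"
    "\<And>x. x \<in> carrier M \<Longrightarrow> inv_into (carrier M) f (f x) = x"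
    "\<And>y. y \<in> carrier N \<Longrightarrow> f (inv_into (carrier M) f y) = y"
    "inv_into (carrier M) f \<in> lin_iso N M"
proof -
  interpret M: module R M by fact
  note l = lin_isoD(1)[OF f] note b = lin_isoD(2)[OF f]
  let ?g = "inv_into (carrier M) f"
  show 1: "\<And>x. x \<in> carrier M \<Longrightarrow> ?g (f x) = x" using b bij_betw_inv_into_left by metis
  show 2: "\<And>y. y \<in> carrier N \<Longrightarrow> f (?g y) = y" using b bij_betw_inv_into_right by metis
  have c: "\<And>y. y \<in> carrier N \<Longrightarrow> ?g y \<in> carrier M" using b by (metis bij_betwE bij_betw_inv_into)
  show 3: "?g \<in> lin N M"
  proof (rule linI)
    show "?g (x \<oplus>\<^bsub>N\<^esub> y) = ?g x \<oplus>\<^bsub>M\<^esub> ?g y" if "x \<in> carrier N" "y \<in> carrier N" for x y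
      using 1[of "?g x \<oplus>\<^bsub>M\<^esub> ?g y"] that by (simp add: lin_add[OF l] c 2)
    show "?g (r \<odot>\<^bsub>N\<^esub> x) = r \<odot>\<^bsub>M\<^esub> ?g x" if "r \<in> carrier R" "x \<in> carrier N" for r x
      using 1[of "r \<odot>\<^bsub>M\<^esub> ?g x"] that by (simp add: lin_smult[OF l] c 2)
  qed (rule c)
  show "?g \<in> lin_iso N M" using lin_isoI[OF 3 l 2 1] .
qed

lemma lin_iso_id: "id \<in> lin_iso M M"
  by (auto simp: lin_iso_def)

lemma lin_iso_comp: "g \<in> lin_iso M N \<Longrightarrow> f \<in> lin_iso N P \<Longrightarrow> f \<circ> g \<in> lin_iso M P"
  by (auto simp: lin_iso_def lin_comp intro: bij_betw_trans)

lemma lin_iso_tmap: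
  assumes f: "f \<in> lin_iso M P" and g: "g \<in> lin_iso N Q" and M: "module R M" "module R N" "module R P" "module R Q"
  shows "tmap P Q f g \<in> lin_iso (M \<boxtimes> N) (P \<boxtimes> Q)"
proof (rule lin_isoI)
  let ?f = "inv_into (carrier M) f" and ?g = "inv_into (carrier N) g"
  note F = lin_iso_inv[OF f M(1)] lin_isoD(1)[OF f] and G = lin_iso_inv[OF g M(2)] lin_isoD(1)[OF g]
  show "tmap P Q f g \<in> lin (M \<boxtimes> N) (P \<boxtimes> Q)" "tmap M N ?f ?g \<in> lin (P \<boxtimes> Q) (M \<boxtimes> N)"
    using F G M by simp_all
  show "tmap M N ?f ?g (tmap P Q f g x) = x" if x: "x \<in> carrier (M \<boxtimes> N)" for x
  proof -
    have "tmap M N (?f \<circ> f) (?g \<circ> g) x = tmap M N id id x"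
      using F G M x by (intro tmap_cong[of _ M M _ N N]) (auto intro: lin_comp)
    then show ?thesis using tmap_tmap[OF F(5) G(5) F(1) G(1) M(1-4) M(1,2) x] tmap_id[OF M(1,2) x] by simp
  qed
  show "tmap P Q f g (tmap M N ?f ?g x) = x" if x: "x \<in> carrier (P \<boxtimes> Q)" for x
  proof -
    have "tmap P Q (f \<circ> ?f) (g \<circ> ?g) x = tmap P Q id id x"
      using F G M x by (intro tmap_cong[of _ P P _ Q Q]) (auto intro: lin_comp)
    then show ?thesis using tmap_tmap[OF F(1) G(1) F(5) G(5) M(3,4) M(1-4) x] tmap_id[OF M(3,4) x] by simp
  qed
qed

lemma
  assumes M: "module R L" "module R M" "module R N"
  shows assoc_inv_assoc: "z \<in> carrier ((L \<boxtimes> M) \<boxtimes> N) \<Longrightarrow> assoc_inv L M N (assoc L M N z) = z"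
    and assoc_assoc_inv: "w \<in> carrier (L \<boxtimes> M \<boxtimes> N) \<Longrightarrow> assoc L M N (assoc_inv L M N w) = w"
proof -
  have "\<forall>z\<in>carrier ((L \<boxtimes> M) \<boxtimes> N). (assoc_inv L M N \<circ> assoc L M N) z = id z"
    by (rule tensor_eqI_left; (rule lin_intros M | simp add: M)+)
  moreover have "\<forall>z\<in>carrier (L \<boxtimes> M \<boxtimes> N). (assoc L M N \<circ> assoc_inv L M N) z = id z"
    by (rule tensor_eqI_right; (rule lin_intros M | simp add: M)+)
  ultimately show "z \<in> carrier ((L \<boxtimes> M) \<boxtimes> N) \<Longrightarrow> assoc_inv L M N (assoc L M N z) = z"
    "w \<in> carrier (L \<boxtimes> M \<boxtimes> N) \<Longrightarrow> assoc L M N (assoc_inv L M N w) = w" by auto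
qed

lemma lin_iso_assoc:
  assumes "module R L" "module R M" "module R N"
  shows "assoc L M N \<in> lin_iso ((L \<boxtimes> M) \<boxtimes> N) (L \<boxtimes> M \<boxtimes> N)"
    "assoc_inv L M N \<in> lin_iso (L \<boxtimes> M \<boxtimes> N) ((L \<boxtimes> M) \<boxtimes> N)"
  using assms by (auto intro!: lin_isoI[OF assoc_lin assoc_inv_lin] lin_isoI[OF assoc_inv_lin assoc_lin]
      simp: assoc_inv_assoc assoc_assoc_inv)

lemma swap_swap:
  assumes M: "module R M" "module R N" and z: "z \<in> carrier (M \<boxtimes> N)"
  shows "swap N M (swap M N z) = z"
proof -
  have "\<forall>z\<in>carrier (M \<boxtimes> N). (swap N M \<circ> swap M N) z = id z"
    by (rule tensor_eqI; (rule lin_intros M | simp add: M)+)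
  then show ?thesis using z by simp
qed

lemma lin_iso_swap: "module R M \<Longrightarrow> module R N \<Longrightarrow> swap M N \<in> lin_iso (M \<boxtimes> N) (N \<boxtimes> M)"
  by (rule lin_isoI[of _ _ _ "swap N M"]) (auto simp: swap_swap)

text \<open>\<open>T\<close> and its opposite are different records over one module. Tensor classes
  and the maps built from them read only these four fields, so related modules yield literally equal
  functions.\<close>

definition same_module :: "('a, 'm, 'x) module_scheme \<Rightarrow> ('a, 'm, 'y) module_scheme \<Rightarrow> bool" where
  "same_module M M' \<longleftrightarrow> carrier M = carrier M' \<and> add M = add M' \<and> zero M = zero M' \<and> smult M = smult M'"

lemma same_module_refl [simp]: "same_module M M"
  by (simp add: same_module_def)

lemma same_module_sym: "same_module M M' \<Longrightarrow> same_module M' M"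
  by (simp add: same_module_def)

lemma tensor_rel_same:
  assumes "same_module M M'" "same_module N N'"
  shows "tensor_rel R M N xs ys \<Longrightarrow> tensor_rel R M' N' xs ys"
proof (induction rule: tensor_rel.induct)
  case (trans xs ys zs)
  then show ?case by (blast intro: tensor_rel.trans)
next
  case (sym xs ys)
  show ?case by (rule tensor_rel.sym) (rule sym.IH)
qed (use assms in \<open>auto simp: same_module_def tensor_rel.refl tensor_rel.append tensor_rel.commute tensor_rel.zero
    tensor_rel.add_left tensor_rel.add_right tensor_rel.balanced\<close>)

lemma tensor_class_same:
  assumes "same_module M M'" "same_module N N'"
  shows "cls M N = cls M' N'"
  unfolding tensor_class_def
  using tensor_rel_same[OF assms] tensor_rel_same[OF assms[THEN same_module_sym]] by blast

lemma
  assumes "same_module M M'" "same_module N N'"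
  shows simple_same: "simple M N = simple M' N'"
    and tmap_same: "tmap M N f g = tmap M' N' f g"
    and lift_same: "lift M h = lift M' h"
    and lin_same: "lin M N = lin M' N'"
    and same_module_tensor: "same_module (M \<boxtimes> N) (M' \<boxtimes> N')"
  using tensor_class_same[OF assms] assms
  by (auto simp: simple_tensor_def tensor_map_def tensor_lift_def tensor_def same_module_def linear_maps_def fun_eq_iff)

lemma assoc_same:
  assumes "same_module L L'" "same_module M M'" "same_module N N'"
  shows "assoc L M N = assoc L' M' N'"
  unfolding tensor_assoc_def Let_def
  using simple_same[OF assms(2,3)] simple_same[OF assms(1) same_module_tensor[OF assms(2,3)]]
  by (simp add: lift_same[OF same_module_tensor[OF assms(1) same_module_tensor[OF assms(2,3)]] same_module_refl])

lemma module_same: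
  assumes "same_module M M'" "module R M"
  shows "module R M'"
proof -
  interpret M: module R M by fact
  have s: "carrier M' = carrier M" "add M' = add M" "zero M' = zero M" "smult M' = smult M"
    using assms(1) by (simp_all add: same_module_def)
  show ?thesis
  proof (rule moduleI)
    show "abelian_group M'"
    proof (rule abelian_groupI)
      show "\<exists>y\<in>carrier M'. y \<oplus>\<^bsub>M'\<^esub> x = \<zero>\<^bsub>M'\<^esub>" if "x \<in> carrier M'" for x
        using that M.l_neg by (intro bexI[of _ "\<ominus>\<^bsub>M\<^esub> x"]) (simp_all add: s)
    qed (simp_all add: s M.a_assoc, simp add: M.a_comm)
  qed (simp_all add: s is_cring M.smult_l_distr M.smult_r_distr M.smult_assoc1)
qed


section \<open>Tensor products of algebras\<close>

lemma nc_algebraD: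
  assumes "nc_algebra R A"
  shows "module R A" "ring A" "mult A \<in> bilin A A A"
proof -
  interpret A: nc_algebra R A by fact
  show "module R A" "ring A" ..
  show "mult A \<in> bilin A A A"
    by (rule bilinI') (simp_all add: A.l_distr A.r_distr A.smult_mult_left A.smult_mult_right)
qed

lemma nc_algebraI:
  assumes "module R A" and b: "mult A \<in> bilin A A A" and "\<one>\<^bsub>A\<^esub> \<in> carrier A"
    and "\<And>x y z. x \<in> carrier A \<Longrightarrow> y \<in> carrier A \<Longrightarrow> z \<in> carrier A \<Longrightarrow>
      (x \<otimes>\<^bsub>A\<^esub> y) \<otimes>\<^bsub>A\<^esub> z = x \<otimes>\<^bsub>A\<^esub> (y \<otimes>\<^bsub>A\<^esub> z)"
    and "\<And>x. x \<in> carrier A \<Longrightarrow> \<one>\<^bsub>A\<^esub> \<otimes>\<^bsub>A\<^esub> x = x"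
    and "\<And>x. x \<in> carrier A \<Longrightarrow> x \<otimes>\<^bsub>A\<^esub> \<one>\<^bsub>A\<^esub> = x"
  shows "nc_algebra R A"
proof -
  interpret A: module R A by fact
  have "abelian_group A" ..
  then have "ring A"
    by (intro ringI monoidI) (simp_all add: assms bilinD[OF b])
  with assms(1) show ?thesis
    by (intro nc_algebra.intro nc_algebra_axioms.intro) (simp_all add: bilinD[OF b])
qed

lemma algebra_homI:
  assumes "f \<in> lin A B" "f \<one>\<^bsub>A\<^esub> = \<one>\<^bsub>B\<^esub>"
    "\<And>x y. x \<in> carrier A \<Longrightarrow> y \<in> carrier A \<Longrightarrow> f (x \<otimes>\<^bsub>A\<^esub> y) = f x \<otimes>\<^bsub>B\<^esub> f y"
  shows "f \<in> algebra_homs R A B"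
  using assms by (auto simp: algebra_homs_def ring_hom_def linear_maps_def)

lemma algebra_homD:
  assumes "f \<in> algebra_homs R A B"
  shows "f \<in> lin A B" "f \<one>\<^bsub>A\<^esub> = \<one>\<^bsub>B\<^esub>"
    "\<And>x y. x \<in> carrier A \<Longrightarrow> y \<in> carrier A \<Longrightarrow> f (x \<otimes>\<^bsub>A\<^esub> y) = f x \<otimes>\<^bsub>B\<^esub> f y"
  using assms by (auto simp: algebra_homs_def ring_hom_def)

lemma bilin_eqI:
  assumes M: "module R A" "module R B" "module R C" "module R D" "module R P"
    and f: "f \<in> bilin (A \<boxtimes> B) (C \<boxtimes> D) P" and g: "g \<in> bilin (A \<boxtimes> B) (C \<boxtimes> D) P"
    and eq: "\<And>a b c d. a \<in> carrier A \<Longrightarrow> b \<in> carrier B \<Longrightarrow> c \<in> carrier C \<Longrightarrow> d \<in> carrier D \<Longrightarrow>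
      f (simple A B a b) (simple C D c d) = g (simple A B a b) (simple C D c d)"
    and X: "X \<in> carrier (A \<boxtimes> B)" and Y: "Y \<in> carrier (C \<boxtimes> D)"
  shows "f X Y = g X Y"
proof -
  have "f X (simple C D c d) = g X (simple C D c d)" if "c \<in> carrier C" "d \<in> carrier D" for c d
    using bspec[OF tensor_eqI[OF M(1,2) bilinD(2)[OF f] bilinD(2)[OF g] M(5)] X, of "simple C D c d"] that eq M
    by simp
  then show ?thesis
    using bspec[OF tensor_eqI[OF M(3,4) bilinD(1)[OF f] bilinD(1)[OF g] M(5)] Y, of X] X by simp
qed

context
  fixes A :: "('a, 's, 'x) module_scheme" and B :: "('a, 't, 'y) module_scheme"
  assumes A: "nc_algebra R A" and B: "nc_algebra R B"
begin

private abbreviation "AB \<equiv> A \<boxtimes> B"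

interpretation A: nc_algebra R A by (fact A)
interpretation B: nc_algebra R B by (fact B)

private lemma MM: "module R A" "module R B" ..

text \<open>Rewrites the list of all pairwise products as a double sum, which turns the product of
  two tensors into a nested \<open>tensor_lift\<close>; bilinearity then comes from the universal
  property.\<close>

private lemma mult_cls:
  assumes xs: "set xs \<subseteq> carrier A \<times> carrier B" and ys: "set ys \<subseteq> carrier A \<times> carrier B"
  shows "cls A B [(m \<otimes>\<^bsub>A\<^esub> m', n \<otimes>\<^bsub>B\<^esub> n'). (m, n) \<leftarrow> xs, (m', n') \<leftarrow> ys] =
    lsum AB (\<lambda>m n. lsum AB (\<lambda>m' n'. simple A B (m \<otimes>\<^bsub>A\<^esub> m') (n \<otimes>\<^bsub>B\<^esub> n')) ys) xs"
proof -
  have 1: "cls A B (map (\<lambda>(m', n'). (m \<otimes>\<^bsub>A\<^esub> m', n \<otimes>\<^bsub>B\<^esub> n')) ys) =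
    lsum AB (\<lambda>m' n'. simple A B (m \<otimes>\<^bsub>A\<^esub> m') (n \<otimes>\<^bsub>B\<^esub> n')) ys \<and>
    set (map (\<lambda>(m', n'). (m \<otimes>\<^bsub>A\<^esub> m', n \<otimes>\<^bsub>B\<^esub> n')) ys) \<subseteq> carrier A \<times> carrier B"
    if "m \<in> carrier A" "n \<in> carrier B" for m n
    using ys
  proof (induction ys)
    case Nil show ?case by (simp add: zero_cls[OF MM])
  next
    case (Cons p ys)
    then show ?case using that by (cases p) (auto simp: cls_Cons[OF MM])
  qed
  have "cls A B (concat (map (\<lambda>(m, n). map (\<lambda>(m', n'). (m \<otimes>\<^bsub>A\<^esub> m', n \<otimes>\<^bsub>B\<^esub> n')) ys) xs)) =
    lsum AB (\<lambda>m n. lsum AB (\<lambda>m' n'. simple A B (m \<otimes>\<^bsub>A\<^esub> m') (n \<otimes>\<^bsub>B\<^esub> n')) ys) xs \<and>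
    set (concat (map (\<lambda>(m, n). map (\<lambda>(m', n'). (m \<otimes>\<^bsub>A\<^esub> m', n \<otimes>\<^bsub>B\<^esub> n')) ys) xs)) \<subseteq> carrier A \<times> carrier B"
    using xs
  proof (induction xs)
    case Nil show ?case by (simp add: zero_cls[OF MM])
  next
    case (Cons p xs)
    obtain m n where p: "p = (m, n)" "m \<in> carrier A" "n \<in> carrier B" using Cons.prems by auto
    with Cons 1[OF p(2,3)] show ?case by (simp add: add_cls[OF MM, symmetric] del: set_map set_concat)
  qed
  then show ?thesis by simp
qed

private lemma inner_bilin:
  "m \<in> carrier A \<Longrightarrow> n \<in> carrier B \<Longrightarrow> (\<lambda>m' n'. simple A B (m \<otimes>\<^bsub>A\<^esub> m') (n \<otimes>\<^bsub>B\<^esub> n')) \<in> bilin A B AB"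
  by (rule bilinI') (simp_all add: MM A.r_distr B.r_distr A.smult_mult_right B.smult_mult_right
      simple_add_left simple_add_right simple_smult_left simple_smult_right)

text \<open>With \<open>n\<close> fixed the expression is bilinear in \<open>m\<close> and the
  tensor, with \<open>m\<close> fixed it is bilinear in \<open>n\<close> and the tensor; evaluating
  both at \<open>Y\<close> gives the two linearities.\<close>

private lemma outer_bilin:
  assumes Y: "Y \<in> carrier AB"
  shows "(\<lambda>m n. lift AB (\<lambda>m' n'. simple A B (m \<otimes>\<^bsub>A\<^esub> m') (n \<otimes>\<^bsub>B\<^esub> n')) Y) \<in> bilin A B AB"
proof -
  have 1: "(\<lambda>m X. lift AB (\<lambda>m' n'. simple A B (m \<otimes>\<^bsub>A\<^esub> m') (n \<otimes>\<^bsub>B\<^esub> n')) X) \<in> bilin A AB AB"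
    if "n \<in> carrier B" for n
    by (rule bilin_lift_right)
      (auto intro!: inner_bilin linI simp: that MM A.l_distr A.smult_mult_left simple_add_left simple_smult_left)
  have 2: "(\<lambda>n X. lift AB (\<lambda>m' n'. simple A B (m \<otimes>\<^bsub>A\<^esub> m') (n \<otimes>\<^bsub>B\<^esub> n')) X) \<in> bilin B AB AB"
    if "m \<in> carrier A" for m
    by (rule bilin_lift_right)
      (auto intro!: inner_bilin linI simp: that MM B.l_distr B.smult_mult_left simple_add_right simple_smult_right)
  show ?thesis
    by (rule bilinI) (auto intro: bilinD(2)[OF 1] bilinD(2)[OF 2] Y)
qed

private lemma mult_lift:
  assumes X: "X \<in> carrier AB" and Y: "Y \<in> carrier AB"
  shows "X \<otimes>\<^bsub>AB\<^esub> Y = lift AB (\<lambda>m n.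
    lift AB (\<lambda>m' n'. simple A B (m \<otimes>\<^bsub>A\<^esub> m') (n \<otimes>\<^bsub>B\<^esub> n')) Y) X"
  using mult_cls[OF formal_sum_carrier(1)[OF MM X] formal_sum_carrier(1)[OF MM Y]]
  by (simp add: tensor_def tensor_lift_def lsum_def)

lemma tensor_mult_bilin: "mult AB \<in> bilin AB AB AB"
proof -
  have "(\<lambda>X Y. lift AB (\<lambda>m n.
    lift AB (\<lambda>m' n'. simple A B (m \<otimes>\<^bsub>A\<^esub> m') (n \<otimes>\<^bsub>B\<^esub> n')) Y) X) \<in> bilin AB AB AB"
    by (rule bilin_lift_left) (auto intro!: outer_bilin lift_lin inner_bilin simp: MM)
  then show ?thesis by (rule bilin_cong) (simp_all add: mult_lift MM)
qed

lemma tensor_mult_simple: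
  assumes "a \<in> carrier A" "b \<in> carrier B" "a' \<in> carrier A" "b' \<in> carrier B"
  shows "simple A B a b \<otimes>\<^bsub>AB\<^esub> simple A B a' b' = simple A B (a \<otimes>\<^bsub>A\<^esub> a') (b \<otimes>\<^bsub>B\<^esub> b')"
  using assms by (simp add: mult_lift MM lift_simple[OF MM outer_bilin] lift_simple[OF MM inner_bilin])

lemma tensor_one: "\<one>\<^bsub>AB\<^esub> = simple A B \<one>\<^bsub>A\<^esub> \<one>\<^bsub>B\<^esub>"
  by (simp add: tensor_def simple_tensor_def)

lemma tensor_nc_algebra: "nc_algebra R AB"
proof (rule nc_algebraI)
  interpret P: module R "A \<boxtimes> B" by (simp add: MM)
  note b = tensor_mult_bilin
  note [simp] = bilinD(3-5)[OF b] bilin_zero[OF b] tensor_mult_simple MM tensor_one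
  show "x \<otimes>\<^bsub>AB\<^esub> y \<otimes>\<^bsub>AB\<^esub> z = x \<otimes>\<^bsub>AB\<^esub> (y \<otimes>\<^bsub>AB\<^esub> z)"
    if "x \<in> carrier AB" and y: "y \<in> carrier AB" and z: "z \<in> carrier AB" for x y z
    using MM that(1)
  proof (induction rule: tensor_induct)
    case (simple a b)
    show ?case using MM y
    proof (induction rule: tensor_induct)
      case (simple a' b')
      show ?case using MM z
        by (induction rule: tensor_induct) (use simple \<open>a \<in> carrier A\<close> \<open>b \<in> carrier B\<close> in \<open>simp_all add: A.m_assoc B.m_assoc\<close>)
    qed (use simple z in simp_all)
  qed (use y z in simp_all)
  show "\<one>\<^bsub>AB\<^esub> \<otimes>\<^bsub>AB\<^esub> x = x" "x \<otimes>\<^bsub>AB\<^esub> \<one>\<^bsub>AB\<^esub> = x" if "x \<in> carrier AB" for x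
    using MM that by (induction rule: tensor_induct) simp_all
qed (simp_all add: MM tensor_mult_bilin tensor_one)

end

lemma tmap_algebra_hom:
  assumes A: "nc_algebra R A" and B: "nc_algebra R B" and P: "nc_algebra R P" and Q: "nc_algebra R Q"
    and f: "f \<in> algebra_homs R A P" and g: "g \<in> algebra_homs R B Q"
  shows "tmap P Q f g \<in> algebra_homs R (A \<boxtimes> B) (P \<boxtimes> Q)"
proof (rule algebra_homI)
  note M [simp] = nc_algebraD(1)[OF A] nc_algebraD(1)[OF B] nc_algebraD(1)[OF P] nc_algebraD(1)[OF Q]
  interpret A: nc_algebra R A by fact
  interpret B: nc_algebra R B by fact
  interpret P: nc_algebra R P by fact
  interpret Q: nc_algebra R Q by fact
  note F = algebra_homD[OF f] and G = algebra_homD[OF g]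
  note [simp] = F G lin_closed[OF F(1)] lin_closed[OF G(1)]
  note t = tmap_simple[OF M(1,2) F(1) G(1) M(3,4)]
  show l: "tmap P Q f g \<in> lin (A \<boxtimes> B) (P \<boxtimes> Q)" by simp
  show "tmap P Q f g \<one>\<^bsub>A \<boxtimes> B\<^esub> = \<one>\<^bsub>P \<boxtimes> Q\<^esub>"
    by (simp add: tensor_one A B P Q t)
  show "tmap P Q f g (x \<otimes>\<^bsub>A \<boxtimes> B\<^esub> y) = tmap P Q f g x \<otimes>\<^bsub>P \<boxtimes> Q\<^esub> tmap P Q f g y"
    if "x \<in> carrier (A \<boxtimes> B)" "y \<in> carrier (A \<boxtimes> B)" for x y
    by (rule bilin_eqI[OF M(1,2) M(1,2) tensor_module[OF M(3,4)]
        bilin_comp[OF tensor_mult_bilin[OF A B] lin_id lin_id l, simplified]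
        bilin_comp[OF tensor_mult_bilin[OF P Q] l l lin_id, simplified]])
      (simp_all add: that t tensor_mult_simple A B P Q)
qed

lemma same_module_opposite: "same_module (opposite A) A"
  by (simp add: same_module_def opposite_def)

lemma nc_algebra_opposite:
  assumes "nc_algebra R A"
  shows "nc_algebra R (opposite A)"
proof -
  interpret A: nc_algebra R A by fact
  have m: "module R (opposite A)"
    using module_same[OF same_module_sym[OF same_module_opposite]] nc_algebraD(1)[OF assms] .
  show ?thesis
  proof (rule nc_algebraI)
    show "mult (opposite A) \<in> bilin (opposite A) (opposite A) (opposite A)"
      by (rule bilinI') (simp_all add: opposite_def A.r_distr A.l_distr A.smult_mult_left A.smult_mult_right)
  qed (rule m, simp_all add: opposite_def A.m_assoc)
qed

lemma nc_algebra_subalgebra: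
  assumes A: "nc_algebra R A" and "submodule C R A" "subring C A"
  shows "nc_algebra R (A\<lparr>carrier := C\<rparr>)"
proof -
  interpret A: nc_algebra R A by fact
  have "module R (A\<lparr>carrier := C\<rparr>)" using submodule.submodule_is_module[OF assms(2) nc_algebraD(1)[OF A]] .
  moreover have "ring (A\<lparr>carrier := C\<rparr>)" using A.subring_is_ring[OF assms(3)] .
  moreover have "C \<subseteq> carrier A" using subringE(1)[OF assms(3)] .
  ultimately show ?thesis
    by (intro nc_algebra.intro nc_algebra_axioms.intro)
      (auto simp: subset_iff A.smult_mult_left A.smult_mult_right)
qed

lemma mult_map_lin: "nc_algebra R A \<Longrightarrow> mult_map A \<in> lin (A \<boxtimes> A) A"
  unfolding mult_map_def by (intro lift_lin) (auto dest: nc_algebraD)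

lemma mult_map_simple:
  "nc_algebra R A \<Longrightarrow> x \<in> carrier A \<Longrightarrow> y \<in> carrier A \<Longrightarrow> mult_map A (simple A A x y) = x \<otimes>\<^bsub>A\<^esub> y"
  unfolding mult_map_def by (subst lift_simple) (auto dest: nc_algebraD)

lemma mult_first_comp: "mult_first R A M = tmap A M (mult_map A) id \<circ> assoc_inv A A M"
  by (simp add: mult_first_def fun_eq_iff)

lemma mult_first_lin: "nc_algebra R A \<Longrightarrow> module R M \<Longrightarrow> mult_first R A M \<in> lin (A \<boxtimes> (A \<boxtimes> M)) (A \<boxtimes> M)"
  unfolding mult_first_comp
  by (rule lin_comp, rule assoc_inv_lin) (auto intro!: tmap_lin mult_map_lin dest: nc_algebraD)

lemma mult_first_simple:
  assumes "nc_algebra R A" "module R M" "a \<in> carrier A" "b \<in> carrier A" "m \<in> carrier M"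
  shows "mult_first R A M (simple A (A \<boxtimes> M) a (simple A M b m)) = simple A M (a \<otimes>\<^bsub>A\<^esub> b) m"
  using assms nc_algebraD(1)[OF assms(1)]
  by (simp add: mult_first_def tmap_simple[OF _ _ mult_map_lin[OF assms(1)] lin_id] mult_map_simple)

lemma
  assumes "nc_algebra R A" "a \<in> carrier A"
  shows mult_left_lin: "(\<lambda>x. a \<otimes>\<^bsub>A\<^esub> x) \<in> lin A A" and mult_right_lin: "(\<lambda>x. x \<otimes>\<^bsub>A\<^esub> a) \<in> lin A A"
  using nc_algebraD(3)[OF assms(1)] assms(2) by (auto simp: bilin_def)

lemma nc_algebra_base: "nc_algebra R (base_algebra R)"
proof (rule nc_algebraI)
  show m: "module R (base_algebra R)"
  proof (rule moduleI)
    show "abelian_group (base_algebra R)"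
    proof (rule abelian_groupI)
      show "\<exists>y\<in>carrier (base_algebra R). y \<oplus>\<^bsub>base_algebra R\<^esub> x = \<zero>\<^bsub>base_algebra R\<^esub>" if "x \<in> carrier (base_algebra R)" for x
        using that by (intro bexI[of _ "\<ominus> x"]) (simp_all add: base_algebra_def l_neg)
    qed (simp_all add: base_algebra_def a_assoc, simp add: a_comm)
  qed (simp_all add: base_algebra_def is_cring l_distr r_distr m_assoc)
  show "mult (base_algebra R) \<in> bilin (base_algebra R) (base_algebra R) (base_algebra R)"
    by (rule bilinI') (simp_all add: base_algebra_def l_distr r_distr m_assoc m_lcomm)
qed (simp_all add: base_algebra_def m_assoc)

end

section \<open>Faithful flatness\<close>

text \<open>
  The test modules of \<^const>\<open>faithfully_flat\<close> have their elements in one fixed type. Exactness transports along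
  isomorphisms, so every module whose carrier injects into that type may be used instead.
\<close>

definition embeddable :: "'u itself \<Rightarrow> ('r, 'm, 'x) module_scheme \<Rightarrow> bool" where
  "embeddable U M \<longleftrightarrow> (\<exists>f :: 'm \<Rightarrow> 'u. inj_on f (carrier M))"

lemma embeddable_subset: "embeddable U M \<Longrightarrow> carrier N \<subseteq> carrier M \<Longrightarrow> embeddable U N"
  unfolding embeddable_def by (blast intro: inj_on_subset)

context cring
begin

lemma embeddable_base: "embeddable TYPE(('a, 't) small) (base_algebra R)"
  unfolding embeddable_def by (intro exI[of _ Scalar] inj_onI) simp

lemma embeddable_self: "embeddable TYPE(('a, 't) small) (M :: ('a, 't, 'x) module_scheme)"
  unfolding embeddable_def by (intro exI[of _ Element] inj_onI) simp

text \<open>A tensor is determined by the formal sum chosen for it, a finite list of pairs, and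
  \<open>small\<close> is closed under finite tuples.\<close>

lemma embeddable_tensor:
  assumes "module R M" "module R N" "embeddable TYPE(('a, 't) small) M" "embeddable TYPE(('a, 't) small) N"
  shows "embeddable TYPE(('a, 't) small) (M \<boxtimes> N)"
proof -
  from assms obtain f g where f: "inj_on (f :: _ \<Rightarrow> ('a, 't) small) (carrier M)"
    and g: "inj_on (g :: _ \<Rightarrow> ('a, 't) small) (carrier N)" unfolding embeddable_def by blast
  let ?e = "\<lambda>(m, n). Tuple [f m, g n]"
  have e: "inj_on ?e (carrier M \<times> carrier N)"
    using f g by (auto simp: inj_on_def)
  have "inj_on (\<lambda>X. Tuple (map ?e (formal_sum X))) (carrier (M \<boxtimes> N))"
  proof (rule inj_onI)
    fix X Y assume X: "X \<in> carrier (M \<boxtimes> N)" and Y: "Y \<in> carrier (M \<boxtimes> N)"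
      and eq: "Tuple (map ?e (formal_sum X)) = Tuple (map ?e (formal_sum Y))"
    note x = formal_sum_carrier[OF assms(1,2) X] and y = formal_sum_carrier[OF assms(1,2) Y]
    have "inj_on ?e (set (formal_sum X) \<union> set (formal_sum Y))"
      using e x(1) y(1) by (auto intro: inj_on_subset)
    with eq have "formal_sum X = formal_sum Y" by (auto dest: map_inj_on)
    with x(2) y(2) show "X = Y" by metis
  qed
  then show ?thesis unfolding embeddable_def by blast
qed

lemma exact_atI:
  assumes "\<And>x. x \<in> carrier M' \<Longrightarrow> f x \<in> carrier M" "\<And>x. x \<in> carrier M' \<Longrightarrow> g (f x) = \<zero>\<^bsub>M''\<^esub>"
    and "\<And>z. z \<in> carrier M \<Longrightarrow> g z = \<zero>\<^bsub>M''\<^esub> \<Longrightarrow> \<exists>x\<in>carrier M'. z = f x"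
  shows "exact_at M' M M'' f g"
  using assms by (auto simp: exact_at_def image_iff)

lemma exact_at_iso:
  assumes a: "a \<in> lin_iso M1 N1" and b: "b \<in> lin_iso M2 N2" and c: "c \<in> lin_iso M3 N3"
    and f: "f \<in> lin M1 M2" and g: "g \<in> lin M2 M3"
    and M: "module R M3" "module R N3"
    and 1: "\<And>x. x \<in> carrier M1 \<Longrightarrow> b (f x) = f' (a x)"
    and 2: "\<And>x. x \<in> carrier M2 \<Longrightarrow> c (g x) = g' (b x)"
  shows "exact_at M1 M2 M3 f g \<longleftrightarrow> exact_at N1 N2 N3 f' g'"
proof -
  note A = lin_isoD[OF a] and B = lin_isoD[OF b] and C = lin_isoD[OF c]
  interpret M3: module R M3 by fact
  have ib: "inj_on b (carrier M2)" and ic: "inj_on c (carrier M3)"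
    using B(2) C(2) by (auto simp: bij_betw_def)
  have "b ` f ` carrier M1 = f' ` a ` carrier M1"
    using 1 by (auto simp: image_image)
  also have "\<dots> = f' ` carrier N1" using A(2) by (simp add: bij_betw_def)
  finally have im: "b ` f ` carrier M1 = f' ` carrier N1" .
  have z: "g' (b m) = \<zero>\<^bsub>N3\<^esub> \<longleftrightarrow> g m = \<zero>\<^bsub>M3\<^esub>" if "m \<in> carrier M2" for m
    using inj_onD[OF ic, of "g m" "\<zero>\<^bsub>M3\<^esub>"] that lin_closed[OF g that] lin_zero[OF C(1) M] by (auto simp flip: 2)
  have "b ` {m \<in> carrier M2. g m = \<zero>\<^bsub>M3\<^esub>} = {m \<in> carrier N2. g' m = \<zero>\<^bsub>N3\<^esub>}"
    using z B(2) unfolding bij_betw_def by force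
  with im show ?thesis
    using inj_on_image_eq_iff[OF ib, of "f ` carrier M1" "{m \<in> carrier M2. g m = \<zero>\<^bsub>M3\<^esub>}"] lin_closed[OF f]
    unfolding exact_at_def by auto
qed

lemma embeddable_copy:
  assumes M: "module R M" and "embeddable TYPE('u) M"
  obtains M' :: "('a, 'u) module" and h where "module R M'" "h \<in> lin_iso M M'"
proof -
  from assms obtain h where h: "inj_on (h :: _ \<Rightarrow> 'u) (carrier M)" unfolding embeddable_def by blast
  interpret M: module R M by fact
  let ?g = "inv_into (carrier M) h"
  have [simp]: "?g (h x) = x" if "x \<in> carrier M" for x using h that by simp
  define M' :: "('a, 'u) module" where "M' = \<lparr>carrier = h ` carrier M, mult = undefined, one = undefined,
    zero = h \<zero>\<^bsub>M\<^esub>, add = (\<lambda>x y. h (?g x \<oplus>\<^bsub>M\<^esub> ?g y)), smult = (\<lambda>r x. h (r \<odot>\<^bsub>M\<^esub> ?g x))\<rparr>"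
  have m: "module R M'"
  proof (rule moduleI)
    show "abelian_group M'"
    proof (rule abelian_groupI)
      fix x y z assume x: "x \<in> carrier M'" and y: "y \<in> carrier M'"
      show "x \<oplus>\<^bsub>M'\<^esub> y = y \<oplus>\<^bsub>M'\<^esub> x"
        using x y by (auto simp: M'_def M.a_comm)
      show "\<exists>y\<in>carrier M'. y \<oplus>\<^bsub>M'\<^esub> x = \<zero>\<^bsub>M'\<^esub>"
        using x by (auto simp: M'_def intro!: bexI[of _ "\<ominus>\<^bsub>M\<^esub> ?g x"] arg_cong[where f = h] M.l_neg)
    qed (auto simp: M'_def M.a_assoc)
  qed (auto simp: M'_def M.smult_l_distr M.smult_r_distr M.smult_assoc1 is_cring)
  have "h \<in> lin_iso M M'"
    using h by (auto simp: lin_iso_def bij_betw_def M'_def intro!: linI)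
  with m show ?thesis by (rule that)
qed

lemma tmap_square:
  assumes M: "module R K" "module R L" "module R M" "module R N" "module R Q"
    and f: "f \<in> lin L M" "g \<in> lin M N" "f' \<in> lin L Q" "g' \<in> lin Q N"
    and eq: "\<And>x. x \<in> carrier L \<Longrightarrow> g (f x) = g' (f' x)" and z: "z \<in> carrier (K \<boxtimes> L)"
  shows "tmap K N id g (tmap K M id f z) = tmap K N id g' (tmap K Q id f' z)"
proof -
  have "tmap K N id g (tmap K M id f z) = tmap K N (id \<circ> id) (g \<circ> f) z"
    by (rule tmap_tmap[of _ K _ _ L]) (use assms in simp_all)
  also have "\<dots> = tmap K N (id \<circ> id) (g' \<circ> f') z"
    by (rule tmap_cong[of _ K _ _ L]) (use assms lin_comp[OF f(1,2)] in simp_all)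
  also have "\<dots> = tmap K N id g' (tmap K Q id f' z)"
    by (rule tmap_tmap[of _ K _ _ L, symmetric]) (use assms in simp_all)
  finally show ?thesis .
qed

text \<open>Serves as the left end of \<open>0 -> M -> N\<close>, by which injectivity becomes an
  exactness statement. Built on the zero of \<open>M\<close>, it has the type of \<open>M\<close>
  and inherits embeddability.\<close>

definition trivial_module :: "('a, 'm, 'x) module_scheme \<Rightarrow> ('a, 'm, 'x) module_scheme" where
  "trivial_module M = M\<lparr>carrier := {\<zero>\<^bsub>M\<^esub>}\<rparr>"

lemma trivial_module:
  assumes "module R M"
  shows "module R (trivial_module M)" "id \<in> lin (trivial_module M) M"
proof -
  interpret M: module R M by fact
  have "submodule {\<zero>\<^bsub>M\<^esub>} R M" by (rule M.submoduleI) auto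
  then show "module R (trivial_module M)"
    unfolding trivial_module_def by (rule submodule.submodule_is_module[OF _ assms])
  show "id \<in> lin (trivial_module M) M"
    by (rule linI) (auto simp: trivial_module_def)
qed

lemma module_diff_eq_zero:
  assumes "module R M" "x \<in> carrier M" "y \<in> carrier M"
  shows "x \<ominus>\<^bsub>M\<^esub> y = \<zero>\<^bsub>M\<^esub> \<longleftrightarrow> x = y"
proof -
  interpret M: module R M by fact
  show ?thesis
    using assms M.minus_equality[of x "\<ominus>\<^bsub>M\<^esub> y"] by (auto simp: a_minus_def M.r_neg)
qed

lemma inj_on_iff_kernel:
  assumes f: "f \<in> lin M N" and M: "module R M" "module R N"
  shows "inj_on f (carrier M) \<longleftrightarrow> {m \<in> carrier M. f m = \<zero>\<^bsub>N\<^esub>} = {\<zero>\<^bsub>M\<^esub>}"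
proof
  interpret M: module R M by fact
  interpret N: module R N by fact
  note fz = lin_zero[OF f M]
  show "{m \<in> carrier M. f m = \<zero>\<^bsub>N\<^esub>} = {\<zero>\<^bsub>M\<^esub>}" if "inj_on f (carrier M)"
  proof -
    have "m = \<zero>\<^bsub>M\<^esub>" if "m \<in> carrier M" "f m = \<zero>\<^bsub>N\<^esub>" for m
      using inj_onD[OF \<open>inj_on f (carrier M)\<close>, of m "\<zero>\<^bsub>M\<^esub>"] that fz by simp
    then show ?thesis using fz by blast
  qed
  assume k: "{m \<in> carrier M. f m = \<zero>\<^bsub>N\<^esub>} = {\<zero>\<^bsub>M\<^esub>}"
  show "inj_on f (carrier M)"
  proof (rule inj_onI)
    fix x y assume x: "x \<in> carrier M" and y: "y \<in> carrier M" and eq: "f x = f y"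
    have "f (x \<ominus>\<^bsub>M\<^esub> y) = \<zero>\<^bsub>N\<^esub>"
      using x y lin_closed[OF f] by (simp add: a_minus_def lin_add[OF f] lin_minus[OF f M] eq N.r_neg)
    then have "x \<ominus>\<^bsub>M\<^esub> y = \<zero>\<^bsub>M\<^esub>" using k x y by blast
    then show "x = y" using x y module_diff_eq_zero[OF M(1)] by simp
  qed
qed

lemma inj_on_iff_exact_at:
  assumes "f \<in> lin M N" "module R M" "module R N"
  shows "inj_on f (carrier M) \<longleftrightarrow> exact_at (trivial_module M) M N id f"
  unfolding inj_on_iff_kernel[OF assms] exact_at_def by (auto simp: trivial_module_def)

context
  fixes T :: "('a, 't, 'y) module_scheme"
  assumes T: "module R T" and ff: "faithfully_flat TYPE(('a, 't) small) R T"
begin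

text \<open>Copies of the three modules inside the test type carry the assumption. Exactness is
  transported to the copies before tensoring and back from them after tensoring, the squares being
  supplied by \<open>tmap_square\<close>.\<close>

lemma faithfully_flat_exact:
  assumes M: "module R M1" "module R M2" "module R M3"
    and e: "embeddable TYPE(('a, 't) small) M1" "embeddable TYPE(('a, 't) small) M2" "embeddable TYPE(('a, 't) small) M3"
    and f: "f \<in> lin M1 M2" and g: "g \<in> lin M2 M3"
  shows "exact_at M1 M2 M3 f g \<longleftrightarrow>
    exact_at (T \<boxtimes> M1) (T \<boxtimes> M2) (T \<boxtimes> M3) (tmap T M2 id f) (tmap T M3 id g)"
proof -
  obtain N1 :: "('a, ('a, 't) small) module" and a where N1: "module R N1" and a: "a \<in> lin_iso M1 N1"
    using embeddable_copy[OF M(1) e(1)] .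
  obtain N2 :: "('a, ('a, 't) small) module" and b where N2: "module R N2" and b: "b \<in> lin_iso M2 N2"
    using embeddable_copy[OF M(2) e(2)] .
  obtain N3 :: "('a, ('a, 't) small) module" and c where N3: "module R N3" and c: "c \<in> lin_iso M3 N3"
    using embeddable_copy[OF M(3) e(3)] .
  note A = lin_iso_inv[OF a M(1)] and B = lin_iso_inv[OF b M(2)] and C = lin_iso_inv[OF c M(3)]
  note A' = lin_isoD(1)[OF a] and B' = lin_isoD(1)[OF b] and C' = lin_isoD(1)[OF c]
  define f' where "f' = b \<circ> f \<circ> inv_into (carrier M1) a"
  define g' where "g' = c \<circ> g \<circ> inv_into (carrier M2) b"
  have f': "f' \<in> lin N1 N2" unfolding f'_def by (rule lin_comp A lin_comp[OF _ B'] f)+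
  have g': "g' \<in> lin N2 N3" unfolding g'_def by (rule lin_comp B lin_comp[OF _ C'] g)+
  have 1: "b (f x) = f' (a x)" if "x \<in> carrier M1" for x using that A by (simp add: f'_def)
  have 2: "c (g x) = g' (b x)" if "x \<in> carrier M2" for x using that B by (simp add: g'_def)
  have "exact_at M1 M2 M3 f g \<longleftrightarrow> exact_at N1 N2 N3 f' g'"
    by (rule exact_at_iso[OF a b c f g M(3) N3 1 2])
  also have "\<dots> \<longleftrightarrow> exact_at (T \<boxtimes> N1) (T \<boxtimes> N2) (T \<boxtimes> N3) (tmap T N2 id f') (tmap T N3 id g')"
    using ff N1 N2 N3 f' g' unfolding faithfully_flat_def by blast
  also have "\<dots> \<longleftrightarrow> exact_at (T \<boxtimes> M1) (T \<boxtimes> M2) (T \<boxtimes> M3) (tmap T M2 id f) (tmap T M3 id g)"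
  proof (rule exact_at_iso[symmetric])
    show "tmap T N1 id a \<in> lin_iso (T \<boxtimes> M1) (T \<boxtimes> N1)" "tmap T N2 id b \<in> lin_iso (T \<boxtimes> M2) (T \<boxtimes> N2)"
      "tmap T N3 id c \<in> lin_iso (T \<boxtimes> M3) (T \<boxtimes> N3)"
      by (simp_all add: lin_iso_tmap lin_iso_id a b c T M N1 N2 N3)
    show "tmap T N2 id b (tmap T M2 id f x) = tmap T N2 id f' (tmap T N1 id a x)" if "x \<in> carrier (T \<boxtimes> M1)" for x
      by (rule tmap_square[OF T M(1,2) N2 N1 f B' A' f' 1 that])
    show "tmap T N3 id c (tmap T M3 id g x) = tmap T N3 id g' (tmap T N2 id b x)" if "x \<in> carrier (T \<boxtimes> M2)" for x
      by (rule tmap_square[OF T M(2,3) N3 N2 g C' B' g' 2 that])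
  qed (simp_all add: f g T M N3)
  finally show ?thesis .
qed

text \<open>Every \<open>t (x) 0\<close> vanishes in \<open>T (x) M\<close>; hence exactness of the
  tensored sequence at \<open>T (x) M\<close> again means that a kernel is zero.\<close>

lemma tensor_trivial_module:
  assumes M: "module R M"
  shows "tmap T M id id ` carrier (T \<boxtimes> trivial_module M) = {\<zero>\<^bsub>T \<boxtimes> M\<^esub>}"
proof -
  note N = trivial_module[OF M]
  interpret N: module R "trivial_module M" by (rule N)
  interpret TM: module R "T \<boxtimes> M" by (simp add: T M)
  interpret TN: module R "T \<boxtimes> trivial_module M" by (simp add: T N)
  have "\<forall>z\<in>carrier (T \<boxtimes> trivial_module M). tmap T M id id z = (\<lambda>z. \<zero>\<^bsub>T \<boxtimes> M\<^esub>) z"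
  proof (rule tensor_eqI[OF T N(1)])
    show "tmap T M id id \<in> lin (T \<boxtimes> trivial_module M) (T \<boxtimes> M)" by (simp add: T N M)
    show "tmap T M id id (simple T (trivial_module M) t n) = \<zero>\<^bsub>T \<boxtimes> M\<^esub>"
      if "t \<in> carrier T" "n \<in> carrier (trivial_module M)" for t n
      using that lin_zero[OF simple_lin_right[OF T M that(1)] M tensor_module[OF T M]]
      by (simp add: tmap_simple[OF T N(1) lin_id N(2) T M]) (simp add: trivial_module_def)
  qed (simp_all add: T M N lin_zero_map)
  moreover have "\<zero>\<^bsub>T \<boxtimes> trivial_module M\<^esub> \<in> carrier (T \<boxtimes> trivial_module M)" by simp
  ultimately show ?thesis by fastforce
qed

lemma faithfully_flat_inj:
  assumes M: "module R M" "module R N"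
    and e: "embeddable TYPE(('a, 't) small) M" "embeddable TYPE(('a, 't) small) N" and f: "f \<in> lin M N"
  shows "inj_on f (carrier M) \<longleftrightarrow> inj_on (tmap T N id f) (carrier (T \<boxtimes> M))"
proof -
  note N = trivial_module[OF M(1)]
  interpret M: module R M by (rule M)
  have "embeddable TYPE(('a, 't) small) (trivial_module M)"
    using e(1) by (rule embeddable_subset) (simp add: trivial_module_def)
  then have "inj_on f (carrier M) \<longleftrightarrow>
    exact_at (T \<boxtimes> trivial_module M) (T \<boxtimes> M) (T \<boxtimes> N) (tmap T M id id) (tmap T N id f)"
    unfolding inj_on_iff_exact_at[OF f M] by (intro faithfully_flat_exact N M e f)
  also have "\<dots> \<longleftrightarrow> inj_on (tmap T N id f) (carrier (T \<boxtimes> M))"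
    unfolding exact_at_def tensor_trivial_module[OF M(1)]
    by (subst inj_on_iff_kernel[of _ "T \<boxtimes> M" "T \<boxtimes> N"]) (auto simp: T M f)
  finally show ?thesis .
qed

text \<open>The zero endomorphism of \<open>N\<close> takes the place of \<open>N -> 0\<close>:
  exactness at the middle of \<open>M -> N -> N\<close> says that \<open>f\<close> is onto.\<close>

lemma faithfully_flat_surj:
  assumes M: "module R M" "module R N"
    and e: "embeddable TYPE(('a, 't) small) M" "embeddable TYPE(('a, 't) small) N" and f: "f \<in> lin M N"
  shows "f ` carrier M = carrier N \<longleftrightarrow> tmap T N id f ` carrier (T \<boxtimes> M) = carrier (T \<boxtimes> N)"
proof -
  have z: "tmap T N id (\<lambda>x. \<zero>\<^bsub>N\<^esub>) x = \<zero>\<^bsub>T \<boxtimes> N\<^esub>" if "x \<in> carrier (T \<boxtimes> N)" for x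
  proof -
    have "\<forall>z\<in>carrier (T \<boxtimes> N). tmap T N id (\<lambda>x. \<zero>\<^bsub>N\<^esub>) z = (\<lambda>z. \<zero>\<^bsub>T \<boxtimes> N\<^esub>) z"
      using T M lin_zero[OF simple_lin_right[OF T M(2)] M(2) tensor_module[OF T M(2)]]
      by (intro tensor_eqI[OF T M(2) _ _ tensor_module[OF T M(2)]])
        (auto simp: lin_zero_map tmap_simple[OF T M(2) lin_id lin_zero_map])
    then show ?thesis using that by simp
  qed
  have "f ` carrier M = carrier N \<longleftrightarrow> exact_at M N N f (\<lambda>x. \<zero>\<^bsub>N\<^esub>)"
    by (simp add: exact_at_def)
  also have "\<dots> \<longleftrightarrow> exact_at (T \<boxtimes> M) (T \<boxtimes> N) (T \<boxtimes> N) (tmap T N id f) (tmap T N id (\<lambda>x. \<zero>\<^bsub>N\<^esub>))"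
    by (intro faithfully_flat_exact M e f lin_zero_map)
  also have "\<dots> \<longleftrightarrow> tmap T N id f ` carrier (T \<boxtimes> M) = carrier (T \<boxtimes> N)"
    using z by (auto simp: exact_at_def)
  finally show ?thesis .
qed

lemma faithfully_flat_iso:
  assumes M: "module R M" "module R N"
    and e: "embeddable TYPE(('a, 't) small) M" "embeddable TYPE(('a, 't) small) N" and f: "f \<in> lin M N"
    and "tmap T N id f \<in> lin_iso (T \<boxtimes> M) (T \<boxtimes> N)"
  shows "f \<in> lin_iso M N"
  using assms(6) f unfolding lin_iso_def bij_betw_def
  using faithfully_flat_inj[OF M e f] faithfully_flat_surj[OF M e f] by simp

end

text \<open>Descent along \<open>k -> T\<close>: the sequence \<open>k -> T -> T (x) T\<close> with
  second map \<open>x \<mapsto> 1 (x) x - x (x) 1\<close> becomes exact after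
  \<open>T (x) -\<close>, because multiplication then provides a contraction. Faithful flatness
  returns exactness of the sequence itself.\<close>

lemma faithfully_flat_unit:
  fixes T :: "('a, 't, 'y) module_scheme"
  assumes A: "nc_algebra R T" and ff: "faithfully_flat TYPE(('a, 't) small) R T"
  shows "inj_on (\<lambda>r. r \<odot>\<^bsub>T\<^esub> \<one>\<^bsub>T\<^esub>) (carrier R)"
    and "x \<in> carrier T \<Longrightarrow> simple T T \<one>\<^bsub>T\<^esub> x = simple T T x \<one>\<^bsub>T\<^esub> \<Longrightarrow> \<exists>r\<in>carrier R. x = r \<odot>\<^bsub>T\<^esub> \<one>\<^bsub>T\<^esub>"
proof -
  interpret T: nc_algebra R T by fact
  note M [simp] = nc_algebraD(1)[OF A] nc_algebraD(1)[OF nc_algebra_base]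
  let ?k = "base_algebra R" and ?TT = "T \<boxtimes> T" and ?T3 = "T \<boxtimes> (T \<boxtimes> T)" and ?Tk = "T \<boxtimes> base_algebra R" and ?L = "lift T (\<lambda>t r. r \<odot>\<^bsub>T\<^esub> t)"
  have [simp]: "carrier ?k = carrier R" by (simp add: base_algebra_def)
  let ?u = "\<lambda>r. r \<odot>\<^bsub>T\<^esub> \<one>\<^bsub>T\<^esub>"
  let ?g = "\<lambda>x. simple T T \<one>\<^bsub>T\<^esub> x \<ominus>\<^bsub>?TT\<^esub> simple T T x \<one>\<^bsub>T\<^esub>"
  have u: "?u \<in> lin ?k T" by (rule linI) (auto simp: base_algebra_def T.smult_l_distr T.smult_assoc1)
  have g: "?g \<in> lin T ?TT" by (intro lin_diff) simp_all
  interpret TT: module R "T \<boxtimes> T" by simp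
  interpret TTT: module R "T \<boxtimes> ?TT" by simp
  note tu = tmap_simple[OF M(1,2) lin_id u M(1,1)]
  note tg = tmap_simple[OF M(1,1) lin_id g M(1) tensor_module[OF M(1,1)]]
  have e: "embeddable TYPE(('a, 't) small) ?k" "embeddable TYPE(('a, 't) small) T" "embeddable TYPE(('a, 't) small) ?TT"
    by (simp_all add: embeddable_base embeddable_self embeddable_tensor)
  have b: "(\<lambda>t r. r \<odot>\<^bsub>T\<^esub> t) \<in> bilin T ?k T"
    by (rule bilinI') (auto simp: base_algebra_def T.smult_l_distr T.smult_r_distr T.smult_assoc1[symmetric] m_comm)
  \<comment> \<open>\<open>?L\<close> is the canonical map \<open>T (x) k -> T\<close>, and by
    \<open>kr\<close> below \<open>t \<mapsto> t (x) 1\<close> undoes it. As \<open>?L\<close> is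
    multiplication after \<open>T (x) ?u\<close>, the map \<open>T (x) ?u\<close> is
    injective.\<close>
  have mu: "\<forall>z\<in>carrier ?Tk. (mult_map T \<circ> tmap T T id ?u) z = ?L z"
    by (rule tensor_eqI[OF M]; (rule lin_comp tmap_lin mult_map_lin[OF A] lin_id u b lift_lin M
        | simp add: tu mult_map_simple[OF A] lift_simple[OF _ _ b] T.smult_mult_right)+)
  have kr: "\<forall>z\<in>carrier ?Tk. (\<lambda>t. simple T ?k t \<one>) (?L z) = id z"
  proof -
    have "\<forall>z\<in>carrier ?Tk. ((\<lambda>t. simple T ?k t \<one>) \<circ> ?L) z = id z"
    proof (rule tensor_eqI[OF M])
      show "(\<lambda>t. simple T ?k t \<one>) \<circ> ?L \<in> lin ?Tk ?Tk"
        by (rule lin_comp[OF lift_lin[OF M b M(1)]]) simp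
      fix t r assume t: "t \<in> carrier T" and r: "r \<in> carrier ?k"
      have "simple T ?k (r \<odot>\<^bsub>T\<^esub> t) \<one> = simple T ?k t (r \<odot>\<^bsub>?k\<^esub> \<one>)"
        using t r by (simp add: simple_smult_left simple_smult_right)
      also have "r \<odot>\<^bsub>?k\<^esub> \<one> = r" using r by (simp add: base_algebra_def)
      finally show "((\<lambda>t. simple T ?k t \<one>) \<circ> ?L) (simple T ?k t r) = id (simple T ?k t r)"
        using t r by (simp add: lift_simple[OF _ _ b])
    qed (simp_all add: lin_id[unfolded id_def])
    then show ?thesis by simp
  qed
  have "inj_on (tmap T T id ?u) (carrier ?Tk)"
  proof (rule inj_onI)
    fix x y assume "x \<in> carrier ?Tk" "y \<in> carrier ?Tk" "tmap T T id ?u x = tmap T T id ?u y"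
    then show "x = y" using mu kr by (metis comp_apply id_apply)
  qed
  then show "inj_on ?u (carrier R)"
    using faithfully_flat_inj[OF M(1) ff M(2,1) e(1,2) u] by simp
  have "exact_at ?k T ?TT ?u ?g"
  proof (subst faithfully_flat_exact[OF M(1) ff M(2,1) tensor_module[OF M(1,1)] e u g], rule exact_atI)
    fix w assume w: "w \<in> carrier ?Tk"
    show "tmap T T id ?u w \<in> carrier ?TT" using lin_closed[OF tmap_lin[OF lin_id u M(1,2,1,1)] w] .
    have "?g (?u r) = \<zero>\<^bsub>?TT\<^esub>" if "r \<in> carrier R" for r
      using that by (simp add: simple_smult_left simple_smult_right TT.r_neg a_minus_def)
    then have "\<forall>w\<in>carrier ?Tk. (tmap T ?TT id ?g \<circ> tmap T T id ?u) w = (\<lambda>w. \<zero>\<^bsub>?T3\<^esub>) w"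
      using lin_zero[OF simple_lin_right[OF M(1) tensor_module[OF M(1,1)]] tensor_module[OF M(1,1)] tensor_module[OF M(1) tensor_module[OF M(1,1)]]]
      by (intro tensor_eqI[OF M _ lin_zero_map] lin_comp[OF tmap_lin[OF lin_id u] tmap_lin[OF lin_id g]])
        (simp_all add: tu tg)
    then show "tmap T ?TT id ?g (tmap T T id ?u w) = \<zero>\<^bsub>?T3\<^esub>" using w by simp
  next
    \<comment> \<open>Multiplying the first two factors of \<open>s (x) (1 (x) t - t (x) 1)\<close>
      gives \<open>s (x) t - s t (x) 1\<close>. So \<open>z\<close> in the kernel equals its product
      tensored with \<open>1\<close>, which visibly comes from \<open>T (x) k\<close>.\<close>
    fix z assume z: "z \<in> carrier ?TT" "tmap T ?TT id ?g z = \<zero>\<^bsub>?T3\<^esub>"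
    note mf = mult_first_lin[OF A M(1)]
    have m: "(\<lambda>z. simple T T (mult_map T z) \<one>\<^bsub>T\<^esub>) \<in> lin ?TT ?TT"
      using lin_comp[OF mult_map_lin[OF A] simple_lin_left[OF M(1,1), of "\<one>\<^bsub>T\<^esub>"]] by (simp add: comp_def)
    have "\<forall>z\<in>carrier ?TT. (mult_first R T T \<circ> tmap T ?TT id ?g) z =
        (\<lambda>z. id z \<ominus>\<^bsub>?TT\<^esub> simple T T (mult_map T z) \<one>\<^bsub>T\<^esub>) z"
    proof (rule tensor_eqI[OF M(1,1)])
      show "mult_first R T T \<circ> tmap T ?TT id ?g \<in> lin ?TT ?TT"
        by (rule lin_comp[OF tmap_lin mf]) (simp_all add: g)
      show "(\<lambda>z. id z \<ominus>\<^bsub>?TT\<^esub> simple T T (mult_map T z) \<one>\<^bsub>T\<^esub>) \<in> lin ?TT ?TT"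
        by (intro lin_diff lin_id m) simp
      fix s t assume st: "s \<in> carrier T" "t \<in> carrier T"
      have c: "simple T T \<one>\<^bsub>T\<^esub> t \<in> carrier ?TT" "simple T T t \<one>\<^bsub>T\<^esub> \<in> carrier ?TT" using st by simp_all
      note s = lin_comp[OF simple_lin_right[OF M(1) tensor_module[OF M(1,1)] st(1)] mf]
      have "mult_first R T T (simple T ?TT s (?g t)) =
        mult_first R T T (simple T ?TT s (simple T T \<one>\<^bsub>T\<^esub> t)) \<ominus>\<^bsub>?TT\<^esub>
        mult_first R T T (simple T ?TT s (simple T T t \<one>\<^bsub>T\<^esub>))"
        using lin_add[OF s c(1) TT.a_inv_closed[OF c(2)]] lin_minus[OF s _ _ c(2)] by (simp add: a_minus_def)
      then show "(mult_first R T T \<circ> tmap T ?TT id ?g) (simple T T s t) =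
        id (simple T T s t) \<ominus>\<^bsub>?TT\<^esub> simple T T (mult_map T (simple T T s t)) \<one>\<^bsub>T\<^esub>"
        using st by (simp add: tg mult_first_simple[OF A] mult_map_simple[OF A])
    qed simp
    from bspec[OF this z(1)] have "z \<ominus>\<^bsub>?TT\<^esub> simple T T (mult_map T z) \<one>\<^bsub>T\<^esub> = \<zero>\<^bsub>?TT\<^esub>"
      using z(2) lin_zero[OF mf] by simp
    then have "z = simple T T (mult_map T z) \<one>\<^bsub>T\<^esub>"
      using iffD1[OF module_diff_eq_zero[OF tensor_module[OF M(1,1)] z(1) lin_closed[OF m z(1)]]] by blast
    also have "\<dots> = tmap T T id ?u (simple T ?k (mult_map T z) \<one>)"
      using lin_closed[OF mult_map_lin[OF A] z(1)] by (simp add: tu)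
    finally show "\<exists>w\<in>carrier ?Tk. z = tmap T T id ?u w"
      using lin_closed[OF mult_map_lin[OF A] z(1)] by (intro bexI[of _ "simple T ?k (mult_map T z) \<one>"]) simp_all
  qed
  then have im: "?u ` carrier R = {x \<in> carrier T. ?g x = \<zero>\<^bsub>?TT\<^esub>}" by (simp add: exact_at_def)
  show "\<exists>r\<in>carrier R. x = ?u r" if x: "x \<in> carrier T" "simple T T \<one>\<^bsub>T\<^esub> x = simple T T x \<one>\<^bsub>T\<^esub>"
  proof -
    have "x \<in> {x \<in> carrier T. ?g x = \<zero>\<^bsub>?TT\<^esub>}"
      using x module_diff_eq_zero[of "T \<boxtimes> T"] by simp
    then show ?thesis unfolding im[symmetric] by blast
  qed
qed


section \<open>Galois maps and the antipode of a bialgebra with bijective Galois map\<close>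

definition left_mult :: "('a, 'm, 'x) module_scheme \<Rightarrow> ('a, 'n, 'y) module_scheme \<Rightarrow> 'm \<Rightarrow> ('m \<times> 'n) list set \<Rightarrow> ('m \<times> 'n) list set" where
  "left_mult A M x = tmap A M (\<lambda>a. x \<otimes>\<^bsub>A\<^esub> a) id"

lemma base_algebra_simps [simp]:
  "carrier (base_algebra R) = carrier R" "add (base_algebra R) = add R" "zero (base_algebra R) = zero R"
  "smult (base_algebra R) = mult R" "mult (base_algebra R) = mult R" "one (base_algebra R) = one R"
  by (simp_all add: base_algebra_def)

context
  fixes A :: "('a, 'm, 'x) module_scheme" and M :: "('a, 'n, 'y) module_scheme"
  assumes A: "nc_algebra R A" and M: "module R M"
begin

interpretation A: nc_algebra R A by (fact A)

private lemma modules [simp]: "module R A" "module R M" by (rule A.module_axioms) (rule M)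

lemma left_mult_lin: "x \<in> carrier A \<Longrightarrow> left_mult A M x \<in> lin (A \<boxtimes> M) (A \<boxtimes> M)"
  unfolding left_mult_def using mult_left_lin[OF A] by simp

lemma left_mult_simple:
  "x \<in> carrier A \<Longrightarrow> a \<in> carrier A \<Longrightarrow> m \<in> carrier M \<Longrightarrow>
    left_mult A M x (simple A M a m) = simple A M (x \<otimes>\<^bsub>A\<^esub> a) m"
  unfolding left_mult_def using mult_left_lin[OF A] by (simp add: tmap_simple[OF _ _ _ lin_id])

lemma left_mult_bilin: "left_mult A M \<in> bilin A (A \<boxtimes> M) (A \<boxtimes> M)"
proof (rule bilinI[OF left_mult_lin linI])
  fix w assume w: "w \<in> carrier (A \<boxtimes> M)"
  note l = left_mult_lin and s = left_mult_simple
  show "x \<in> carrier A \<Longrightarrow> left_mult A M x w \<in> carrier (A \<boxtimes> M)" for x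
    using lin_closed[OF left_mult_lin w] .
  show "left_mult A M (x \<oplus>\<^bsub>A\<^esub> y) w = left_mult A M x w \<oplus>\<^bsub>A \<boxtimes> M\<^esub> left_mult A M y w"
    if "x \<in> carrier A" "y \<in> carrier A" for x y
    by (rule bspec[OF tensor_eqI[OF modules l lin_plus[OF l l]] w])
      (use that in \<open>simp_all add: s A.l_distr simple_add_left\<close>)
  show "left_mult A M (r \<odot>\<^bsub>A\<^esub> x) w = r \<odot>\<^bsub>A \<boxtimes> M\<^esub> left_mult A M x w"
    if "r \<in> carrier R" "x \<in> carrier A" for r x
    by (rule bspec[OF tensor_eqI[OF modules l lin_scale[OF l]] w])
      (use that in \<open>simp_all add: s A.smult_mult_left simple_smult_left\<close>)
qed

lemma left_mult_mult:
  assumes "x \<in> carrier A" "y \<in> carrier A" "w \<in> carrier (A \<boxtimes> M)"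
  shows "left_mult A M (x \<otimes>\<^bsub>A\<^esub> y) w = left_mult A M x (left_mult A M y w)"
proof -
  have "\<forall>w\<in>carrier (A \<boxtimes> M). left_mult A M (x \<otimes>\<^bsub>A\<^esub> y) w = (left_mult A M x \<circ> left_mult A M y) w"
    by (rule tensor_eqI[OF modules], (rule lin_comp left_mult_lin assms | simp add: assms left_mult_simple A.m_assoc)+)
  then show ?thesis using assms(3) by simp
qed

lemma left_mult_one:
  assumes "w \<in> carrier (A \<boxtimes> M)"
  shows "left_mult A M \<one>\<^bsub>A\<^esub> w = w"
proof -
  have "\<forall>w\<in>carrier (A \<boxtimes> M). left_mult A M \<one>\<^bsub>A\<^esub> w = id w"
    by (rule tensor_eqI[OF modules], (rule left_mult_lin lin_id | simp add: left_mult_simple)+)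
  then show ?thesis using assms by simp
qed

context
  fixes \<delta>
  assumes \<delta>: "\<delta> \<in> lin A (A \<boxtimes> M)"
begin

private lemma galois_bilin: "(\<lambda>x y. left_mult A M x (\<delta> y)) \<in> bilin A A (A \<boxtimes> M)"
  using bilin_comp[OF left_mult_bilin lin_id \<delta> lin_id] by simp

lemma galois_map_lift: "galois_map R M A \<delta> = lift (A \<boxtimes> M) (\<lambda>x y. left_mult A M x (\<delta> y))"
  by (simp add: galois_map_def left_mult_def)

lemma galois_map_lin: "galois_map R M A \<delta> \<in> lin (A \<boxtimes> A) (A \<boxtimes> M)"
  unfolding galois_map_lift by (intro lift_lin galois_bilin) simp_all

lemma galois_map_simple:
  "x \<in> carrier A \<Longrightarrow> y \<in> carrier A \<Longrightarrow> galois_map R M A \<delta> (simple A A x y) = left_mult A M x (\<delta> y)"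
  unfolding galois_map_lift by (simp add: lift_simple[OF _ _ galois_bilin])

end

end

lemma galois_map_left_mult:
  assumes A: "nc_algebra R A" and M: "module R M" and \<delta>: "\<delta> \<in> lin A (A \<boxtimes> M)"
    and x: "x \<in> carrier A" and z: "z \<in> carrier (A \<boxtimes> A)"
  shows "galois_map R M A \<delta> (left_mult A A x z) = left_mult A M x (galois_map R M A \<delta> z)"
proof -
  interpret A: nc_algebra R A by (fact A)
  note [simp] = M A.module_axioms
  note g = galois_map_lin[OF A M \<delta>]
  have "\<forall>z\<in>carrier (A \<boxtimes> A). (galois_map R M A \<delta> \<circ> left_mult A A x) z = (left_mult A M x \<circ> galois_map R M A \<delta>) z"
  proof (rule tensor_eqI)
    show "galois_map R M A \<delta> \<circ> left_mult A A x \<in> lin (A \<boxtimes> A) (A \<boxtimes> M)"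
      by (rule lin_comp[OF left_mult_lin[OF A _ x] g]) simp
    show "left_mult A M x \<circ> galois_map R M A \<delta> \<in> lin (A \<boxtimes> A) (A \<boxtimes> M)"
      by (rule lin_comp[OF g left_mult_lin[OF A M x]])
  qed (simp_all add: x left_mult_simple[OF A] galois_map_simple[OF A M \<delta>] left_mult_mult[OF A M] lin_closed[OF \<delta>])
  then show ?thesis using z by simp
qed

text \<open>
  Put \<open>S h = (H \<otimes> \<epsilon>) (can\<^sup>-\<^sup>1 (1 \<otimes> h))\<close>. Left \<open>H\<close>-linearity of \<open>can\<close> gives \<open>h\<^sub>1 S(h\<^sub>2) = \<epsilon>(h)\<close>. Hence
  \<open>g \<otimes> h \<mapsto> g S(h\<^sub>1) \<otimes> h\<^sub>2\<close> is a left inverse of \<open>can\<close>, so \<open>S(h\<^sub>1) \<otimes> h\<^sub>2 = can\<^sup>-\<^sup>1 (1 \<otimes> h)\<close>; multiplying out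
  and using \<open>(H \<otimes> \<epsilon>) \<circ> can = mult\<close> yields \<open>S(h\<^sub>1) h\<^sub>2 = \<epsilon>(h)\<close>.
\<close>

lemma antipode_of_galois:
  assumes H: "nc_algebra R H" and \<Delta>: "\<Delta> \<in> lin H (H \<boxtimes> H)" and \<epsilon>: "\<epsilon> \<in> lin H (base_algebra R)"
    and coassoc: "\<And>h. h \<in> carrier H \<Longrightarrow>
      assoc H H H (tmap (H \<boxtimes> H) H \<Delta> id (\<Delta> h)) = tmap H (H \<boxtimes> H) id \<Delta> (\<Delta> h)"
    and counit_left: "\<And>h. h \<in> carrier H \<Longrightarrow> lift H (\<lambda>a b. \<epsilon> a \<odot>\<^bsub>H\<^esub> b) (\<Delta> h) = h"
    and counit_right: "\<And>h. h \<in> carrier H \<Longrightarrow> lift H (\<lambda>a b. \<epsilon> b \<odot>\<^bsub>H\<^esub> a) (\<Delta> h) = h"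
    and can: "galois_map R H H \<Delta> \<in> lin_iso (H \<boxtimes> H) (H \<boxtimes> H)"
  shows "\<exists>S\<in>lin H H. \<forall>h\<in>carrier H.
      lift H (\<lambda>a b. S a \<otimes>\<^bsub>H\<^esub> b) (\<Delta> h) = \<epsilon> h \<odot>\<^bsub>H\<^esub> \<one>\<^bsub>H\<^esub> \<and>
      lift H (\<lambda>a b. a \<otimes>\<^bsub>H\<^esub> S b) (\<Delta> h) = \<epsilon> h \<odot>\<^bsub>H\<^esub> \<one>\<^bsub>H\<^esub>"
proof -
  let ?can = "galois_map R H H \<Delta>" and ?HH = "H \<boxtimes> H"
  interpret H: nc_algebra R H by (fact H)
  note M [simp] = H.module_axioms
  note lm = left_mult_lin[OF H M] and lms [simp] = left_mult_simple[OF H M]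
  let ?L = "left_mult H H"
  have [simp]: "\<Delta> h \<in> carrier ?HH" "\<epsilon> h \<in> carrier R" if "h \<in> carrier H" for h
    using lin_closed[OF \<Delta> that] lin_closed[OF \<epsilon> that] by simp_all
  have b2: "(\<lambda>a b. \<epsilon> b \<odot>\<^bsub>H\<^esub> a) \<in> bilin H H H"
    by (rule bilinI') (simp_all add: lin_add[OF \<epsilon>] lin_smult[OF \<epsilon>] H.smult_l_distr H.smult_r_distr
        H.smult_assoc1[symmetric] m_comm)
  have b1: "(\<lambda>a b. \<epsilon> a \<odot>\<^bsub>H\<^esub> b) \<in> bilin H H H" using bilin_flip[OF b2] .
  \<comment> \<open>\<open>e2\<close> is the map \<open>H (x) \<epsilon>\<close> from the formula
    for \<open>S\<close>; \<open>g\<close> below is the inverse of the Galois map.\<close>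
  define e2 where "e2 = lift H (\<lambda>a b. \<epsilon> b \<odot>\<^bsub>H\<^esub> a)"
  have e2: "e2 \<in> lin ?HH H" unfolding e2_def by (intro lift_lin b2) simp_all
  have e2s [simp]: "e2 (simple H H a b) = \<epsilon> b \<odot>\<^bsub>H\<^esub> a" if "a \<in> carrier H" "b \<in> carrier H" for a b
    using that unfolding e2_def by (simp add: lift_simple[OF M M b2])
  have e2_left: "e2 (?L g w) = g \<otimes>\<^bsub>H\<^esub> e2 w" if g: "g \<in> carrier H" and w: "w \<in> carrier ?HH" for g w
  proof -
    have "\<forall>w\<in>carrier ?HH. (e2 \<circ> ?L g) w = ((\<lambda>x. g \<otimes>\<^bsub>H\<^esub> x) \<circ> e2) w"
      by (rule tensor_eqI[OF M M], (rule lin_comp[OF lm[OF g] e2] lin_comp[OF e2 mult_left_lin[OF H g]]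
        | simp add: g H.smult_mult_right)+)
    then show ?thesis using w by simp
  qed
  have e2\<Delta>: "e2 (\<Delta> h) = h" if "h \<in> carrier H" for h using counit_right[OF that] by (simp add: e2_def)
  note cl = galois_map_lin[OF H M \<Delta>]
  note cs = galois_map_simple[OF H M \<Delta>]
  have e2can: "e2 (?can z) = mult_map H z" if z: "z \<in> carrier ?HH" for z
  proof -
    have "\<forall>z\<in>carrier ?HH. (e2 \<circ> ?can) z = mult_map H z"
      by (rule tensor_eqI[OF M M], (rule lin_comp[OF cl e2] mult_map_lin[OF H]
        | simp add: cs e2_left e2\<Delta> mult_map_simple[OF H])+)
    then show ?thesis using z by simp
  qed
  define g where "g = inv_into (carrier ?HH) ?can"
  note G = lin_iso_inv(1-3)[OF can tensor_module[OF M M], folded g_def]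
  have gc: "g w \<in> carrier ?HH" if "w \<in> carrier ?HH" for w using lin_closed[OF G(1) that] .
  have g_left: "g (?L x w) = ?L x (g w)" if x: "x \<in> carrier H" and w: "w \<in> carrier ?HH" for x w
    using galois_map_left_mult[OF H M \<Delta> x gc[OF w]] G(2)[of "?L x (g w)"] G(3)[OF w] gc[OF w] lin_closed[OF lm[OF x]]
    by simp
  define S where "S h = e2 (g (simple H H \<one>\<^bsub>H\<^esub> h))" for h
  have S: "S \<in> lin H H"
    using lin_comp[OF lin_comp[OF simple_lin_right[OF M M H.one_closed] G(1)] e2] by (simp add: comp_def S_def[abs_def])
  note Sc [simp] = lin_closed[OF S]
  have bS: "(\<lambda>a b. a \<otimes>\<^bsub>H\<^esub> S b) \<in> bilin H H H" "(\<lambda>a b. S a \<otimes>\<^bsub>H\<^esub> b) \<in> bilin H H H"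
    using bilin_comp[OF nc_algebraD(3)[OF H] lin_id S lin_id] bilin_comp[OF nc_algebraD(3)[OF H] S lin_id lin_id] by simp_all
  define X1 where "X1 = lift H (\<lambda>a b. a \<otimes>\<^bsub>H\<^esub> S b)"
  have X1: "X1 \<in> lin ?HH H" unfolding X1_def by (intro lift_lin bS) simp_all
  have X1s [simp]: "X1 (simple H H a b) = a \<otimes>\<^bsub>H\<^esub> S b" if "a \<in> carrier H" "b \<in> carrier H" for a b
    using that unfolding X1_def by (simp add: lift_simple[OF M M bS(1)])
  have "\<forall>z\<in>carrier ?HH. X1 z = (e2 \<circ> g) z"
  proof (rule tensor_eqI[OF M M X1 lin_comp[OF G(1) e2] M])
    fix a b assume ab: "a \<in> carrier H" "b \<in> carrier H"
    then have "e2 (g (simple H H a b)) = e2 (g (?L a (simple H H \<one>\<^bsub>H\<^esub> b)))" by simp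
    also have "\<dots> = a \<otimes>\<^bsub>H\<^esub> S b" using ab by (simp add: g_left e2_left gc S_def del: lms)
    finally show "X1 (simple H H a b) = (e2 \<circ> g) (simple H H a b)" using ab by simp
  qed
  then have X1g: "X1 z = e2 (g z)" if "z \<in> carrier ?HH" for z using that by simp
  \<comment> \<open>The Galois map sends \<open>1 (x) h\<close> to \<open>\<Delta> h\<close>, so
    \<open>g\<close> sends \<open>\<Delta> h\<close> back to \<open>1 (x) h\<close>, and
    \<open>e2\<close> evaluates this to \<open>\<epsilon>(h) 1\<close>.\<close>
  have right: "X1 (\<Delta> h) = \<epsilon> h \<odot>\<^bsub>H\<^esub> \<one>\<^bsub>H\<^esub>" if h: "h \<in> carrier H" for h
    using G(2)[of "simple H H \<one>\<^bsub>H\<^esub> h"] h by (simp add: X1g cs left_mult_one[OF H M])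
  define \<phi> where "\<phi> = tmap H H S id \<circ> \<Delta>"
  have \<phi>: "\<phi> \<in> lin H ?HH" unfolding \<phi>_def by (rule lin_comp[OF \<Delta>]) (simp add: S)
  \<comment> \<open>The candidate left inverse is itself of Galois type, with
    \<open>\<phi> h\<close>, standing for the sum of \<open>S(h\<^sub>1) (x) h\<^sub>2\<close>, in
    place of the comultiplication.\<close>
  let ?Th = "galois_map R H H \<phi>"
  note ths = galois_map_simple[OF H M \<phi>] and thl = galois_map_lin[OF H M \<phi>]
  define X where "X = tmap H H X1 id \<circ> assoc_inv H H H"
  have X: "X \<in> lin (H \<boxtimes> ?HH) ?HH" unfolding X_def by (rule lin_comp[OF assoc_inv_lin]) (simp_all add: X1)
  have X_eq: "X (simple H ?HH a u) = ?L a (tmap H H S id u)" if a: "a \<in> carrier H" and u: "u \<in> carrier ?HH" for a u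
  proof -
    have "\<forall>u\<in>carrier ?HH. (X \<circ> simple H ?HH a) u = (?L a \<circ> tmap H H S id) u"
    proof (rule tensor_eqI[OF M M])
      show "X \<circ> simple H ?HH a \<in> lin ?HH ?HH" by (rule lin_comp[OF _ X]) (simp add: a)
      show "?L a \<circ> tmap H H S id \<in> lin ?HH ?HH" by (rule lin_comp[OF _ lm[OF a]]) (simp add: S)
    qed (simp_all add: X_def a tmap_simple[OF _ _ X1 lin_id] tmap_simple[OF _ _ S lin_id])
    then show ?thesis using u by simp
  qed
  have thX: "?Th w = X (tmap H ?HH id \<Delta> w)" if w: "w \<in> carrier ?HH" for w
  proof -
    have "\<forall>w\<in>carrier ?HH. ?Th w = (X \<circ> tmap H ?HH id \<Delta>) w"
    proof (rule tensor_eqI[OF M M thl])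
      show "X \<circ> tmap H ?HH id \<Delta> \<in> lin ?HH ?HH" by (rule lin_comp[OF _ X]) (simp add: \<Delta>)
    qed (simp_all add: ths tmap_simple[OF _ _ lin_id \<Delta>] X_eq, simp add: \<phi>_def)
    then show ?thesis using w by simp
  qed
  \<comment> \<open>By coassociativity \<open>?Th (\<Delta> b)\<close> is the sum of
    \<open>b\<^sub>1 S(b\<^sub>2) (x) b\<^sub>3\<close>; the identity \<open>right\<close> applied
    to the first two legs leaves \<open>\<epsilon>(b\<^sub>1) 1 (x) b\<^sub>2\<close>, which is
    \<open>1 (x) b\<close>.\<close>
  have th\<Delta>: "?Th (\<Delta> b) = simple H H \<one>\<^bsub>H\<^esub> b" if b: "b \<in> carrier H" for b
  proof -
    have t: "tmap ?HH H \<Delta> id (\<Delta> b) \<in> carrier (?HH \<boxtimes> H)"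
      by (rule lin_closed[OF tmap_lin[OF \<Delta> lin_id]]) (simp_all add: b)
    have "?Th (\<Delta> b) = X (assoc H H H (tmap ?HH H \<Delta> id (\<Delta> b)))"
      using b by (simp add: thX coassoc)
    also have "\<dots> = tmap H H X1 id (tmap ?HH H \<Delta> id (\<Delta> b))"
      using t by (simp add: X_def assoc_inv_assoc)
    also have "\<dots> = tmap H H (X1 \<circ> \<Delta>) (id \<circ> id) (\<Delta> b)"
      by (rule tmap_tmap[OF \<Delta> lin_id X1 lin_id]) (simp_all add: b)
    also have "\<dots> = tmap H H (\<lambda>h. \<epsilon> h \<odot>\<^bsub>H\<^esub> \<one>\<^bsub>H\<^esub>) id (\<Delta> b)"
      by (rule tmap_cong[OF lin_comp[OF \<Delta> X1], of _ H H]) (simp_all add: b right)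
    also have "\<dots> = simple H H \<one>\<^bsub>H\<^esub> (lift H (\<lambda>a b. \<epsilon> a \<odot>\<^bsub>H\<^esub> b) (\<Delta> b))"
    proof -
      have l: "(\<lambda>h. \<epsilon> h \<odot>\<^bsub>H\<^esub> \<one>\<^bsub>H\<^esub>) \<in> lin H H"
        using bilinD(2)[OF b1 H.one_closed] .
      have "\<forall>w\<in>carrier ?HH. tmap H H (\<lambda>h. \<epsilon> h \<odot>\<^bsub>H\<^esub> \<one>\<^bsub>H\<^esub>) id w =
        (simple H H \<one>\<^bsub>H\<^esub> \<circ> lift H (\<lambda>a b. \<epsilon> a \<odot>\<^bsub>H\<^esub> b)) w"
      proof (rule tensor_eqI[OF M M])
        show "simple H H \<one>\<^bsub>H\<^esub> \<circ> lift H (\<lambda>a b. \<epsilon> a \<odot>\<^bsub>H\<^esub> b) \<in> lin ?HH ?HH"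
          by (rule lin_comp[OF lift_lin[OF M M b1 M]]) simp
      qed (simp_all add: l tmap_simple[OF _ _ l lin_id] lift_simple[OF _ _ b1] simple_smult_left simple_smult_right)
      then show ?thesis using b by simp
    qed
    finally show ?thesis using counit_left[OF b] by simp
  qed
  have "\<forall>z\<in>carrier ?HH. (?Th \<circ> ?can) z = id z"
    by (rule tensor_eqI[OF M M], (rule lin_comp[OF cl thl] lin_id
      | simp add: cs galois_map_left_mult[OF H M \<phi>] th\<Delta>)+)
  then have thcan: "?Th (?can z) = z" if "z \<in> carrier ?HH" for z using that by simp
  \<comment> \<open>A left inverse of a bijection is its inverse, so \<open>?Th\<close> agrees with
    \<open>g\<close>; at \<open>1 (x) h\<close> the value of \<open>?Th\<close> is
    \<open>\<phi> h\<close>.\<close>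
  have \<phi>g: "\<phi> h = g (simple H H \<one>\<^bsub>H\<^esub> h)" if h: "h \<in> carrier H" for h
    using thcan[OF gc, of "simple H H \<one>\<^bsub>H\<^esub> h"] h lin_closed[OF \<phi> h]
    by (simp add: G(3) ths left_mult_one[OF H M])
  have left: "lift H (\<lambda>a b. S a \<otimes>\<^bsub>H\<^esub> b) (\<Delta> h) = \<epsilon> h \<odot>\<^bsub>H\<^esub> \<one>\<^bsub>H\<^esub>" if h: "h \<in> carrier H" for h
  proof -
    have "\<forall>z\<in>carrier ?HH. lift H (\<lambda>a b. S a \<otimes>\<^bsub>H\<^esub> b) z = (mult_map H \<circ> tmap H H S id) z"
    proof (rule tensor_eqI[OF M M lift_lin[OF M M bS(2) M]])
      show "mult_map H \<circ> tmap H H S id \<in> lin ?HH H"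
        by (rule lin_comp[OF _ mult_map_lin[OF H]]) (simp add: S)
    qed (simp_all add: lift_simple[OF _ _ bS(2)] tmap_simple[OF _ _ S lin_id] mult_map_simple[OF H])
    then have "lift H (\<lambda>a b. S a \<otimes>\<^bsub>H\<^esub> b) (\<Delta> h) = mult_map H (\<phi> h)" using h by (simp add: \<phi>_def)
    also have "\<dots> = e2 (?can (g (simple H H \<one>\<^bsub>H\<^esub> h)))" using h by (simp add: \<phi>g e2can gc)
    also have "\<dots> = \<epsilon> h \<odot>\<^bsub>H\<^esub> \<one>\<^bsub>H\<^esub>" using h by (simp add: G(3))
    finally show ?thesis .
  qed
  show ?thesis using S left right by (intro bexI[of _ S]) (simp_all add: X1_def)
qed


section \<open>Naturality, products in tensor algebras, and factoring through injective maps\<close>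

lemma assoc_natural:
  assumes M: "module R L" "module R M" "module R N" "module R P" "module R Q" "module R S"
    and f: "f \<in> lin L P" and g: "g \<in> lin M Q" and h: "h \<in> lin N S" and z: "z \<in> carrier ((L \<boxtimes> M) \<boxtimes> N)"
  shows "assoc P Q S (tmap (P \<boxtimes> Q) S (tmap P Q f g) h z) = tmap P (Q \<boxtimes> S) f (tmap Q S g h) (assoc L M N z)"
proof -
  note [simp] = M lin_closed[OF f] lin_closed[OF g] lin_closed[OF h]
  note fg = tmap_lin[OF f g M(1,2,4,5)] and gh = tmap_lin[OF g h M(2,3,5,6)]
  have "\<forall>z\<in>carrier ((L \<boxtimes> M) \<boxtimes> N). (assoc P Q S \<circ> tmap (P \<boxtimes> Q) S (tmap P Q f g) h) z =
    (tmap P (Q \<boxtimes> S) f (tmap Q S g h) \<circ> assoc L M N) z"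
    by (rule tensor_eqI_left[OF M(1-3)], (rule lin_comp[OF tmap_lin[OF fg h] assoc_lin] lin_comp[OF assoc_lin tmap_lin[OF f gh]] tensor_module M
        | simp add: tmap_simple[OF _ _ f g] tmap_simple[OF _ _ g h] tmap_simple[OF _ _ fg h] tmap_simple[OF _ _ f gh])+)
  then show ?thesis using z by simp
qed

lemma swap_natural:
  assumes M: "module R L" "module R M" "module R P" "module R Q"
    and f: "f \<in> lin L P" and g: "g \<in> lin M Q" and z: "z \<in> carrier (L \<boxtimes> M)"
  shows "swap P Q (tmap P Q f g z) = tmap Q P g f (swap L M z)"
proof -
  note [simp] = M lin_closed[OF f] lin_closed[OF g]
  have "\<forall>z\<in>carrier (L \<boxtimes> M). (swap P Q \<circ> tmap P Q f g) z = (tmap Q P g f \<circ> swap L M) z"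
    by (rule tensor_eqI[OF M(1,2)], (rule lin_comp[OF tmap_lin[OF f g] swap_lin] lin_comp[OF swap_lin tmap_lin[OF g f]] tensor_module M
        | simp add: tmap_simple[OF _ _ f g] tmap_simple[OF _ _ g f])+)
  then show ?thesis using z by simp
qed

lemma id_algebra_hom: "id \<in> algebra_homs R A A"
  by (rule algebra_homI[OF lin_id]) simp_all

lemma assoc_algebra_hom:
  assumes A: "nc_algebra R A" and B: "nc_algebra R B" and C: "nc_algebra R C"
  shows "assoc A B C \<in> algebra_homs R ((A \<boxtimes> B) \<boxtimes> C) (A \<boxtimes> (B \<boxtimes> C))"
proof (rule algebra_homI)
  note M [simp] = nc_algebraD(1)[OF A] nc_algebraD(1)[OF B] nc_algebraD(1)[OF C]
  interpret A: nc_algebra R A by fact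
  interpret B: nc_algebra R B by fact
  interpret C: nc_algebra R C by fact
  note AB = tensor_nc_algebra[OF A B] and BC = tensor_nc_algebra[OF B C]
  note P = tensor_nc_algebra[OF AB C] and Q = tensor_nc_algebra[OF A BC]
  note Pb = nc_algebraD(3)[OF P] and Qb = nc_algebraD(3)[OF Q]
  interpret AB: nc_algebra R "A \<boxtimes> B" by (rule AB)
  show l: "assoc A B C \<in> lin ((A \<boxtimes> B) \<boxtimes> C) (A \<boxtimes> (B \<boxtimes> C))" by simp
  show "assoc A B C \<one>\<^bsub>(A \<boxtimes> B) \<boxtimes> C\<^esub> = \<one>\<^bsub>A \<boxtimes> (B \<boxtimes> C)\<^esub>"
    by (simp add: tensor_one A B C AB BC)
  note f = bilin_comp[OF Pb lin_id lin_id l, simplified] and g = bilin_comp[OF Qb l l lin_id, simplified]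
  have 1: "assoc A B C (X \<otimes>\<^bsub>(A \<boxtimes> B) \<boxtimes> C\<^esub> simple (A \<boxtimes> B) C (simple A B a b) c) =
    assoc A B C X \<otimes>\<^bsub>A \<boxtimes> (B \<boxtimes> C)\<^esub> assoc A B C (simple (A \<boxtimes> B) C (simple A B a b) c)"
    if X: "X \<in> carrier ((A \<boxtimes> B) \<boxtimes> C)" and abc: "a \<in> carrier A" "b \<in> carrier B" "c \<in> carrier C" for X a b c
  proof -
    have s: "simple (A \<boxtimes> B) C (simple A B a b) c \<in> carrier ((A \<boxtimes> B) \<boxtimes> C)" using abc by simp
    show ?thesis
      by (rule bspec[OF tensor_eqI_left[OF M bilinD(2)[OF f s] bilinD(2)[OF g s]] X])
        (simp_all add: abc tensor_mult_simple A B C AB BC)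
  qed
  show "assoc A B C (X \<otimes>\<^bsub>(A \<boxtimes> B) \<boxtimes> C\<^esub> Y) = assoc A B C X \<otimes>\<^bsub>A \<boxtimes> (B \<boxtimes> C)\<^esub> assoc A B C Y"
    if X: "X \<in> carrier ((A \<boxtimes> B) \<boxtimes> C)" and Y: "Y \<in> carrier ((A \<boxtimes> B) \<boxtimes> C)" for X Y
    by (rule bspec[OF tensor_eqI_left[OF M bilinD(1)[OF f X] bilinD(1)[OF g X]] Y]) (simp_all add: 1[OF X] del: assoc_simple)
qed

lemma left_mult_eq:
  assumes A: "nc_algebra R A" and B: "nc_algebra R B" and x: "x \<in> carrier A" and w: "w \<in> carrier (A \<boxtimes> B)"
  shows "left_mult A B x w = simple A B x \<one>\<^bsub>B\<^esub> \<otimes>\<^bsub>A \<boxtimes> B\<^esub> w"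
proof -
  interpret A: nc_algebra R A by fact
  interpret B: nc_algebra R B by fact
  note M [simp] = nc_algebraD(1)[OF A] nc_algebraD(1)[OF B]
  have s: "simple A B x \<one>\<^bsub>B\<^esub> \<in> carrier (A \<boxtimes> B)" using x by simp
  show ?thesis
    by (rule bspec[OF tensor_eqI[OF M left_mult_lin[OF A M(2) x] bilinD(1)[OF tensor_mult_bilin[OF A B] s]] w])
      (simp_all add: x left_mult_simple[OF A] tensor_mult_simple A B)
qed

lemma left_mult_mult_assoc:
  assumes A: "nc_algebra R A" and B: "nc_algebra R B" and x: "x \<in> carrier A"
    and v: "v \<in> carrier (A \<boxtimes> B)" and w: "w \<in> carrier (A \<boxtimes> B)"
  shows "left_mult A B x (v \<otimes>\<^bsub>A \<boxtimes> B\<^esub> w) = left_mult A B x v \<otimes>\<^bsub>A \<boxtimes> B\<^esub> w"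
proof -
  interpret P: nc_algebra R "A \<boxtimes> B" using tensor_nc_algebra[OF A B] .
  interpret B: nc_algebra R B by fact
  show ?thesis
    using x v w nc_algebraD(1)[OF A] nc_algebraD(1)[OF B] by (simp add: left_mult_eq[OF A B] P.m_assoc)
qed

text \<open>The source of \<open>delta\<close>, \<open>eps\<close> and \<open>Delta\<close>: each
  formula is first shown to take values in the image of an injective inclusion
  \<open>j\<close>.\<close>

lemma lin_factor:
  assumes j: "j \<in> lin M N" and inj: "inj_on j (carrier M)" and f: "f \<in> lin L N" and M: "module R M"
    and im: "\<And>x. x \<in> carrier L \<Longrightarrow> f x \<in> j ` carrier M"
  obtains g where "g \<in> lin L M" "\<And>x. x \<in> carrier L \<Longrightarrow> j (g x) = f x"
proof
  interpret M: module R M by fact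
  let ?g = "\<lambda>x. inv_into (carrier M) j (f x)"
  show eq: "j (?g x) = f x" if "x \<in> carrier L" for x using f_inv_into_f[OF im[OF that]] .
  have c: "?g x \<in> carrier M" if "x \<in> carrier L" for x using inv_into_into[OF im[OF that]] .
  have u: "inv_into (carrier M) j y = m" if "m \<in> carrier M" "j m = y" for y m
    using inv_into_f_f[OF inj that(1)] that(2) by simp
  show "?g \<in> lin L M"
    by (rule linI) (auto intro!: u simp: c lin_add[OF j] lin_smult[OF j] eq lin_add[OF f] lin_smult[OF f])
qed

text \<open>Because \<open>j\<close> is injective and multiplicative, the algebra laws for
  \<open>g\<close> may be tested after \<open>j\<close>, where they are laws of the explicit formula
  \<open>f\<close>.\<close>

lemma algebra_hom_factor:
  assumes A: "nc_algebra R A" and M: "nc_algebra R M" and j: "j \<in> algebra_homs R M N" and inj: "inj_on j (carrier M)"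
    and f1: "f \<one>\<^bsub>A\<^esub> = \<one>\<^bsub>N\<^esub>"
    and fm: "\<And>x y. x \<in> carrier A \<Longrightarrow> y \<in> carrier A \<Longrightarrow> f (x \<otimes>\<^bsub>A\<^esub> y) = f x \<otimes>\<^bsub>N\<^esub> f y"
    and g: "g \<in> lin A M" and eq: "\<And>x. x \<in> carrier A \<Longrightarrow> j (g x) = f x"
  shows "g \<in> algebra_homs R A M"
proof -
  interpret A: nc_algebra R A by fact
  interpret M: nc_algebra R M by fact
  note J = algebra_homD[OF j]
  show ?thesis
    by (rule algebra_homI[OF g]; rule inj_onD[OF inj])
      (simp_all add: eq f1 fm J lin_closed[OF g])
qed

lemma lin_iso_cancel:
  assumes p: "p \<in> lin_iso L M" and q: "q \<in> lin_iso L N" and f: "f \<in> lin M N" and L: "module R L"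
    and eq: "\<And>x. x \<in> carrier L \<Longrightarrow> f (p x) = q x"
  shows "f \<in> lin_iso M N"
proof -
  note P = lin_iso_inv[OF p L] lin_isoD[OF p] and Q = lin_isoD[OF q]
  have "bij_betw (q \<circ> inv_into (carrier L) p) (carrier M) (carrier N)"
    using lin_isoD(2)[OF lin_iso_comp[OF P(4) q]] .
  moreover have "(q \<circ> inv_into (carrier L) p) y = f y" if "y \<in> carrier M" for y
    using eq[of "inv_into (carrier L) p y"] P(3)[OF that] lin_closed[OF P(1) that] by simp
  ultimately have "bij_betw f (carrier M) (carrier N)" by (metis (no_types, lifting) bij_betw_cong)
  with f show ?thesis by (simp add: lin_iso_def)
qed

lemma inj_on_square:
  assumes a: "inj_on a (carrier L)" and g: "inj_on g (a ` carrier L)"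
    and eq: "\<And>x. x \<in> carrier L \<Longrightarrow> c (f x) = g (a x)"
  shows "inj_on f (carrier L)"
  by (rule inj_onI) (metis a eq g image_eqI inj_on_def)

section \<open>Flatness of a module \<open>H\<close> for which \<open>T (x) H\<close> is isomorphic
  to \<open>T (x) T\<close>\<close>

context
  fixes T :: "('a, 't, 'y) module_scheme"
  assumes T: "module R T" and ff: "faithfully_flat TYPE(('a, 't) small) R T"
begin

text \<open>Up to rebracketing the map is \<open>T (x) (W (x) f)\<close>, so flatness of
  \<open>T\<close> suffices. Iteration handles every tensor power of \<open>T\<close>.\<close>

lemma inj_tmap_step:
  assumes M: "module R W" "module R M" "module R N" and f: "f \<in> lin M N"
    and e: "embeddable TYPE(('a, 't) small) W" "embeddable TYPE(('a, 't) small) M" "embeddable TYPE(('a, 't) small) N"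
    and inj: "inj_on (tmap W N id f) (carrier (W \<boxtimes> M))"
  shows "inj_on (tmap (T \<boxtimes> W) N id f) (carrier ((T \<boxtimes> W) \<boxtimes> M))"
proof (rule inj_on_square)
  note [simp] = T M
  note a = lin_isoD(2)[OF lin_iso_assoc(1)[OF T M(1,2)]]
  show "inj_on (assoc T W M) (carrier ((T \<boxtimes> W) \<boxtimes> M))" using a by (simp add: bij_betw_def)
  show "inj_on (tmap T (W \<boxtimes> N) id (tmap W N id f)) (assoc T W M ` carrier ((T \<boxtimes> W) \<boxtimes> M))"
    using a faithfully_flat_inj[OF T ff _ _ _ _ tmap_lin[OF lin_id f], of W] inj e
    by (simp add: bij_betw_def embeddable_tensor)
  fix x assume x: "x \<in> carrier ((T \<boxtimes> W) \<boxtimes> M)"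
  \<comment> \<open>The identity of \<open>T (x) W\<close> is split as \<open>id (x) id\<close>, the
    shape in which \<open>assoc_natural\<close> applies.\<close>
  have "tmap (T \<boxtimes> W) N (tmap T W id id) f x = tmap (T \<boxtimes> W) N id f x"
    by (rule tmap_cong[of _ "T \<boxtimes> W" _ _ M]) (simp_all add: x f tmap_id)
  then show "assoc T W N (tmap (T \<boxtimes> W) N id f x) = tmap T (W \<boxtimes> N) id (tmap W N id f) (assoc T W M x)"
    using assoc_natural[OF T M(1,2) T M(1,3) lin_id lin_id f x] by simp
qed

context
  fixes H :: "('a, 'h, 'z) module_scheme" and \<phi>
  assumes H: "module R H" and \<phi>: "\<phi> \<in> lin_iso (T \<boxtimes> H) (T \<boxtimes> T)"
    and eH: "embeddable TYPE(('a, 't) small) H"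
begin

text \<open>Applies \<open>\<phi>\<close> to the first two factors. Since \<open>M\<close> is left
  alone, the isomorphism is natural in \<open>M\<close> whatever the isomorphism
  \<open>\<phi>\<close> is.\<close>

private lemma base_change:
  assumes M: "module R M"
  shows "assoc T T M \<circ> tmap (T \<boxtimes> T) M \<phi> id \<circ> assoc_inv T H M \<in> lin_iso (T \<boxtimes> (H \<boxtimes> M)) (T \<boxtimes> (T \<boxtimes> M))"
  using lin_iso_comp[OF lin_iso_assoc(2)[OF T H M] lin_iso_comp[OF lin_iso_tmap[OF \<phi> lin_iso_id] lin_iso_assoc(1)[OF T T M]]]
  by (simp add: T H M comp_assoc)

private lemma base_change_natural:
  assumes M: "module R M" "module R N" and f: "f \<in> lin M N" and z: "z \<in> carrier (T \<boxtimes> (H \<boxtimes> M))"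
  shows "(assoc T T N \<circ> tmap (T \<boxtimes> T) N \<phi> id \<circ> assoc_inv T H N) (tmap T (H \<boxtimes> N) id (tmap H N id f) z) =
    tmap T (T \<boxtimes> N) id (tmap T N id f) ((assoc T T M \<circ> tmap (T \<boxtimes> T) M \<phi> id \<circ> assoc_inv T H M) z)"
proof -
  note [simp] = T H M
  note l = lin_isoD(1)[OF \<phi>]
  note hf = tmap_lin[OF lin_id f H M(1) H M(2)] and tf = tmap_lin[OF lin_id f T M(1) T M(2)]
  have "\<forall>z\<in>carrier (T \<boxtimes> (H \<boxtimes> M)).
    ((assoc T T N \<circ> tmap (T \<boxtimes> T) N \<phi> id \<circ> assoc_inv T H N) \<circ> tmap T (H \<boxtimes> N) id (tmap H N id f)) z =
    (tmap T (T \<boxtimes> N) id (tmap T N id f) \<circ> (assoc T T M \<circ> tmap (T \<boxtimes> T) M \<phi> id \<circ> assoc_inv T H M)) z"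
  proof (rule tensor_eqI_right[OF T H M(1)])
    show "(assoc T T N \<circ> tmap (T \<boxtimes> T) N \<phi> id \<circ> assoc_inv T H N) \<circ> tmap T (H \<boxtimes> N) id (tmap H N id f)
      \<in> lin (T \<boxtimes> (H \<boxtimes> M)) (T \<boxtimes> (T \<boxtimes> N))"
      by (rule lin_comp[OF tmap_lin[OF lin_id hf] lin_isoD(1)[OF base_change]]) simp_all
    show "tmap T (T \<boxtimes> N) id (tmap T N id f) \<circ> (assoc T T M \<circ> tmap (T \<boxtimes> T) M \<phi> id \<circ> assoc_inv T H M)
      \<in> lin (T \<boxtimes> (H \<boxtimes> M)) (T \<boxtimes> (T \<boxtimes> N))"
      by (rule lin_comp[OF lin_isoD(1)[OF base_change] tmap_lin[OF lin_id tf]]) simp_all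
    fix t h m assume a: "t \<in> carrier T" "h \<in> carrier H" "m \<in> carrier M"
    let ?v = "\<phi> (simple T H t h)"
    have v: "?v \<in> carrier (T \<boxtimes> T)" using a lin_closed[OF l] by simp
    have "assoc T T N (simple (T \<boxtimes> T) N ?v (f m)) = tmap T (T \<boxtimes> N) id (tmap T N id f) (assoc T T M (simple (T \<boxtimes> T) M ?v m))"
      using assoc_natural[OF T T M(1) T T M(2) lin_id lin_id f, of "simple (T \<boxtimes> T) M ?v m"] a v
      by (simp add: tmap_simple[OF _ _ tmap_lin[OF lin_id lin_id] f] tmap_id)
    then show "((assoc T T N \<circ> tmap (T \<boxtimes> T) N \<phi> id \<circ> assoc_inv T H N) \<circ> tmap T (H \<boxtimes> N) id (tmap H N id f))
        (simple T (H \<boxtimes> M) t (simple H M h m)) =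
      (tmap T (T \<boxtimes> N) id (tmap T N id f) \<circ> (assoc T T M \<circ> tmap (T \<boxtimes> T) M \<phi> id \<circ> assoc_inv T H M))
        (simple T (H \<boxtimes> M) t (simple H M h m))"
      using a by (simp add: tmap_simple[OF _ _ lin_id hf] tmap_simple[OF _ _ lin_id f] tmap_simple[OF _ _ l lin_id] lin_closed[OF f])
  qed simp
  then show ?thesis using z by simp
qed

text \<open>Two uses of flatness make \<open>T (x) (T (x) -)\<close> of the sequence exact; by
  \<open>base_change\<close> this is \<open>T (x) (H (x) -)\<close> of it, and faithfulness of
  \<open>T\<close> removes the outer factor.\<close>

lemma flat_of_base_change:
  assumes M: "module R M1" "module R M2" "module R M3"
    and e: "embeddable TYPE(('a, 't) small) M1" "embeddable TYPE(('a, 't) small) M2" "embeddable TYPE(('a, 't) small) M3"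
    and f: "f \<in> lin M1 M2" and g: "g \<in> lin M2 M3" and ex: "exact_at M1 M2 M3 f g"
  shows "exact_at (H \<boxtimes> M1) (H \<boxtimes> M2) (H \<boxtimes> M3) (tmap H M2 id f) (tmap H M3 id g)"
proof -
  note [simp] = T H M
  note f2 = tmap_lin[OF lin_id f] and g2 = tmap_lin[OF lin_id g]
  have eT: "embeddable TYPE(('a, 't) small) T" by (rule embeddable_self)
  have "exact_at (T \<boxtimes> (T \<boxtimes> M1)) (T \<boxtimes> (T \<boxtimes> M2)) (T \<boxtimes> (T \<boxtimes> M3))
      (tmap T (T \<boxtimes> M2) id (tmap T M2 id f)) (tmap T (T \<boxtimes> M3) id (tmap T M3 id g))"
    using ex by (subst faithfully_flat_exact[OF T ff, symmetric], simp_all add: f2 g2 embeddable_tensor eT e)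
      (subst faithfully_flat_exact[OF T ff, symmetric], simp_all add: f g e)
  then have "exact_at (T \<boxtimes> (H \<boxtimes> M1)) (T \<boxtimes> (H \<boxtimes> M2)) (T \<boxtimes> (H \<boxtimes> M3))
      (tmap T (H \<boxtimes> M2) id (tmap H M2 id f)) (tmap T (H \<boxtimes> M3) id (tmap H M3 id g))"
    by (subst exact_at_iso[OF base_change[OF M(1)] base_change[OF M(2)] base_change[OF M(3)]])
      (simp_all only: base_change_natural M f g, simp_all add: f2 g2 f g)
  then show ?thesis
    by (subst faithfully_flat_exact[OF T ff]) (simp_all add: f g embeddable_tensor eH e)
qed

lemma flat_inj_of_base_change:
  assumes M: "module R M" "module R N"
    and e: "embeddable TYPE(('a, 't) small) M" "embeddable TYPE(('a, 't) small) N"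
    and f: "f \<in> lin M N" and inj: "inj_on f (carrier M)"
  shows "inj_on (tmap H N id f) (carrier (H \<boxtimes> M))"
proof -
  note [simp] = T H M
  have eT: "embeddable TYPE(('a, 't) small) T" by (rule embeddable_self)
  have i: "inj_on (tmap T (T \<boxtimes> N) id (tmap T N id f)) (carrier (T \<boxtimes> (T \<boxtimes> M)))"
    using inj by (simp add: faithfully_flat_inj[OF T ff, symmetric] embeddable_tensor eT e f)
  note b = lin_isoD(2)[OF base_change[OF M(1)]]
  have "inj_on (tmap T (H \<boxtimes> N) id (tmap H N id f)) (carrier (T \<boxtimes> (H \<boxtimes> M)))"
  proof (rule inj_on_square)
    show "inj_on (assoc T T M \<circ> tmap (T \<boxtimes> T) M \<phi> id \<circ> assoc_inv T H M) (carrier (T \<boxtimes> (H \<boxtimes> M)))"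
      using b by (simp only: bij_betw_def)
    show "inj_on (tmap T (T \<boxtimes> N) id (tmap T N id f))
      ((assoc T T M \<circ> tmap (T \<boxtimes> T) M \<phi> id \<circ> assoc_inv T H M) ` carrier (T \<boxtimes> (H \<boxtimes> M)))"
      using b i by (simp only: bij_betw_def)
  qed (rule base_change_natural[OF M f])
  then show ?thesis
    by (simp add: faithfully_flat_inj[OF T ff, symmetric] embeddable_tensor eH e f)
qed

end

end

end

lemma (in cring) mult_first_left_mult:
  assumes A: "nc_algebra R A" and M: "module R M" and x: "x \<in> carrier A" and v: "v \<in> carrier (A \<boxtimes> M)"
  shows "mult_first R A M (simple A (A \<boxtimes> M) x v) = left_mult A M x v"
proof -
  note [simp] = M nc_algebraD(1)[OF A]
  have "\<forall>v\<in>carrier (A \<boxtimes> M). (mult_first R A M \<circ> simple A (A \<boxtimes> M) x) v = left_mult A M x v"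
    by (rule tensor_eqI[OF nc_algebraD(1)[OF A] M], (rule lin_comp[OF simple_lin_right mult_first_lin[OF A M]]
      left_mult_lin[OF A M x] | simp add: x mult_first_simple[OF A M] left_mult_simple[OF A M])+)
  then show ?thesis using v by simp
qed

section \<open>Faithfully flat torsors\<close>

locale faithfully_flat_torsor = torsor R T \<mu>
  for R (structure) and T :: "('a, 't, 'y) module_scheme" (structure) and \<mu> +
  assumes ff: "faithfully_flat TYPE(('a, 't) small) R T"
begin

section \<open>The map \<open>D\<close> and the subalgebra \<open>H\<close>\<close>

abbreviation "oT \<equiv> opposite T"
abbreviation "TT \<equiv> T \<boxtimes> T"
abbreviation "T3 \<equiv> T \<boxtimes> TT"
abbreviation "T4 \<equiv> T \<boxtimes> T3"
abbreviation "T5 \<equiv> T \<boxtimes> T4"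
abbreviation "eta \<equiv> simple T TT \<one>\<^bsub>T\<^esub>"
abbreviation "id_mult \<equiv> tmap T T id (mult_map T)"
abbreviation "id_mf \<equiv> tmap T T3 id (mult_first R T TT)"
abbreviation "B \<equiv> oT \<boxtimes> T"
abbreviation "D \<equiv> torsor_D R T \<mu>"
abbreviation "H \<equiv> torsor_H R T \<mu>"
abbreviation "TH \<equiv> T \<boxtimes> H"
abbreviation "HH \<equiv> H \<boxtimes> H"
abbreviation "THH \<equiv> T \<boxtimes> HH"

lemma algT: "nc_algebra R T" ..
lemma modT [simp]: "module R T" ..
lemma one_T [simp]: "\<one>\<^bsub>T\<^esub> \<in> carrier T" by simp
lemma modTT: "module R TT" by simp
lemma eta_lin: "eta \<in> lin TT T3" by simp
lemmas algB = tensor_nc_algebra[OF nc_algebra_opposite[OF algT] algT]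
lemmas algTB = tensor_nc_algebra[OF algT algB]

lemma same_B: "same_module B TT"
  by (rule same_module_tensor[OF same_module_opposite same_module_refl])

lemma opposite_one: "one oT = one T"
  by (simp add: opposite_def)

text \<open>Fixes the normal form: everything except the multiplication is expressed over
  \<open>TT\<close>, so linear arguments never meet the opposite algebra.\<close>

lemma B_simps [simp]:
  "carrier oT = carrier T" "carrier B = carrier TT" "add B = add TT" "zero B = zero TT" "smult B = smult TT"
  "simple oT T = simple T T" "simple T B = simple T TT" "tmap T B f g = tmap T TT f g"
  "carrier (T \<boxtimes> B) = carrier T3" "one B = simple T T \<one>\<^bsub>T\<^esub> \<one>\<^bsub>T\<^esub>"
  using same_B same_module_tensor[OF same_module_refl[of T] same_B] simple_same[OF same_module_refl[of T] same_B]
    simple_same[OF same_module_opposite same_module_refl[of T], of T] tmap_same[OF same_module_refl[of T] same_B]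
    same_module_opposite[of T]
  by (simp_all add: same_module_def tensor_one[OF nc_algebra_opposite[OF algT] algT] opposite_one)

lemma lin_TB: "lin M (T \<boxtimes> B) = lin M T3" "lin (T \<boxtimes> B) M = lin T3 M" "lin M B = lin M TT" "lin B M = lin TT M"
  using lin_same[OF same_module_refl[of M] same_module_tensor[OF same_module_refl[of T] same_B]]
    lin_same[OF same_module_tensor[OF same_module_refl[of T] same_B] same_module_refl[of M]]
    lin_same[OF same_module_refl[of M] same_B] lin_same[OF same_B same_module_refl[of M]] by simp_all

lemma left_mult_B: "left_mult T B x = left_mult T TT x"
  by (simp add: left_mult_def fun_eq_iff)

lemma B_mult: "a \<in> carrier T \<Longrightarrow> b \<in> carrier T \<Longrightarrow> a' \<in> carrier T \<Longrightarrow> b' \<in> carrier T \<Longrightarrow>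
    simple T T a b \<otimes>\<^bsub>B\<^esub> simple T T a' b' = simple T T (a' \<otimes>\<^bsub>T\<^esub> a) (b \<otimes>\<^bsub>T\<^esub> b')"
  using tensor_mult_simple[OF nc_algebra_opposite[OF algT] algT, of a b a' b'] by (simp) (simp add: opposite_def)

lemma mu_lin: "\<mu> \<in> lin T T3" and mu_one: "\<mu> \<one>\<^bsub>T\<^esub> = eta (simple T T \<one>\<^bsub>T\<^esub> \<one>\<^bsub>T\<^esub>)"
  and mu_mult: "x \<in> carrier T \<Longrightarrow> y \<in> carrier T \<Longrightarrow> \<mu> (x \<otimes>\<^bsub>T\<^esub> y) = \<mu> x \<otimes>\<^bsub>T \<boxtimes> B\<^esub> \<mu> y"
  using algebra_homD[OF torsor_hom] lin_TB(1)[of T] by (simp_all add: tensor_one[OF algT algB])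

lemmas mu_closed [simp] = lin_closed[OF mu_lin]

lemmas lm_lin = left_mult_lin[OF algT] and lm_simple [simp] = left_mult_simple[OF algT]
  and lm_mult = left_mult_mult[OF algT]

lemma lm_closed [simp]: "module R M \<Longrightarrow> x \<in> carrier T \<Longrightarrow> v \<in> carrier (T \<boxtimes> M) \<Longrightarrow> left_mult T M x v \<in> carrier (T \<boxtimes> M)"
  using lin_closed[OF lm_lin] .

lemmas mult_lin [simp] = mult_map_lin[OF algT] and mult_simple [simp] = mult_map_simple[OF algT]
lemmas mult_closed [simp] = lin_closed[OF mult_lin]
lemmas mf_lin = mult_first_lin[OF algT] and mf_simple = mult_first_left_mult[OF algT]

lemma D_eq: "D z = mult_first R T TT (tmap T T3 id \<mu> z)"
  by (simp add: torsor_D_def)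

lemma D_comp: "D = mult_first R T TT \<circ> tmap T T3 id \<mu>"
  by (simp add: D_eq fun_eq_iff)

lemma D_lin: "D \<in> lin TT T3"
  unfolding D_comp by (rule lin_comp[OF tmap_lin[OF lin_id mu_lin] mf_lin]) simp_all

lemmas D_closed [simp] = lin_closed[OF D_lin]

lemma D_simple [simp]: "x \<in> carrier T \<Longrightarrow> y \<in> carrier T \<Longrightarrow> D (simple T T x y) = left_mult T TT x (\<mu> y)"
  by (simp add: D_eq tmap_simple[OF _ _ lin_id mu_lin] mf_simple)

lemma D_left_mult:
  assumes "t \<in> carrier T" "z \<in> carrier TT"
  shows "D (left_mult T T t z) = left_mult T TT t (D z)"
proof -
  have "\<forall>z\<in>carrier TT. (D \<circ> left_mult T T t) z = (left_mult T TT t \<circ> D) z"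
    by (rule tensor_eqI[OF modT modT], (rule lin_comp[OF lm_lin D_lin] lin_comp[OF D_lin lm_lin] | simp add: assms lm_mult)+)
  then show ?thesis using assms by simp
qed

text \<open>In \<open>B\<close> the product of \<open>x (x) y\<close> and \<open>x' (x) y'\<close>
  is \<open>x' x (x) y y'\<close>. Hence \<open>x'\<close> comes out on the left by
  \<open>T\<close>-linearity, while \<open>y'\<close> enters through multiplicativity of
  \<open>\<mu>\<close>.\<close>

lemma D_mult_simple:
  assumes z: "z \<in> carrier TT" and xy: "x' \<in> carrier T" "y' \<in> carrier T"
  shows "D (z \<otimes>\<^bsub>B\<^esub> simple T T x' y') = left_mult T TT x' (D z \<otimes>\<^bsub>T \<boxtimes> B\<^esub> \<mu> y')"
proof -
  note bB = bilinD(2)[OF nc_algebraD(3)[OF algB]] and bC = bilinD(2)[OF nc_algebraD(3)[OF algTB]]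
  have s: "simple T T x' y' \<in> carrier B" "\<mu> y' \<in> carrier (T \<boxtimes> B)" using xy by simp_all
  have l1: "(\<lambda>z. z \<otimes>\<^bsub>B\<^esub> simple T T x' y') \<in> lin TT TT" using bB[OF s(1)] by (simp add: lin_TB)
  have l2: "(\<lambda>z. z \<otimes>\<^bsub>T \<boxtimes> B\<^esub> \<mu> y') \<in> lin T3 T3" using bC[OF s(2)] by (simp add: lin_TB)
  have "\<forall>z\<in>carrier TT. (D \<circ> (\<lambda>z. z \<otimes>\<^bsub>B\<^esub> simple T T x' y')) z = (left_mult T TT x' \<circ> ((\<lambda>z. z \<otimes>\<^bsub>T \<boxtimes> B\<^esub> \<mu> y') \<circ> D)) z"
  proof (rule tensor_eqI[OF modT modT lin_comp[OF l1 D_lin] lin_comp[OF lin_comp[OF D_lin l2] lm_lin]])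
    fix x y assume *: "x \<in> carrier T" "y \<in> carrier T"
    have "left_mult T TT (x' \<otimes>\<^bsub>T\<^esub> x) (\<mu> y \<otimes>\<^bsub>T \<boxtimes> B\<^esub> \<mu> y') =
      left_mult T TT x' (left_mult T TT x (\<mu> y) \<otimes>\<^bsub>T \<boxtimes> B\<^esub> \<mu> y')"
      using left_mult_mult_assoc[OF algT algB *(1), of "\<mu> y" "\<mu> y'"] * xy
      by (simp add: left_mult_B lm_mult mu_mult[symmetric])
    then show "(D \<circ> (\<lambda>z. z \<otimes>\<^bsub>B\<^esub> simple T T x' y')) (simple T T x y) =
      (left_mult T TT x' \<circ> ((\<lambda>z. z \<otimes>\<^bsub>T \<boxtimes> B\<^esub> \<mu> y') \<circ> D)) (simple T T x y)"
      using * xy by (simp add: B_mult mu_mult)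
  qed (simp_all add: xy)
  then show ?thesis using z by simp
qed

text \<open>For \<open>w\<close> in \<open>H\<close> the right side is \<open>eta z\<close> times
  \<open>eta w\<close>, which yields closure of \<open>H\<close> under products.\<close>

lemma D_mult:
  assumes z: "z \<in> carrier TT" "D z = eta z" and w: "w \<in> carrier TT"
  shows "D (z \<otimes>\<^bsub>B\<^esub> w) = eta z \<otimes>\<^bsub>T \<boxtimes> B\<^esub> D w"
proof -
  interpret B: nc_algebra R B by (rule algB)
  interpret C: nc_algebra R "T \<boxtimes> B" by (rule algTB)
  note bB = bilinD(1)[OF nc_algebraD(3)[OF algB]] and bC = bilinD(1)[OF nc_algebraD(3)[OF algTB]]
  have s: "z \<in> carrier B" "eta z \<in> carrier (T \<boxtimes> B)" using z by simp_all
  have l1: "mult B z \<in> lin TT TT" using bB[OF s(1)] by (simp add: lin_TB)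
  have l2: "mult (T \<boxtimes> B) (eta z) \<in> lin T3 T3" using bC[OF s(2)] by (simp add: lin_TB)
  have "\<forall>w\<in>carrier TT. (D \<circ> mult B z) w = (mult (T \<boxtimes> B) (eta z) \<circ> D) w"
  proof (rule tensor_eqI[OF modT modT lin_comp[OF l1 D_lin] lin_comp[OF D_lin l2]])
    fix x y assume *: "x \<in> carrier T" "y \<in> carrier T"
    have c: "simple T B x \<one>\<^bsub>B\<^esub> \<in> carrier (T \<boxtimes> B)" "\<mu> y \<in> carrier (T \<boxtimes> B)" using * by simp_all
    \<comment> \<open>\<open>x (x) 1\<close> and \<open>1 (x) z\<close> commute, so the first leg of
      \<open>w\<close> can be moved past \<open>eta z\<close>.\<close>
    have m: "simple T B x \<one>\<^bsub>B\<^esub> \<otimes>\<^bsub>T \<boxtimes> B\<^esub> simple T B \<one>\<^bsub>T\<^esub> z = simple T B \<one>\<^bsub>T\<^esub> z \<otimes>\<^bsub>T \<boxtimes> B\<^esub> simple T B x \<one>\<^bsub>B\<^esub>"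
      using * s(1) by (simp add: tensor_mult_simple[OF algT algB] del: B_simps)
    have "left_mult T B x (simple T B \<one>\<^bsub>T\<^esub> z \<otimes>\<^bsub>T \<boxtimes> B\<^esub> \<mu> y) = simple T B \<one>\<^bsub>T\<^esub> z \<otimes>\<^bsub>T \<boxtimes> B\<^esub> left_mult T B x (\<mu> y)"
      using c s * m C.m_assoc[of "simple T B x \<one>\<^bsub>B\<^esub>" "simple T B \<one>\<^bsub>T\<^esub> z" "\<mu> y"]
        C.m_assoc[of "simple T B \<one>\<^bsub>T\<^esub> z" "simple T B x \<one>\<^bsub>B\<^esub>" "\<mu> y"] C.m_closed[of "simple T B \<one>\<^bsub>T\<^esub> z" "\<mu> y"]
      by (simp add: left_mult_eq[OF algT algB] )
    then show "(D \<circ> mult B z) (simple T T x y) = (mult (T \<boxtimes> B) (eta z) \<circ> D) (simple T T x y)"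
      using * z by (simp add: D_mult_simple left_mult_B)
  qed simp
  then show ?thesis using w by simp
qed

lemma H_simps [simp]:
  "add H = add TT" "zero H = zero TT" "smult H = smult TT" "mult H = mult B" "one H = simple T T \<one>\<^bsub>T\<^esub> \<one>\<^bsub>T\<^esub>"
  by (simp_all add: torsor_H_def)

lemma H_iff: "z \<in> carrier H \<longleftrightarrow> z \<in> carrier TT \<and> D z = eta z"
  by (simp add: torsor_H_def torsor_H_carrier_def)

lemma H_sub [simp]: "z \<in> carrier H \<Longrightarrow> z \<in> carrier TT"
  and D_H: "z \<in> carrier H \<Longrightarrow> D z = eta z"
  by (simp_all add: H_iff)

lemma one_H: "simple T T \<one>\<^bsub>T\<^esub> \<one>\<^bsub>T\<^esub> \<in> carrier H"
  by (simp add: H_iff mu_one del: H_sub)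

lemma submodule_H: "submodule (carrier H) R B"
proof -
  interpret B: nc_algebra R B by (rule algB)
  interpret TTT: module R T3 by simp
  interpret T2: module R TT by simp
  have l: "D \<in> lin B T3" "eta \<in> lin B T3"
    unfolding lin_TB by (rule D_lin, rule simple_lin_right) simp_all
  have m: "module R B" "module R T3" by (rule nc_algebraD(1)[OF algB]) simp
  show ?thesis
  proof (rule B.submoduleI)
    show "\<zero>\<^bsub>B\<^esub> \<in> carrier H" using lin_zero[OF l(1) m] lin_zero[OF l(2) m] by (simp add: H_iff del: H_sub)
    show "\<ominus>\<^bsub>B\<^esub> a \<in> carrier H" if "a \<in> carrier H" for a
      using lin_minus[OF l(1) m, of a] lin_minus[OF l(2) m, of a] that B.a_inv_closed[of a] by (simp add: H_iff del: H_sub)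
    show "a \<oplus>\<^bsub>B\<^esub> b \<in> carrier H" if "a \<in> carrier H" "b \<in> carrier H" for a b
      using lin_add[OF l(1), of a b] lin_add[OF l(2), of a b] that by (simp add: H_iff del: H_sub)
    show "a \<odot>\<^bsub>B\<^esub> x \<in> carrier H" if "a \<in> carrier R" "x \<in> carrier H" for a x
      using lin_smult[OF l(1), of a x] lin_smult[OF l(2), of a x] that by (simp add: H_iff del: H_sub)
  qed auto
qed

lemma subring_H: "subring (carrier H) B"
proof -
  interpret B: nc_algebra R B by (rule algB)
  note S = B.submoduleE[OF submodule_H]
  show ?thesis
  proof (rule B.subringI)
    show "h1 \<otimes>\<^bsub>B\<^esub> h2 \<in> carrier H" if h: "h1 \<in> carrier H" "h2 \<in> carrier H" for h1 h2
      using tensor_mult_simple[OF algT algB, of "\<one>\<^bsub>T\<^esub>" h1 "\<one>\<^bsub>T\<^esub>" h2] h B.m_closed[of h1 h2]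
      by (simp add: H_iff D_mult del: H_sub)
  qed (use S one_H in auto)
qed

lemma algH: "nc_algebra R H"
  using nc_algebra_subalgebra[OF algB submodule_H subring_H] by (simp add: torsor_H_def)

lemma modH [simp]: "module R H"
  using nc_algebraD(1)[OF algH] .

lemma H_incl [simp]: "id \<in> lin H TT"
  by (rule linI) simp_all

lemma H_incl_hom: "id \<in> algebra_homs R H B"
  by (rule algebra_homI) (simp_all add: lin_TB)

lemma embeddable_T_H [simp]:
  "embeddable TYPE(('a, 't) small) T" "embeddable TYPE(('a, 't) small) H"
  by (rule embeddable_self, rule embeddable_subset[OF embeddable_tensor[OF modT modT]]) (auto simp: embeddable_self)
declare embeddable_tensor [simp]

section \<open>The coaction of \<open>H\<close> on \<open>T\<close>\<close>

abbreviation "j \<equiv> TH_inclusion R T"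

lemma j_eq: "j = tmap T TT id id"
  by (simp add: TH_inclusion_def fun_eq_iff)

lemma j_lin: "j \<in> lin TH T3"
  unfolding j_eq by simp

lemmas j_closed [simp] = lin_closed[OF j_lin]

lemma j_simple [simp]: "t \<in> carrier T \<Longrightarrow> h \<in> carrier H \<Longrightarrow> j (simple T H t h) = simple T TT t h"
  unfolding j_eq by (simp add: tmap_simple[OF _ _ lin_id H_incl])

text \<open>Although written with \<open>id\<close>, this map changes tensor classes; it is
  \<open>T\<close> tensored with the injection of \<open>H\<close> into \<open>TT\<close>, hence
  injective by flatness.\<close>

lemma inj_j: "inj_on j (carrier TH)"
  unfolding j_eq by (subst faithfully_flat_inj[OF modT ff, symmetric]) simp_all

lemma j_hom: "j \<in> algebra_homs R TH (T \<boxtimes> B)"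
  using tmap_algebra_hom[OF algT algH algT algB id_algebra_hom H_incl_hom] by (simp add: j_eq)

lemma j_left_mult:
  assumes "t \<in> carrier T" "w \<in> carrier TH"
  shows "j (left_mult T H t w) = left_mult T TT t (j w)"
proof -
  have "\<forall>w\<in>carrier TH. (j \<circ> left_mult T H t) w = (left_mult T TT t \<circ> j) w"
    by (rule tensor_eqI[OF modT modH], (rule lin_comp[OF lm_lin j_lin] lin_comp[OF j_lin lm_lin] | simp add: assms)+)
  then show ?thesis using assms by simp
qed

text \<open>Presents \<open>H\<close> as a kernel, the form in which exactness can be
  tensored.\<close>

definition "kap z = D z \<ominus>\<^bsub>T3\<^esub> eta z"

lemma kap_lin: "kap \<in> lin TT T3"
  unfolding kap_def[abs_def] by (intro lin_diff D_lin) simp_all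

lemma exact_H: "exact_at H TT T3 id kap"
proof -
  have "z \<in> carrier H \<longleftrightarrow> z \<in> carrier TT \<and> kap z = \<zero>\<^bsub>T3\<^esub>" for z
    by (cases "z \<in> carrier TT") (simp_all add: H_iff kap_def module_diff_eq_zero del: H_sub)
  then show ?thesis unfolding exact_at_def by (simp only: image_id id_apply) blast
qed

text \<open>The shuffle \<open>(a \<otimes> b \<otimes> c) \<otimes> u \<mapsto> a \<otimes> (b \<otimes> (c \<otimes> u))\<close>.\<close>

definition "psi = tmap T T4 id (assoc T T TT) \<circ> assoc T TT TT"

lemma psi_lin: "psi \<in> lin (T3 \<boxtimes> TT) T5"
  unfolding psi_def by (rule lin_comp[OF assoc_lin]) simp_all

lemma psi_simple:
  "a \<in> carrier T \<Longrightarrow> v \<in> carrier TT \<Longrightarrow> u \<in> carrier TT \<Longrightarrow>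
    psi (simple T3 TT (simple T TT a v) u) = simple T T4 a (assoc T T TT (simple TT TT v u))"
  by (simp add: psi_def tmap_simple[OF _ _ lin_id assoc_lin])

lemma torsor_assoc':
  assumes "x \<in> carrier T"
  shows "psi (tmap T3 TT \<mu> id (\<mu> x)) = tmap T T4 id (tmap T T3 id \<mu>) (\<mu> x)"
  using torsor_assoc[OF assms] by (simp add: psi_def)

text \<open>Multiplying the second and third factors in axiom (i) turns one side into
  \<open>x^(1) (x) D(x^(2) (x) x^(3))\<close>. The other side becomes
  \<open>x^(1) (x) 1 (x) x^(2) (x) x^(3)\<close> by \<open>torsor_right\<close> applied to
  \<open>x^(1)\<close>. So \<open>\<mu> x\<close> is killed by \<open>T (x) kap\<close>.\<close>

lemma kap_mu:
  assumes x: "x \<in> carrier T"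
  shows "tmap T T3 id kap (\<mu> x) = \<zero>\<^bsub>T \<boxtimes> T3\<^esub>"
proof -
  note [simp] = tmap_simple[OF _ _ lin_id mult_lin]
  note mf = mf_lin[OF modTT]
  have im: "id_mult \<in> lin T3 TT" by simp
  have 1: "id_mf (psi (simple T3 TT v u)) =
    assoc T T TT (simple TT TT (id_mult v) u)" if u: "u \<in> carrier TT" and v: "v \<in> carrier T3" for u v
  proof -
    have "\<forall>v\<in>carrier T3. (id_mf \<circ> psi \<circ> (\<lambda>v. simple T3 TT v u)) v =
      (assoc T T TT \<circ> ((\<lambda>v. simple TT TT v u) \<circ> id_mult)) v"
    proof (rule tensor_eqI_right[OF modT modT modT])
    show "id_mf \<circ> psi \<circ> (\<lambda>v. simple T3 TT v u) \<in> lin T3 (T \<boxtimes> T3)"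
      by (rule lin_comp[OF simple_lin_left lin_comp[OF psi_lin]]) (simp_all add: u mf)
    show "assoc T T TT \<circ> ((\<lambda>v. simple TT TT v u) \<circ> id_mult) \<in> lin T3 (T \<boxtimes> T3)"
      by (rule lin_comp[OF lin_comp[OF im simple_lin_left] assoc_lin]) (simp_all add: u)
    qed (simp_all add: u psi_simple tmap_simple[OF _ _ lin_id mf] mf_simple)
    then show ?thesis using v by simp
  qed
  have 2: "id_mf (psi (tmap T3 TT \<mu> id w)) = tmap T T3 id eta w" if w: "w \<in> carrier T3" for w
  proof -
    note ml = tmap_lin[OF mu_lin lin_id, of TT]
      have "\<forall>w\<in>carrier T3. (id_mf \<circ> (psi \<circ> tmap T3 TT \<mu> id)) w = tmap T T3 id eta w"
    proof (rule tensor_eqI[OF modT])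
      show "id_mf \<circ> (psi \<circ> tmap T3 TT \<mu> id) \<in> lin T3 (T \<boxtimes> T3)"
        by (rule lin_comp[OF lin_comp[OF ml psi_lin]]) (simp_all add: mf)
      fix t u assume tu: "t \<in> carrier T" "u \<in> carrier TT"
      then show "(id_mf \<circ> (psi \<circ> tmap T3 TT \<mu> id)) (simple T TT t u) = tmap T T3 id eta (simple T TT t u)"
        using 1[OF tu(2), of "\<mu> t"] torsor_right[OF tu(1)]
        by (simp add: tmap_simple[OF _ _ mu_lin lin_id] tmap_simple[OF _ _ lin_id eta_lin])
    qed (simp_all add: eta_lin)
    then show ?thesis using w by simp
  qed
  have "tmap T T3 id D (\<mu> x) = tmap T T3 (id \<circ> id) (mult_first R T TT \<circ> tmap T T3 id \<mu>) (\<mu> x)"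
    by (simp add: D_comp)
  also have "\<dots> = id_mf (tmap T T4 id (tmap T T3 id \<mu>) (\<mu> x))"
    by (rule tmap_tmap[OF lin_id tmap_lin[OF lin_id mu_lin] lin_id mf, symmetric]) (simp_all add: x)
  also have "\<dots> = tmap T T3 id eta (\<mu> x)"
    using 2[of "\<mu> x"] x by (simp add: torsor_assoc')
  finally have e: "tmap T T3 id D (\<mu> x) = tmap T T3 id eta (\<mu> x)" .
  have "\<forall>v\<in>carrier T3. tmap T T3 id kap v = (\<lambda>v. tmap T T3 id D v \<ominus>\<^bsub>T \<boxtimes> T3\<^esub> tmap T T3 id eta v) v"
  proof (rule tensor_eqI[OF modT])
    show "(\<lambda>v. tmap T T3 id D v \<ominus>\<^bsub>T \<boxtimes> T3\<^esub> tmap T T3 id eta v) \<in> lin T3 (T \<boxtimes> T3)"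
      by (intro lin_diff) (simp_all add: D_lin)
    fix t u assume tu: "t \<in> carrier T" "u \<in> carrier TT"
    note s = simple_lin_right[OF modT tensor_module[OF modT modTT] tu(1)]
    interpret X: module R T3 by simp
    have "simple T T3 t (kap u) = simple T T3 t (D u) \<ominus>\<^bsub>T \<boxtimes> T3\<^esub> simple T T3 t (eta u)"
      using tu lin_add[OF s, of "D u" "\<ominus>\<^bsub>T3\<^esub> eta u"] lin_minus[OF s, of "eta u"]
      by (simp add: kap_def a_minus_def)
    then show "tmap T T3 id kap (simple T TT t u) = tmap T T3 id D (simple T TT t u) \<ominus>\<^bsub>T \<boxtimes> T3\<^esub>
      tmap T T3 id eta (simple T TT t u)"
      using tu by (simp add: tmap_simple[OF _ _ lin_id kap_lin] tmap_simple[OF _ _ lin_id D_lin] tmap_simple[OF _ _ lin_id eta_lin])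
  qed (simp_all add: kap_lin)
  from bspec[OF this, of "\<mu> x"] have "tmap T T3 id kap (\<mu> x) = tmap T T3 id D (\<mu> x) \<ominus>\<^bsub>T \<boxtimes> T3\<^esub> tmap T T3 id eta (\<mu> x)"
    using x by simp
  also have "\<dots> = \<zero>\<^bsub>T \<boxtimes> T3\<^esub>"
    unfolding e using lin_closed[OF tmap_lin[OF lin_id eta_lin], of T "\<mu> x"] x by (simp add: module_diff_eq_zero)
  finally show ?thesis .
qed

lemma delta_exists: "\<exists>\<delta>. \<delta> \<in> lin T TH \<and> (\<forall>x\<in>carrier T. j (\<delta> x) = \<mu> x)"
proof -
  have "exact_at TH T3 (T \<boxtimes> T3) j (tmap T T3 id kap)"
    unfolding j_eq by (rule iffD1[OF faithfully_flat_exact[OF modT ff] exact_H]) (simp_all add: kap_lin)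
  then have "\<mu> x \<in> j ` carrier TH" if "x \<in> carrier T" for x
    using kap_mu[OF that] that by (simp add: exact_at_def)
  then show ?thesis
    using lin_factor[OF j_lin inj_j mu_lin] by (metis tensor_module modT modH)
qed

definition "delta = (SOME \<delta>. \<delta> \<in> lin T TH \<and> (\<forall>x\<in>carrier T. j (\<delta> x) = \<mu> x))"

lemma delta_lin: "delta \<in> lin T TH" and j_delta [simp]: "x \<in> carrier T \<Longrightarrow> j (delta x) = \<mu> x"
  using someI_ex[OF delta_exists] unfolding delta_def by blast+

lemmas delta_closed [simp] = lin_closed[OF delta_lin]

lemma delta_hom: "delta \<in> algebra_homs R T TH"
  by (rule algebra_hom_factor[OF algT tensor_nc_algebra[OF algT algH] j_hom inj_j _ _ delta_lin j_delta])
    (simp_all add: mu_one mu_mult tensor_one[OF algT algB])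

section \<open>Bijectivity of the Galois map of \<open>T\<close>\<close>

abbreviation "beta \<equiv> galois_map R H T delta"

lemmas beta_lin = galois_map_lin[OF algT modH delta_lin]
  and beta_simple = galois_map_simple[OF algT modH delta_lin]

lemma j_beta:
  assumes "z \<in> carrier TT"
  shows "j (beta z) = D z"
proof -
  have "\<forall>z\<in>carrier TT. (j \<circ> beta) z = D z"
    by (rule tensor_eqI[OF modT modT lin_comp[OF beta_lin j_lin] D_lin]) (simp_all add: beta_simple j_left_mult)
  then show ?thesis using assms by simp
qed

lemma beta_iso: "beta \<in> lin_iso TT TH"
proof (rule lin_isoI[OF beta_lin])
  note mf = mf_lin[OF modT]
  show "mult_first R T T \<circ> j \<in> lin TH TT" by (rule lin_comp[OF j_lin mf])
  have mfl: "mult_first R T T (left_mult T TT x v) = left_mult T T x (mult_first R T T v)"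
    if x: "x \<in> carrier T" and v: "v \<in> carrier T3" for x v
  proof -
    have "\<forall>v\<in>carrier T3. (mult_first R T T \<circ> left_mult T TT x) v = (left_mult T T x \<circ> mult_first R T T) v"
      by (rule tensor_eqI[OF modT _ lin_comp[OF lm_lin mf] lin_comp[OF mf lm_lin]]) (simp_all add: x mf_simple lm_mult)
    then show ?thesis using v by simp
  qed
  \<comment> \<open>On \<open>x (x) y\<close> this is
    \<open>x y^(1) y^(2) (x) y^(3) = x (x) y\<close>, a consequence of
    \<open>torsor_left\<close>.\<close>
  have "\<forall>z\<in>carrier TT. (mult_first R T T \<circ> D) z = id z"
    by (rule tensor_eqI[OF modT modT lin_comp[OF D_lin mf] lin_id]) (simp_all add: mfl torsor_left)
  then show "(mult_first R T T \<circ> j) (beta z) = z" if "z \<in> carrier TT" for z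
    using that by (simp add: j_beta)
  \<comment> \<open>For \<open>h\<close> in \<open>H\<close> left linearity gives
    \<open>D (t h) = t D h = t (1 (x) h)\<close>, which is \<open>t (x) h\<close>; here the
    definition of \<open>H\<close> enters.\<close>
  have "\<forall>w\<in>carrier TH. (D \<circ> (mult_first R T T \<circ> j)) w = j w"
    by (rule tensor_eqI[OF modT modH lin_comp[OF lin_comp[OF j_lin mf] D_lin] j_lin])
      (simp_all add: mf_simple D_left_mult D_H)
  then have "j (beta ((mult_first R T T \<circ> j) w)) = j w" if "w \<in> carrier TH" for w
    using that lin_closed[OF mf j_closed[OF that]] by (simp add: j_beta)
  then show "beta ((mult_first R T T \<circ> j) w) = w" if "w \<in> carrier TH" for w
  proof (rule inj_onD[OF inj_j])
    show "beta ((mult_first R T T \<circ> j) w) \<in> carrier TH"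
      using lin_closed[OF beta_lin, of "(mult_first R T T \<circ> j) w"] lin_closed[OF mf j_closed[OF that]] by simp
  qed (use that in simp_all)
qed


lemma assoc_closed [simp]:
  "module R L \<Longrightarrow> module R M \<Longrightarrow> module R N \<Longrightarrow> z \<in> carrier ((L \<boxtimes> M) \<boxtimes> N) \<Longrightarrow> assoc L M N z \<in> carrier (L \<boxtimes> (M \<boxtimes> N))"
  by (rule lin_closed[OF assoc_lin])

lemma tmap_diff_left:
  assumes M: "module R L" "module R M" "module R P" "module R Q"
    and f: "f \<in> lin L P" "f' \<in> lin L P" and g: "g \<in> lin M Q" and z: "z \<in> carrier (L \<boxtimes> M)"
  shows "tmap P Q (\<lambda>x. f x \<ominus>\<^bsub>P\<^esub> f' x) g z = tmap P Q f g z \<ominus>\<^bsub>P \<boxtimes> Q\<^esub> tmap P Q f' g z"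
proof -
  interpret P: module R P by fact
  note [simp] = M
  have d: "(\<lambda>x. f x \<ominus>\<^bsub>P\<^esub> f' x) \<in> lin L P" by (intro lin_diff f M)
  have "\<forall>z\<in>carrier (L \<boxtimes> M). tmap P Q (\<lambda>x. f x \<ominus>\<^bsub>P\<^esub> f' x) g z = (\<lambda>z. tmap P Q f g z \<ominus>\<^bsub>P \<boxtimes> Q\<^esub> tmap P Q f' g z) z"
  proof (rule tensor_eqI[OF M(1,2)])
    show "(\<lambda>z. tmap P Q f g z \<ominus>\<^bsub>P \<boxtimes> Q\<^esub> tmap P Q f' g z) \<in> lin (L \<boxtimes> M) (P \<boxtimes> Q)"
      by (intro lin_diff tmap_lin f g M tensor_module)
    fix m n assume a: "m \<in> carrier L" "n \<in> carrier M"
    note s = simple_lin_left[OF M(3,4) lin_closed[OF g a(2)]]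
    show "tmap P Q (\<lambda>x. f x \<ominus>\<^bsub>P\<^esub> f' x) g (simple L M m n) =
      tmap P Q f g (simple L M m n) \<ominus>\<^bsub>P \<boxtimes> Q\<^esub> tmap P Q f' g (simple L M m n)"
      using a lin_add[OF s, of "f m" "\<ominus>\<^bsub>P\<^esub> f' m"] lin_minus[OF s M(3) tensor_module[OF M(3,4)], of "f' m"]
      by (simp add: tmap_simple[OF _ _ d[unfolded a_minus_def] g] tmap_simple[OF _ _ f(1) g] tmap_simple[OF _ _ f(2) g] lin_closed[OF f(1)]
          lin_closed[OF f(2)] a_minus_def)
  qed (simp_all add: d g)
  then show ?thesis using z by simp
qed

lemma mult_first_natural:
  assumes A: "nc_algebra R A" and M: "module R M" "module R N" and g: "g \<in> lin M N" and w: "w \<in> carrier (A \<boxtimes> (A \<boxtimes> M))"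
  shows "mult_first R A N (tmap A (A \<boxtimes> N) id (tmap A N id g) w) = tmap A N id g (mult_first R A M w)"
proof -
  note MA [simp] = nc_algebraD(1)[OF A] M
  interpret A: nc_algebra R A by fact
  note g1 = tmap_lin[OF lin_id g MA(1,2,1,3)]
  have "\<forall>w\<in>carrier (A \<boxtimes> (A \<boxtimes> M)). (mult_first R A N \<circ> tmap A (A \<boxtimes> N) id (tmap A N id g)) w = (tmap A N id g \<circ> mult_first R A M) w"
  proof (rule tensor_eqI_right[OF MA(1,1,2)])
    show "mult_first R A N \<circ> tmap A (A \<boxtimes> N) id (tmap A N id g) \<in> lin (A \<boxtimes> (A \<boxtimes> M)) (A \<boxtimes> N)"
      by (rule lin_comp[OF tmap_lin[OF lin_id g1] mult_first_lin[OF A M(2)]]) simp_all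
    show "tmap A N id g \<circ> mult_first R A M \<in> lin (A \<boxtimes> (A \<boxtimes> M)) (A \<boxtimes> N)"
      by (rule lin_comp[OF mult_first_lin[OF A M(1)] g1])
  qed (simp_all add: tmap_simple[OF _ _ lin_id g1] tmap_simple[OF _ _ lin_id g] mult_first_simple[OF A] lin_closed[OF g])
  then show ?thesis using w by simp
qed


section \<open>The counit\<close>

lemma id_mult_left:
  assumes "x \<in> carrier T" "v \<in> carrier T3"
  shows "id_mult (left_mult T TT x v) = left_mult T T x (id_mult v)"
proof -
  have m: "id_mult \<in> lin T3 TT" by simp
  have "\<forall>v\<in>carrier T3. (id_mult \<circ> left_mult T TT x) v = (left_mult T T x \<circ> id_mult) v"
    by (rule tensor_eqI[OF modT _ lin_comp[OF lm_lin m] lin_comp[OF m lm_lin]])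
      (simp_all add: assms tmap_simple[OF _ _ lin_id mult_lin])
  then show ?thesis using assms by simp
qed

text \<open>On \<open>x (x) y\<close> the left side is \<open>x y^(1) (x) y^(2) y^(3)\<close>, and
  \<open>torsor_right\<close> collapses it.\<close>

lemma id_mult_D:
  assumes "z \<in> carrier TT"
  shows "id_mult (D z) = simple T T (mult_map T z) \<one>\<^bsub>T\<^esub>"
proof -
  have m: "id_mult \<in> lin T3 TT" by simp
  have "\<forall>z\<in>carrier TT. (id_mult \<circ> D) z = ((\<lambda>x. simple T T x \<one>\<^bsub>T\<^esub>) \<circ> mult_map T) z"
    by (rule tensor_eqI[OF modT modT lin_comp[OF D_lin m] lin_comp[OF mult_lin simple_lin_left]])
      (simp_all add: id_mult_left torsor_right)
  then show ?thesis using assms by simp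
qed

abbreviation "unit \<equiv> \<lambda>r. r \<odot>\<^bsub>T\<^esub> \<one>\<^bsub>T\<^esub>"

lemma unit_hom: "unit \<in> algebra_homs R (base_algebra R) T"
  by (rule algebra_homI, rule linI) (simp_all add: smult_l_distr smult_assoc1 smult_mult_left)

lemmas unit_inj = faithfully_flat_unit(1)[OF algT ff]

text \<open>Multiplying the last two factors of \<open>D h = 1 (x) h\<close> in two ways gives
  \<open>1 (x) m = m (x) 1\<close> for the product \<open>m\<close> of \<open>h\<close>; descent
  then places \<open>m\<close> in \<open>k\<close>.\<close>

lemma mult_H_unit:
  assumes h: "h \<in> carrier H"
  shows "mult_map T h \<in> unit ` carrier R"
proof -
  have "simple T T \<one>\<^bsub>T\<^esub> (mult_map T h) = id_mult (D h)"
    using h by (simp add: D_H tmap_simple[OF _ _ lin_id mult_lin])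
  also have "\<dots> = simple T T (mult_map T h) \<one>\<^bsub>T\<^esub>" using h by (simp add: id_mult_D)
  finally show ?thesis using faithfully_flat_unit(2)[OF algT ff, of "mult_map T h"] h by auto
qed

lemma eps_exists: "\<exists>e. e \<in> lin H (base_algebra R) \<and> (\<forall>h\<in>carrier H. unit (e h) = mult_map T h)"
proof -
  have m: "mult_map T \<in> lin H T" using lin_comp[OF H_incl mult_lin] by simp
  obtain g where "g \<in> lin H (base_algebra R)" "\<And>h. h \<in> carrier H \<Longrightarrow> unit (g h) = mult_map T h"
    using lin_factor[OF algebra_homD(1)[OF unit_hom] _ m nc_algebraD(1)[OF nc_algebra_base]] unit_inj mult_H_unit
    by auto
  then show ?thesis by blast
qed

definition "eps = (SOME e. e \<in> lin H (base_algebra R) \<and> (\<forall>h\<in>carrier H. unit (e h) = mult_map T h))"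

lemma eps_lin: "eps \<in> lin H (base_algebra R)" and unit_eps: "h \<in> carrier H \<Longrightarrow> unit (eps h) = mult_map T h"
  using someI_ex[OF eps_exists] unfolding eps_def by blast+

lemma eps_closed [simp]: "h \<in> carrier H \<Longrightarrow> eps h \<in> carrier R"
  using lin_closed[OF eps_lin] by simp

lemma mult_B_simple:
  assumes z: "z \<in> carrier TT" and xy: "x \<in> carrier T" "y \<in> carrier T"
  shows "mult_map T (z \<otimes>\<^bsub>B\<^esub> simple T T x y) = x \<otimes>\<^bsub>T\<^esub> (mult_map T z \<otimes>\<^bsub>T\<^esub> y)"
proof -
  have s: "simple T T x y \<in> carrier B" using xy by simp
  have l: "(\<lambda>z. z \<otimes>\<^bsub>B\<^esub> simple T T x y) \<in> lin TT TT"
    using bilinD(2)[OF nc_algebraD(3)[OF algB] s] by (simp add: lin_TB)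
  have "\<forall>z\<in>carrier TT. (mult_map T \<circ> (\<lambda>z. z \<otimes>\<^bsub>B\<^esub> simple T T x y)) z =
    ((\<lambda>a. x \<otimes>\<^bsub>T\<^esub> a) \<circ> ((\<lambda>a. a \<otimes>\<^bsub>T\<^esub> y) \<circ> mult_map T)) z"
    by (rule tensor_eqI[OF modT modT lin_comp[OF l mult_lin]
          lin_comp[OF lin_comp[OF mult_lin mult_right_lin[OF algT xy(2)]] mult_left_lin[OF algT xy(1)]]])
      (simp_all add: B_mult xy m_assoc)
  then show ?thesis using z by simp
qed

text \<open>For \<open>w = x (x) y\<close> the product is \<open>x m y\<close>, where
  \<open>m\<close> is the product of \<open>z\<close>; since \<open>z\<close> lies in
  \<open>H\<close>, \<open>m\<close> is a scalar and can be moved to the front.\<close>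

lemma mult_B:
  assumes z: "z \<in> carrier H" and w: "w \<in> carrier TT"
  shows "mult_map T (z \<otimes>\<^bsub>B\<^esub> w) = mult_map T z \<otimes>\<^bsub>T\<^esub> mult_map T w"
proof -
  have s: "z \<in> carrier B" using z by simp
  have l: "(\<lambda>w. z \<otimes>\<^bsub>B\<^esub> w) \<in> lin TT TT"
    using bilinD(1)[OF nc_algebraD(3)[OF algB] s] by (simp add: lin_TB)
  have c: "mult_map T z \<in> carrier T" using z by simp
  have "\<forall>w\<in>carrier TT. (mult_map T \<circ> (\<lambda>w. z \<otimes>\<^bsub>B\<^esub> w)) w = ((\<lambda>a. mult_map T z \<otimes>\<^bsub>T\<^esub> a) \<circ> mult_map T) w"
    by (rule tensor_eqI[OF modT modT lin_comp[OF l mult_lin] lin_comp[OF mult_lin mult_left_lin[OF algT c]]])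
      (simp_all add: mult_B_simple z unit_eps[symmetric] smult_mult_left smult_mult_right)
  then show ?thesis using w by simp
qed

lemma eps_hom: "eps \<in> algebra_homs R H (base_algebra R)"
  by (rule algebra_hom_factor[OF algH nc_algebra_base unit_hom _ _ _ eps_lin unit_eps])
    (simp_all add: unit_inj mult_B)

section \<open>The comultiplication\<close>

lemmas inv_beta_iso = lin_iso_inv(4)[OF beta_iso modTT]

text \<open>\<open>H (x) H\<close> enters the fourth tensor power of \<open>T\<close> in two stages:
  first the left \<open>H\<close> is enlarged, using flatness of \<open>H\<close>, then the right
  one, using flatness of \<open>T\<close>.\<close>

abbreviation "HH_TTH \<equiv> tmap TT H id id"

lemma HH_TTH_lin: "HH_TTH \<in> lin HH (TT \<boxtimes> H)"
  by simp

lemma swap_HH_TTH: "x \<in> carrier HH \<Longrightarrow> swap TT H (HH_TTH x) = tmap H TT id id (swap H H x)"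
  by (rule swap_natural[OF modH modH _ modH H_incl lin_id]) simp_all

lemma swap_inj: "module R M \<Longrightarrow> module R N \<Longrightarrow> inj_on (swap M N) (carrier (M \<boxtimes> N))"
  and swap_image: "module R M \<Longrightarrow> module R N \<Longrightarrow> swap M N ` carrier (M \<boxtimes> N) = carrier (N \<boxtimes> M)"
  using lin_isoD(2)[OF lin_iso_swap, of M N] by (simp_all add: bij_betw_def)

lemma inj_HH_TTH: "inj_on HH_TTH (carrier HH)"
proof (rule inj_on_square[where a = "swap H H" and c = "swap TT H" and g = "tmap H TT id id"])
  show "inj_on (tmap H TT id id) (swap H H ` carrier HH)"
    unfolding swap_image[OF modH modH]
    by (rule flat_inj_of_base_change[OF modT ff modH inv_beta_iso]) simp_all
qed (simp_all add: swap_inj swap_HH_TTH)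

text \<open>\<open>exact_H\<close> tensored with the flat module \<open>H\<close>, then flipped. It
  identifies the tensors of \<open>TT (x) H\<close> whose left leg may be taken in
  \<open>H\<close>.\<close>

lemma exact_HH_TTH: "exact_at HH (TT \<boxtimes> H) (T3 \<boxtimes> H) HH_TTH (tmap T3 H kap id)"
proof -
  have "exact_at HH (H \<boxtimes> TT) (H \<boxtimes> T3) (tmap H TT id id) (tmap H T3 id kap)"
    by (rule flat_of_base_change[OF modT ff modH inv_beta_iso]) (simp_all add: kap_lin exact_H)
  moreover have "exact_at HH (TT \<boxtimes> H) (T3 \<boxtimes> H) HH_TTH (tmap T3 H kap id) \<longleftrightarrow>
    exact_at HH (H \<boxtimes> TT) (H \<boxtimes> T3) (tmap H TT id id) (tmap H T3 id kap)"
    by (rule exact_at_iso[OF lin_iso_swap lin_iso_swap lin_iso_swap])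
      (simp_all add: kap_lin swap_natural[OF modH modH _ modH H_incl lin_id] swap_natural[OF _ modH _ modH kap_lin lin_id])
  ultimately show ?thesis by simp
qed

definition "TTH_incl = tmap T T3 id j \<circ> assoc T T H"

lemma TTH_incl_lin: "TTH_incl \<in> lin (TT \<boxtimes> H) T4"
  unfolding TTH_incl_def by (rule lin_comp[OF assoc_lin]) (simp_all add: j_lin)

lemma TTH_incl_simple:
  assumes a: "a \<in> carrier TT" and h: "h \<in> carrier H"
  shows "TTH_incl (simple TT H a h) = assoc T T TT (simple TT TT a h)"
proof -
  have "\<forall>a\<in>carrier TT. (TTH_incl \<circ> (\<lambda>a. simple TT H a h)) a = (assoc T T TT \<circ> (\<lambda>a. simple TT TT a h)) a"
    by (rule tensor_eqI[OF modT modT lin_comp[OF simple_lin_left TTH_incl_lin] lin_comp[OF simple_lin_left assoc_lin]])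
      (simp_all add: h TTH_incl_def tmap_simple[OF _ _ lin_id j_lin])
  then show ?thesis using a by simp
qed

lemma inj_id_tmap:
  assumes "module R M" "module R N" "embeddable TYPE(('a, 't) small) M" "embeddable TYPE(('a, 't) small) N"
    "f \<in> lin M N" "inj_on f (carrier M)"
  shows "inj_on (tmap T N id f) (carrier (T \<boxtimes> M))"
  using faithfully_flat_inj[OF modT ff assms(1-5)] assms(6) by simp

lemma inj_comp_assoc:
  assumes "module R L" "module R M" "module R N" "inj_on g (carrier (L \<boxtimes> (M \<boxtimes> N)))"
  shows "inj_on (g \<circ> assoc L M N) (carrier ((L \<boxtimes> M) \<boxtimes> N))"
  using lin_isoD(2)[OF lin_iso_assoc(1)[OF assms(1-3)]] assms(4) by (intro comp_inj_on) (simp_all add: bij_betw_def)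

lemma inj_TTH_incl: "inj_on TTH_incl (carrier (TT \<boxtimes> H))"
  unfolding TTH_incl_def by (rule inj_comp_assoc) (simp_all add: inj_id_tmap j_lin inj_j)

abbreviation "HH_incl \<equiv> HH_inclusion R T"

lemma HH_incl_eq: "HH_incl = assoc T T TT \<circ> tmap TT TT id id"
  by (simp add: HH_inclusion_def fun_eq_iff)

lemma HH_incl_lin: "HH_incl \<in> lin HH T4"
  unfolding HH_incl_eq by (rule lin_comp[OF _ assoc_lin]) simp_all

lemma HH_incl_simple: "a \<in> carrier H \<Longrightarrow> b \<in> carrier H \<Longrightarrow> HH_incl (simple H H a b) = assoc T T TT (simple TT TT a b)"
  by (simp add: HH_inclusion_def tmap_simple[OF _ _ H_incl H_incl])

lemma HH_incl_TTH_incl: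
  assumes "x \<in> carrier HH"
  shows "HH_incl x = TTH_incl (HH_TTH x)"
proof -
  have "\<forall>x\<in>carrier HH. HH_incl x = (TTH_incl \<circ> HH_TTH) x"
    by (rule tensor_eqI[OF modH modH HH_incl_lin lin_comp[OF HH_TTH_lin TTH_incl_lin]])
      (simp_all add: HH_incl_simple TTH_incl_simple tmap_simple[OF _ _ H_incl lin_id])
  then show ?thesis using assms by simp
qed

lemma inj_HH_incl: "inj_on HH_incl (carrier HH)"
proof (rule inj_onI)
  fix x y assume xy: "x \<in> carrier HH" "y \<in> carrier HH" "HH_incl x = HH_incl y"
  then have "HH_TTH x = HH_TTH y" using lin_closed[OF HH_TTH_lin] by (intro inj_onD[OF inj_TTH_incl]) (simp_all add: HH_incl_TTH_incl)
  then show "x = y" using xy inj_onD[OF inj_HH_TTH] by blast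
qed

abbreviation "id_mu \<equiv> tmap T T3 id \<mu>"

lemma id_mu_lin: "id_mu \<in> lin TT T4"
  using mu_lin by simp

lemmas id_mu_closed [simp] = lin_closed[OF id_mu_lin]

lemma psi_left:
  assumes x: "x \<in> carrier T" and v: "v \<in> carrier T3" and u: "u \<in> carrier TT"
  shows "psi (simple T3 TT (left_mult T TT x v) u) = left_mult T T4 x (psi (simple T3 TT v u))"
proof -
  note s = simple_lin_left[of T3 TT u]
  have "\<forall>v\<in>carrier T3. (psi \<circ> (\<lambda>v. simple T3 TT v u) \<circ> left_mult T TT x) v = (left_mult T T4 x \<circ> (psi \<circ> (\<lambda>v. simple T3 TT v u))) v"
    by (rule tensor_eqI[OF modT _ lin_comp[OF lm_lin lin_comp[OF s psi_lin]] lin_comp[OF lin_comp[OF s psi_lin] lm_lin]])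
      (simp_all add: x u psi_simple)
  then show ?thesis using v by simp
qed

lemma psi_mu_lin: "psi \<circ> tmap T3 TT \<mu> id \<in> lin T3 T5"
  by (rule lin_comp[OF _ psi_lin]) (simp add: mu_lin)

text \<open>Coassociativity of the future \<open>Delta\<close> before it exists:
  \<open>torsor_assoc'\<close> applied in the second leg of \<open>h\<close>.\<close>

lemma psi_mu_id_mu:
  assumes "h \<in> carrier TT"
  shows "tmap T T5 id (psi \<circ> tmap T3 TT \<mu> id) (id_mu h) = tmap T T5 id (tmap T T4 id id_mu) (id_mu h)"
proof -
  have mm: "tmap T T4 id id_mu \<in> lin T3 T5" using id_mu_lin by simp
  have "tmap T T5 id (psi \<circ> tmap T3 TT \<mu> id) (id_mu h) = tmap T T5 (id \<circ> id) ((psi \<circ> tmap T3 TT \<mu> id) \<circ> \<mu>) h"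
    by (rule tmap_tmap[OF lin_id mu_lin lin_id psi_mu_lin]) (simp_all add: assms)
  also have "\<dots> = tmap T T5 (id \<circ> id) (tmap T T4 id id_mu \<circ> \<mu>) h"
    by (rule tmap_cong[OF lin_comp[OF lin_id lin_id] lin_comp[OF mu_lin psi_mu_lin]]) (simp_all add: assms torsor_assoc')
  also have "\<dots> = tmap T T5 id (tmap T T4 id id_mu) (id_mu h)"
    by (rule tmap_tmap[OF lin_id mu_lin lin_id mm, symmetric]) (simp_all add: assms)
  finally show ?thesis .
qed

definition "T3H_incl = tmap T T4 id TTH_incl \<circ> assoc T TT H"

lemma T3H_incl_lin: "T3H_incl \<in> lin (T3 \<boxtimes> H) T5"
  unfolding T3H_incl_def by (rule lin_comp[OF assoc_lin]) (simp_all add: TTH_incl_lin)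

lemma inj_T3H_incl: "inj_on T3H_incl (carrier (T3 \<boxtimes> H))"
  unfolding T3H_incl_def by (rule inj_comp_assoc) (simp_all add: inj_id_tmap TTH_incl_lin inj_TTH_incl)

lemma T3H_incl_simple:
  assumes v: "v \<in> carrier T3" and h: "h \<in> carrier H"
  shows "T3H_incl (simple T3 H v h) = psi (simple T3 TT v h)"
proof -
  have "\<forall>v\<in>carrier T3. (T3H_incl \<circ> (\<lambda>v. simple T3 H v h)) v = (psi \<circ> (\<lambda>v. simple T3 TT v h)) v"
    by (rule tensor_eqI[OF modT _ lin_comp[OF simple_lin_left T3H_incl_lin] lin_comp[OF simple_lin_left psi_lin]])
      (simp_all add: h psi_simple T3H_incl_def tmap_simple[OF _ _ lin_id TTH_incl_lin] TTH_incl_simple)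
  then show ?thesis using v by simp
qed

text \<open>The right leg lies in \<open>H\<close> because \<open>\<mu>\<close> factors through
  \<open>delta\<close>. For the left leg, axiom (i) rewrites
  \<open>x \<mu>(y^(1)) (x) y^(2) (x) y^(3)\<close> as
  \<open>x y^(1) (x) y^(2) (x) \<mu>(y^(3))\<close>, that is \<open>D h\<close> with
  \<open>\<mu>\<close> applied to its last factor. As \<open>D h = 1 (x) h\<close>, this is
  \<open>1\<close> tensored with \<open>id_mu h\<close>, the required kernel condition.\<close>

lemma id_mu_image:
  assumes h: "h \<in> carrier H"
  shows "id_mu h \<in> HH_incl ` carrier HH"
proof -
  \<comment> \<open>The preimage of \<open>id_mu h\<close> in \<open>TT (x) H\<close>, obtained with
    \<open>delta\<close> in place of \<open>\<mu>\<close>.\<close>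
  define z where "z = assoc_inv T T H (tmap T TH id delta h)"
  note d = tmap_lin[OF lin_id delta_lin modT modT modT tensor_module[OF modT modH]]
  have z: "z \<in> carrier (TT \<boxtimes> H)"
    unfolding z_def using lin_closed[OF assoc_inv_lin[OF modT modT modH] lin_closed[OF d]] h by simp
  have kz: "TTH_incl z = id_mu h"
  proof -
    have "TTH_incl z = tmap T T3 id j (tmap T TH id delta h)"
      unfolding TTH_incl_def z_def using h lin_closed[OF d, of h] by (simp add: assoc_assoc_inv)
    also have "\<dots> = tmap T T3 (id \<circ> id) (j \<circ> delta) h"
      by (rule tmap_tmap[OF lin_id delta_lin lin_id j_lin]) (simp_all add: h)
    also have "\<dots> = id_mu h"
      by (rule tmap_cong[OF _ lin_comp[OF delta_lin j_lin], of _ T]) (simp_all add: h)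
    finally show ?thesis .
  qed
  \<comment> \<open>\<open>D\<close> on the first two of four factors. Equality of
    \<open>D (x) H\<close> and \<open>eta (x) H\<close> at \<open>z\<close> is tested in the fifth
    tensor power through the injective \<open>T3H_incl\<close>, where \<open>D (x) H\<close> becomes
    \<open>Dl\<close>.\<close>
  define Dl where "Dl = mult_first R T T4 \<circ> tmap T T5 id (psi \<circ> tmap T3 TT \<mu> id)"
  have Dl_lin: "Dl \<in> lin T4 T5"
    unfolding Dl_def by (rule lin_comp[OF _ mf_lin]) (simp_all add: psi_mu_lin)
  have Dl_simple: "Dl (simple T T3 x (simple T TT y u)) = left_mult T T4 x (psi (simple T3 TT (\<mu> y) u))"
    if "x \<in> carrier T" "y \<in> carrier T" "u \<in> carrier TT" for x y u
    using that lin_closed[OF psi_lin, of "simple T3 TT (\<mu> y) u"]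
    by (simp add: Dl_def tmap_simple[OF _ _ lin_id psi_mu_lin] tmap_simple[OF _ _ mu_lin lin_id] mf_simple)
  have 1: "T3H_incl (tmap T3 H D id z) = Dl (TTH_incl z)"
  proof -
    have "\<forall>z\<in>carrier (TT \<boxtimes> H). (T3H_incl \<circ> tmap T3 H D id) z = (Dl \<circ> TTH_incl) z"
      by (rule tensor_eqI_left[OF modT modT modH lin_comp[OF tmap_lin[OF D_lin lin_id] T3H_incl_lin] lin_comp[OF TTH_incl_lin Dl_lin]])
        (simp_all add: tmap_simple[OF _ _ D_lin lin_id] T3H_incl_simple psi_left TTH_incl_simple Dl_simple)
    then show ?thesis using z by simp
  qed
  have 2: "T3H_incl (tmap T3 H eta id z) = simple T T4 \<one>\<^bsub>T\<^esub> (TTH_incl z)"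
  proof -
    have "\<forall>z\<in>carrier (TT \<boxtimes> H). (T3H_incl \<circ> tmap T3 H eta id) z = (simple T T4 \<one>\<^bsub>T\<^esub> \<circ> TTH_incl) z"
      by (rule tensor_eqI[OF _ modH lin_comp[OF tmap_lin[OF eta_lin lin_id] T3H_incl_lin] lin_comp[OF TTH_incl_lin simple_lin_right]])
        (simp_all add: tmap_simple[OF _ _ eta_lin lin_id] T3H_incl_simple psi_simple TTH_incl_simple)
    then show ?thesis using z by simp
  qed
  have "Dl (id_mu h) = mult_first R T T4 (tmap T T5 id (tmap T T4 id id_mu) (id_mu h))"
    using h by (simp add: Dl_def psi_mu_id_mu)
  also have "\<dots> = tmap T T4 id id_mu (D h)"
    using h by (simp add: mult_first_natural[OF algT _ _ id_mu_lin] D_eq)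
  also have "\<dots> = simple T T4 \<one>\<^bsub>T\<^esub> (id_mu h)" using h by (simp add: D_H tmap_simple[OF _ _ lin_id id_mu_lin])
  finally have "T3H_incl (tmap T3 H D id z) = T3H_incl (tmap T3 H eta id z)"
    by (simp add: 1 2 kz)
  then have e: "tmap T3 H D id z = tmap T3 H eta id z"
    by (rule inj_onD[OF inj_T3H_incl]) (use z lin_closed[OF tmap_lin[OF D_lin lin_id[of H]]] lin_closed[OF tmap_lin[OF eta_lin lin_id[of H]]] in simp_all)
  have "tmap T3 H kap id z = \<zero>\<^bsub>T3 \<boxtimes> H\<^esub>"
    unfolding kap_def[abs_def] using lin_closed[OF tmap_lin[OF eta_lin lin_id], of H z] z
    by (simp add: tmap_diff_left[OF _ _ _ _ D_lin eta_lin lin_id] e module_diff_eq_zero)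
  then have "z \<in> HH_TTH ` carrier HH" using exact_HH_TTH z unfolding exact_at_def by blast
  then obtain x where "x \<in> carrier HH" "z = HH_TTH x" by blast
  then show ?thesis using kz by (metis HH_incl_TTH_incl image_eqI)
qed

lemma Delta_exists: "\<exists>\<Delta>. \<Delta> \<in> lin H HH \<and> (\<forall>h\<in>carrier H. HH_incl (\<Delta> h) = id_mu h)"
proof -
  have "id_mu \<in> lin H T4" using lin_comp[OF H_incl id_mu_lin] by simp
  then obtain g where "g \<in> lin H HH" "\<And>h. h \<in> carrier H \<Longrightarrow> HH_incl (g h) = id_mu h"
    using lin_factor[OF HH_incl_lin inj_HH_incl] id_mu_image by (metis tensor_module modH)
  then show ?thesis by blast
qed

definition "Delta = (SOME \<Delta>. \<Delta> \<in> lin H HH \<and> (\<forall>h\<in>carrier H. HH_incl (\<Delta> h) = id_mu h))"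

lemma Delta_lin: "Delta \<in> lin H HH" and HH_incl_Delta [simp]: "h \<in> carrier H \<Longrightarrow> HH_incl (Delta h) = id_mu h"
  using someI_ex[OF Delta_exists] unfolding Delta_def by blast+

lemmas Delta_closed [simp] = lin_closed[OF Delta_lin]


text \<open>Multiplicativity holds only with opposite algebras in the first and third factors. The
  map is built over \<open>oT\<close> and \<open>B\<close>, where the algebra lemmas apply, and is
  then recognised as the same function over \<open>T\<close> and \<open>TT\<close>.\<close>

lemma HH_incl_hom: "HH_incl \<in> algebra_homs R HH (oT \<boxtimes> (T \<boxtimes> B))"
proof -
  note oT = nc_algebra_opposite[OF algT]
  have "assoc oT T B \<circ> tmap B B id id \<in> algebra_homs R HH (oT \<boxtimes> (T \<boxtimes> B))"
  proof (rule algebra_homI)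
    note h1 = tmap_algebra_hom[OF algH algH algB algB H_incl_hom H_incl_hom] and h2 = assoc_algebra_hom[OF oT algT algB]
    note a = algebra_homD[OF h1] algebra_homD[OF h2]
    show "assoc oT T B \<circ> tmap B B id id \<in> lin HH (oT \<boxtimes> (T \<boxtimes> B))" by (rule lin_comp[OF a(1,4)])
    show "(assoc oT T B \<circ> tmap B B id id) \<one>\<^bsub>HH\<^esub> = \<one>\<^bsub>oT \<boxtimes> (T \<boxtimes> B)\<^esub>"
      unfolding comp_def a(2,5) ..
    show "(assoc oT T B \<circ> tmap B B id id) (x \<otimes>\<^bsub>HH\<^esub> y) =
      (assoc oT T B \<circ> tmap B B id id) x \<otimes>\<^bsub>oT \<boxtimes> (T \<boxtimes> B)\<^esub> (assoc oT T B \<circ> tmap B B id id) y"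
      if "x \<in> carrier HH" "y \<in> carrier HH" for x y
      using a(3)[OF that] a(6)[OF lin_closed[OF a(1) that(1)] lin_closed[OF a(1) that(2)]] by (simp only: comp_def)
  qed
  also have "assoc oT T B \<circ> tmap B B id id = HH_incl"
    unfolding HH_incl_eq assoc_same[OF same_module_opposite same_module_refl[of T] same_B] tmap_same[OF same_B same_B] ..
  finally show ?thesis .
qed

lemma Delta_hom: "Delta \<in> algebra_homs R H HH"
proof -
  note oT = nc_algebra_opposite[OF algT]
  have "tmap oT (T \<boxtimes> B) id \<mu> \<in> algebra_homs R B (oT \<boxtimes> (T \<boxtimes> B))"
    by (rule tmap_algebra_hom[OF oT algT oT algTB id_algebra_hom torsor_hom])
  also have "tmap oT (T \<boxtimes> B) id \<mu> = id_mu"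
    by (rule tmap_same[OF same_module_opposite same_module_tensor[OF same_module_refl[of T] same_B]])
  finally have mh: "id_mu \<in> algebra_homs R B (oT \<boxtimes> (T \<boxtimes> B))" .
  have "id_mu \<one>\<^bsub>H\<^esub> = \<one>\<^bsub>oT \<boxtimes> (T \<boxtimes> B)\<^esub>" using algebra_homD(2)[OF mh] by simp
  moreover have "id_mu (x \<otimes>\<^bsub>H\<^esub> y) = id_mu x \<otimes>\<^bsub>oT \<boxtimes> (T \<boxtimes> B)\<^esub> id_mu y" if "x \<in> carrier H" "y \<in> carrier H" for x y
    using algebra_homD(3)[OF mh, of x y] that by simp
  ultimately show ?thesis
    by (rule algebra_hom_factor[OF algH tensor_nc_algebra[OF algH algH] HH_incl_hom inj_HH_incl _ _ Delta_lin HH_incl_Delta])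
qed

section \<open>Coassociativity and counit laws for \<open>H\<close> and for the coaction\<close>

definition "shuffle = tmap T T5 id psi \<circ> assoc T T3 TT"

lemma shuffle_lin: "shuffle \<in> lin (T4 \<boxtimes> TT) (T \<boxtimes> T5)"
  unfolding shuffle_def by (rule lin_comp[OF assoc_lin]) (simp_all add: psi_lin)

definition "HHH_incl = assoc T T T4 \<circ> tmap TT T4 id HH_incl"

lemma HHH_incl_lin: "HHH_incl \<in> lin (H \<boxtimes> HH) (T \<boxtimes> T5)"
  unfolding HHH_incl_def by (rule lin_comp[OF _ assoc_lin]) (simp_all add: HH_incl_lin)

text \<open>After a flip this is \<open>T4\<close> tensored with the injection of \<open>H\<close>
  into \<open>TT\<close>; \<open>inj_tmap_step\<close> climbs up to it from
  \<open>inj_j\<close>.\<close>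

lemma inj_H_T4: "inj_on (tmap TT T4 id id) (carrier (H \<boxtimes> T4))"
proof (rule inj_on_square[where a = "swap H T4" and c = "swap TT T4" and g = "tmap T4 TT id id"])
  have "inj_on (tmap T TT id id) (carrier TH)" using inj_j by (simp add: j_eq)
  then have "inj_on (tmap T4 TT id id) (carrier (T4 \<boxtimes> H))"
    by (intro inj_tmap_step[OF modT ff]) simp_all
  then show "inj_on (tmap T4 TT id id) (swap H T4 ` carrier (H \<boxtimes> T4))"
    by (simp add: swap_image)
qed (simp_all add: swap_inj swap_natural[OF modH _ _ _ H_incl lin_id])

text \<open>Two stages as before: \<open>H (x) HH\<close> goes into \<open>H (x) T4\<close> by
  flatness of \<open>H\<close>, and this into \<open>TT (x) T4\<close> by
  \<open>inj_H_T4\<close>.\<close>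

lemma inj_HHH_incl: "inj_on HHH_incl (carrier (H \<boxtimes> HH))"
proof (rule inj_onI)
  fix x y assume xy: "x \<in> carrier (H \<boxtimes> HH)" "y \<in> carrier (H \<boxtimes> HH)" and eq: "HHH_incl x = HHH_incl y"
  have c: "tmap TT T4 id HH_incl z = tmap TT T4 id id (tmap H T4 id HH_incl z)" "tmap H T4 id HH_incl z \<in> carrier (H \<boxtimes> T4)"
    "tmap TT T4 id HH_incl z \<in> carrier (TT \<boxtimes> T4)"
    if z: "z \<in> carrier (H \<boxtimes> HH)" for z
    using tmap_tmap[OF lin_id HH_incl_lin H_incl lin_id, of z] lin_closed[OF tmap_lin[OF lin_id[of H] HH_incl_lin], of z]
      lin_closed[OF tmap_lin[OF H_incl HH_incl_lin], of z] z by simp_all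
  have "tmap TT T4 id HH_incl x = tmap TT T4 id HH_incl y"
    using inj_onD[of "assoc T T T4" "carrier (TT \<boxtimes> T4)"] lin_isoD(2)[OF lin_iso_assoc(1)[OF modT modT, of T4]] eq c(3)[OF xy(1)] c(3)[OF xy(2)]
    by (simp add: HHH_incl_def bij_betw_def)
  then have "tmap H T4 id HH_incl x = tmap H T4 id HH_incl y"
    using inj_onD[OF inj_H_T4] c(2)[OF xy(1)] c(2)[OF xy(2)] c(1)[OF xy(1)] c(1)[OF xy(2)] by simp
  moreover have "inj_on (tmap H T4 id HH_incl) (carrier (H \<boxtimes> HH))"
    by (rule flat_inj_of_base_change[OF modT ff modH inv_beta_iso]) (simp_all add: HH_incl_lin inj_HH_incl)
  ultimately show "x = y" using xy inj_onD by metis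
qed

lemma HHH_incl_assoc:
  assumes X: "X \<in> carrier (HH \<boxtimes> H)"
  shows "HHH_incl (assoc H H H X) = shuffle (tmap T4 TT HH_incl id X)"
proof -
  have 1: "assoc T T T4 (simple TT T4 a (assoc T T TT (simple TT TT b c))) = shuffle (simple T4 TT (assoc T T TT (simple TT TT a b)) c)"
    if a: "a \<in> carrier TT" and bc: "b \<in> carrier TT" "c \<in> carrier TT" for a b c
  proof -
    have "\<forall>a\<in>carrier TT. (assoc T T T4 \<circ> (\<lambda>a. simple TT T4 a (assoc T T TT (simple TT TT b c)))) a =
      (shuffle \<circ> ((\<lambda>w. simple T4 TT w c) \<circ> (assoc T T TT \<circ> (\<lambda>a. simple TT TT a b)))) a"
      by (rule tensor_eqI[OF modT modT lin_comp[OF simple_lin_left assoc_lin]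
        lin_comp[OF lin_comp[OF lin_comp[OF simple_lin_left assoc_lin] simple_lin_left] shuffle_lin]])
       (simp_all add: bc shuffle_def tmap_simple[OF _ _ lin_id psi_lin] psi_simple)
    then show ?thesis using a by simp
  qed
  have "\<forall>X\<in>carrier (HH \<boxtimes> H). (HHH_incl \<circ> assoc H H H) X = (shuffle \<circ> tmap T4 TT HH_incl id) X"
    by (rule tensor_eqI_left[OF modH modH modH lin_comp[OF assoc_lin HHH_incl_lin] lin_comp[OF tmap_lin[OF HH_incl_lin H_incl] shuffle_lin]])
      (simp_all add: HHH_incl_def tmap_simple[OF _ _ H_incl HH_incl_lin] tmap_simple[OF _ _ HH_incl_lin H_incl] HH_incl_simple 1)
  then show ?thesis using X by simp
qed

lemma tmap_Delta_right:
  assumes X: "X \<in> carrier HH"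
  shows "HHH_incl (tmap H HH id Delta X) = tmap T T5 id (tmap T T4 id id_mu) (HH_incl X)"
proof -
  have "tmap TT T4 id HH_incl (tmap H HH id Delta X) = tmap TT T4 (id \<circ> id) (HH_incl \<circ> Delta) X"
    by (rule tmap_tmap[OF lin_id Delta_lin H_incl HH_incl_lin]) (simp_all add: X)
  also have "\<dots> = tmap TT T4 (id \<circ> id) (id_mu \<circ> id) X"
    by (rule tmap_cong[OF _ lin_comp[OF Delta_lin HH_incl_lin], of _ H]) (simp_all add: X)
  also have "\<dots> = tmap TT T4 id id_mu (tmap TT TT id id X)"
    by (rule tmap_tmap[OF H_incl H_incl lin_id id_mu_lin, symmetric]) (simp_all add: X)
  finally have "HHH_incl (tmap H HH id Delta X) = assoc T T T4 (tmap TT T4 id id_mu (tmap TT TT id id X))"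
    by (simp add: HHH_incl_def)
  also have "\<dots> = assoc T T T4 (tmap TT T4 (tmap T T id id) id_mu (tmap TT TT id id X))"
    by (rule arg_cong[where f = "assoc T T T4"], rule tmap_cong[OF lin_id id_mu_lin])
      (simp_all add: tmap_id lin_closed[OF tmap_lin[OF H_incl H_incl]] X)
  also have "\<dots> = tmap T T5 id (tmap T T4 id id_mu) (assoc T T TT (tmap TT TT id id X))"
    by (rule assoc_natural[OF modT modT _ modT modT _ lin_id lin_id id_mu_lin])
      (simp_all add: lin_closed[OF tmap_lin[OF H_incl H_incl]] X)
  finally show ?thesis by (simp add: HH_inclusion_def)
qed

lemma tmap_Delta_left:
  assumes X: "X \<in> carrier HH"
  shows "HHH_incl (assoc H H H (tmap HH H Delta id X)) = tmap T T5 id (psi \<circ> tmap T3 TT \<mu> id) (HH_incl X)"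
proof -
  have iX: "tmap TT TT id id X \<in> carrier (TT \<boxtimes> TT)"
    using lin_closed[OF tmap_lin[OF H_incl H_incl]] X by simp
  have "tmap T4 TT HH_incl id (tmap HH H Delta id X) = tmap T4 TT (HH_incl \<circ> Delta) (id \<circ> id) X"
    by (rule tmap_tmap[OF Delta_lin lin_id HH_incl_lin H_incl]) (simp_all add: X)
  also have "\<dots> = tmap T4 TT (id_mu \<circ> id) (id \<circ> id) X"
    by (rule tmap_cong[OF lin_comp[OF Delta_lin HH_incl_lin], of _ H]) (simp_all add: X)
  also have "\<dots> = tmap T4 TT id_mu id (tmap TT TT id id X)"
    by (rule tmap_tmap[OF H_incl H_incl id_mu_lin lin_id, symmetric]) (simp_all add: X)
  finally have "HHH_incl (assoc H H H (tmap HH H Delta id X)) = shuffle (tmap T4 TT id_mu id (tmap TT TT id id X))"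
    using X lin_closed[OF tmap_lin[OF Delta_lin lin_id[of H]], of X] by (simp add: HHH_incl_assoc)
  also have "\<dots> = tmap T T5 id psi (tmap T (T3 \<boxtimes> TT) id (tmap T3 TT \<mu> id) (HH_incl X))"
    using assoc_natural[OF modT modT _ modT _ _ lin_id mu_lin lin_id iX]
    by (simp add: shuffle_def HH_inclusion_def)
  also have "\<dots> = tmap T T5 (id \<circ> id) (psi \<circ> tmap T3 TT \<mu> id) (HH_incl X)"
    by (rule tmap_tmap[OF lin_id tmap_lin[OF mu_lin lin_id] lin_id psi_lin])
      (simp_all add: lin_closed[OF HH_incl_lin X])
  finally show ?thesis by simp
qed

text \<open>In the sixth tensor power both sides are explicit maps applied to
  \<open>HH_incl (Delta h) = id_mu h\<close>, and there they agree by
  \<open>psi_mu_id_mu\<close>.\<close>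

lemma Delta_coassoc:
  assumes h: "h \<in> carrier H"
  shows "assoc H H H (tmap HH H Delta id (Delta h)) = tmap H HH id Delta (Delta h)"
proof (rule inj_onD[OF inj_HHH_incl])
  show "HHH_incl (assoc H H H (tmap HH H Delta id (Delta h))) = HHH_incl (tmap H HH id Delta (Delta h))"
    using h by (simp add: tmap_Delta_left tmap_Delta_right psi_mu_id_mu)
qed (use h lin_closed[OF tmap_lin[OF Delta_lin lin_id[of H]]] lin_closed[OF tmap_lin[OF lin_id[of H] Delta_lin]] in simp_all)

lemma eps_bilin:
  assumes M: "module R M"
  shows "(\<lambda>a b. eps a \<odot>\<^bsub>M\<^esub> b) \<in> bilin H M M" "(\<lambda>a b. eps b \<odot>\<^bsub>M\<^esub> a) \<in> bilin M H M"
proof -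
  interpret M: module R M by fact
  show "(\<lambda>a b. eps a \<odot>\<^bsub>M\<^esub> b) \<in> bilin H M M"
    using lin_add[OF eps_lin] lin_smult[OF eps_lin]
    by (intro bilinI') (simp_all add: M.smult_l_distr M.smult_r_distr M.smult_assoc1[symmetric] m_comm)
  then show "(\<lambda>a b. eps b \<odot>\<^bsub>M\<^esub> a) \<in> bilin M H M" by (rule bilin_flip)
qed

lemma inj_simple_one: "inj_on eta (carrier TT)"
proof (rule inj_on_inverseI)
  show "mult_first R T T (eta z) = z" if "z \<in> carrier TT" for z
    using that by (simp add: mf_simple left_mult_one[OF algT modT])
qed

text \<open>Multiplying the first two factors maps \<open>a (x) b\<close> in \<open>HH\<close> to
  \<open>1 (x) \<epsilon>(a) b\<close> and \<open>id_mu h\<close> to \<open>D h = 1 (x) h\<close>.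
  The common factor \<open>1 (x) -\<close> is cancelled because \<open>eta\<close> is
  injective.\<close>

lemma eps_counit_left:
  assumes h: "h \<in> carrier H"
  shows "lift H (\<lambda>a b. eps a \<odot>\<^bsub>H\<^esub> b) (Delta h) = h"
proof (rule inj_onD[OF inj_simple_one])
  note b = eps_bilin(1)[OF modH] and mf = mf_lin[of TT]
  have 1: "mult_first R T TT (assoc T T TT (simple TT TT a u)) = simple T TT (mult_map T a) u"
    if a: "a \<in> carrier TT" and u: "u \<in> carrier TT" for a u
  proof -
    have "\<forall>a\<in>carrier TT. (mult_first R T TT \<circ> (assoc T T TT \<circ> (\<lambda>a. simple TT TT a u))) a = ((\<lambda>t. simple T TT t u) \<circ> mult_map T) a"
      by (rule tensor_eqI[OF modT modT lin_comp[OF lin_comp[OF simple_lin_left assoc_lin] mf] lin_comp[OF mult_lin simple_lin_left]])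
        (simp_all add: u mf_simple)
    then show ?thesis using a by simp
  qed
  have lc: "eta \<in> lin H T3"
    using lin_comp[OF H_incl simple_lin_right[OF modT _ one_T]] by simp
  have "\<forall>X\<in>carrier HH. (eta \<circ> lift H (\<lambda>a b. eps a \<odot>\<^bsub>H\<^esub> b)) X = (mult_first R T TT \<circ> HH_incl) X"
    by (rule tensor_eqI[OF modH modH lin_comp[OF lift_lin[OF modH modH b modH] lc] lin_comp[OF HH_incl_lin mf]])
      (simp_all add: lift_simple[OF modH modH b modH, unfolded H_simps] HH_incl_simple 1 unit_eps[symmetric] simple_smult_left simple_smult_right)
  then show "eta (lift H (\<lambda>a b. eps a \<odot>\<^bsub>H\<^esub> b) (Delta h)) = eta h"
    using h by (simp add: D_eq[symmetric] D_H)
  show "lift H (\<lambda>a b. eps a \<odot>\<^bsub>H\<^esub> b) (Delta h) \<in> carrier TT"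
    using lin_closed[OF lift_lin[OF modH modH b modH], of "Delta h"] h by simp
qed (use h in simp)

text \<open>\<open>F\<close> multiplies the last three factors together. On \<open>a (x) b\<close>
  in \<open>HH\<close> the product of \<open>b\<close> is the scalar \<open>\<epsilon>(b)\<close>;
  on \<open>id_mu h\<close> the second leg becomes \<open>y^(1) y^(2) y^(3) = y\<close> by
  \<open>torsor_right\<close>.\<close>

lemma eps_counit_right:
  assumes h: "h \<in> carrier H"
  shows "lift H (\<lambda>a b. eps b \<odot>\<^bsub>H\<^esub> a) (Delta h) = h"
proof -
  note b = eps_bilin(2)[OF modH]
  have im: "id_mult \<in> lin T3 TT" by simp
  define F where "F = tmap T T id (mult_map T \<circ> id_mult)"
  note mm = lin_comp[OF im mult_lin]
  have F: "F \<in> lin T4 TT" unfolding F_def using mm by simp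
  have 1: "F (assoc T T TT (simple TT TT a u)) = eps u \<odot>\<^bsub>TT\<^esub> a"
    if a: "a \<in> carrier TT" and u: "u \<in> carrier H" for a u
  proof -
    have "\<forall>a\<in>carrier TT. (F \<circ> (assoc T T TT \<circ> (\<lambda>a. simple TT TT a u))) a = (\<lambda>a. eps u \<odot>\<^bsub>TT\<^esub> id a) a"
    proof (rule tensor_eqI[OF modT modT lin_comp[OF lin_comp[OF simple_lin_left assoc_lin] F] lin_scale[OF lin_id]])
      fix x y assume "x \<in> carrier T" "y \<in> carrier T"
      then show "(F \<circ> (assoc T T TT \<circ> (\<lambda>a. simple TT TT a u))) (simple T T x y) = eps u \<odot>\<^bsub>TT\<^esub> id (simple T T x y)"
        using u by (simp add: F_def tmap_simple[OF _ _ lin_id mm] tmap_simple[OF _ _ lin_id mult_lin] unit_eps[symmetric]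
          lin_smult[OF mult_lin] smult_mult_right simple_smult_right)
    qed (use u in simp_all)
    then show ?thesis using a by simp
  qed
  have L: "lift H (\<lambda>a b. eps b \<odot>\<^bsub>H\<^esub> a) \<in> lin HH TT"
    using lin_comp[OF lift_lin[OF modH modH b modH] H_incl] by simp
  have "\<forall>X\<in>carrier HH. lift H (\<lambda>a b. eps b \<odot>\<^bsub>H\<^esub> a) X = (F \<circ> HH_incl) X"
    by (rule tensor_eqI[OF modH modH L lin_comp[OF HH_incl_lin F]])
      (simp_all add: lift_simple[OF modH modH b modH, unfolded H_simps] HH_incl_simple 1)
  then have "lift H (\<lambda>a b. eps b \<odot>\<^bsub>H\<^esub> a) (Delta h) = F (id_mu h)" using h by simp
  also have "\<dots> = tmap T T (id \<circ> id) ((mult_map T \<circ> id_mult) \<circ> \<mu>) h"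
    unfolding F_def by (rule tmap_tmap[OF lin_id mu_lin lin_id mm]) (simp_all add: h)
  also have "\<dots> = tmap T T id id h"
    by (rule tmap_cong[OF _ lin_comp[OF mu_lin mm], of _ T]) (simp_all add: h torsor_right)
  finally show ?thesis using h by (simp add: tmap_id)
qed

text \<open>Seen inside \<open>T5\<close>, the two sides are precisely the two sides of
  \<open>torsor_assoc'\<close>.\<close>

lemma delta_coassoc:
  assumes x: "x \<in> carrier T"
  shows "assoc T H H (tmap TH H delta id (delta x)) = tmap T HH id Delta (delta x)"
proof (rule inj_onD[of "tmap T T4 id HH_incl"])
  show "inj_on (tmap T T4 id HH_incl) (carrier THH)"
    by (rule inj_id_tmap) (simp_all add: HH_incl_lin inj_HH_incl)
  have 1: "tmap T T4 id HH_incl (assoc T H H Y) = psi (tmap T3 TT j id Y)" if "Y \<in> carrier (TH \<boxtimes> H)" for Y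
  proof -
    have "\<forall>Y\<in>carrier (TH \<boxtimes> H). (tmap T T4 id HH_incl \<circ> assoc T H H) Y = (psi \<circ> tmap T3 TT j id) Y"
      by (rule tensor_eqI_left[OF modT modH modH lin_comp[OF assoc_lin tmap_lin[OF lin_id HH_incl_lin]] lin_comp[OF tmap_lin[OF j_lin H_incl] psi_lin]])
        (simp_all add: tmap_simple[OF _ _ lin_id HH_incl_lin] tmap_simple[OF _ _ j_lin H_incl] HH_incl_simple psi_simple)
    then show ?thesis using that by simp
  qed
  have "tmap T3 TT j id (tmap TH H delta id (delta x)) = tmap T3 TT (j \<circ> delta) (id \<circ> id) (delta x)"
    by (rule tmap_tmap[OF delta_lin lin_id j_lin H_incl]) (simp_all add: x)
  also have "\<dots> = tmap T3 TT (\<mu> \<circ> id) (id \<circ> id) (delta x)"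
    by (rule tmap_cong[OF lin_comp[OF delta_lin j_lin], of _ H]) (simp_all add: x)
  also have "\<dots> = tmap T3 TT \<mu> id (tmap T TT id id (delta x))"
    by (rule tmap_tmap[OF lin_id H_incl mu_lin lin_id, symmetric]) (simp_all add: x)
  also have "\<dots> = tmap T3 TT \<mu> id (\<mu> x)" using j_delta[OF x] by (simp add: j_eq)
  finally have L: "tmap T T4 id HH_incl (assoc T H H (tmap TH H delta id (delta x))) = psi (tmap T3 TT \<mu> id (\<mu> x))"
    using lin_closed[OF tmap_lin[OF delta_lin lin_id[of H]], of "delta x"] x by (simp add: 1)
  have "tmap T T4 id HH_incl (tmap T HH id Delta (delta x)) = tmap T T4 (id \<circ> id) (HH_incl \<circ> Delta) (delta x)"
    by (rule tmap_tmap[OF lin_id Delta_lin lin_id HH_incl_lin]) (simp_all add: x)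
  also have "\<dots> = tmap T T4 (id \<circ> id) (id_mu \<circ> id) (delta x)"
    by (rule tmap_cong[OF _ lin_comp[OF Delta_lin HH_incl_lin], of _ T]) (simp_all add: x)
  also have "\<dots> = tmap T T4 id id_mu (tmap T TT id id (delta x))"
    by (rule tmap_tmap[OF lin_id H_incl lin_id id_mu_lin, symmetric]) (simp_all add: x)
  also have "\<dots> = tmap T T4 id id_mu (\<mu> x)" using j_delta[OF x] by (simp add: j_eq)
  finally show "tmap T T4 id HH_incl (assoc T H H (tmap TH H delta id (delta x))) = tmap T T4 id HH_incl (tmap T HH id Delta (delta x))"
    using L torsor_assoc'[OF x] by simp
qed (use x lin_closed[OF tmap_lin[OF delta_lin lin_id[of H]]] lin_closed[OF tmap_lin[OF lin_id[of T] Delta_lin]] in simp_all)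

text \<open>Applying \<open>eps\<close> to the \<open>H\<close> leg multiplies it out, so the left
  side is \<open>x^(1) x^(2) x^(3)\<close>.\<close>

lemma delta_counit:
  assumes x: "x \<in> carrier T"
  shows "lift T (\<lambda>a h. eps h \<odot>\<^bsub>T\<^esub> a) (delta x) = x"
proof -
  note b = eps_bilin(2)[OF modT]
  have im: "id_mult \<in> lin T3 TT" by simp
  have "\<forall>Y\<in>carrier TH. lift T (\<lambda>a h. eps h \<odot>\<^bsub>T\<^esub> a) Y = (mult_map T \<circ> (id_mult \<circ> j)) Y"
    by (rule tensor_eqI[OF modT modH lift_lin[OF modT modH b modT] lin_comp[OF lin_comp[OF j_lin im] mult_lin]])
      (simp_all add: lift_simple[OF _ _ b] tmap_simple[OF _ _ lin_id mult_lin] unit_eps[symmetric] smult_mult_right)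
  then show ?thesis using x by (simp add: torsor_right)
qed

section \<open>Bijectivity of the Galois map of \<open>H\<close>\<close>

abbreviation "can \<equiv> galois_map R H H Delta"

lemmas can_lin = galois_map_lin[OF algH modH Delta_lin]
  and can_simple = galois_map_simple[OF algH modH Delta_lin]

text \<open>
  \<open>Psi\<close> maps \<open>x \<otimes> y \<otimes> z\<close> to \<open>x y\<^sub>0 z\<^sub>0 \<otimes> y\<^sub>1 z\<^sub>1 \<otimes> z\<^sub>2\<close>, \<open>N13\<close> maps \<open>(t \<otimes> g) \<otimes> z\<close> to \<open>t z\<^sub>0 \<otimes> g \<otimes> z\<^sub>1\<close>, and \<open>Phi\<close> maps
  \<open>x \<otimes> y \<otimes> z\<close> to \<open>x y\<^sub>0 z\<^sub>0 \<otimes> y\<^sub>1 \<otimes> z\<^sub>1\<close>.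
\<close>

definition "Psi = assoc T H H \<circ> tmap TH H beta id \<circ> assoc_inv T T H \<circ> tmap T TH id beta"

definition "N13 = tmap T HH id (swap H H) \<circ> assoc T H H \<circ> tmap TH H beta id \<circ> assoc_inv T T H
  \<circ> tmap T TH id (swap H T) \<circ> assoc T H T"

definition "Phi = N13 \<circ> tmap TH T beta id \<circ> assoc_inv T T T"

lemma Psi_iso: "Psi \<in> lin_iso T3 THH"
  unfolding Psi_def comp_assoc
  by (rule lin_iso_comp lin_iso_tmap lin_iso_id beta_iso lin_iso_assoc | simp)+

lemma N13_iso: "N13 \<in> lin_iso (TH \<boxtimes> T) THH"
  unfolding N13_def comp_assoc
  by (rule lin_iso_comp lin_iso_tmap lin_iso_id beta_iso lin_iso_assoc lin_iso_swap | simp)+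

lemma Phi_iso: "Phi \<in> lin_iso T3 THH"
  unfolding Phi_def comp_assoc
  by (rule lin_iso_comp lin_iso_tmap lin_iso_id beta_iso lin_iso_assoc N13_iso | simp)+

lemmas algTH = tensor_nc_algebra[OF algT algH]
lemmas algHH = tensor_nc_algebra[OF algH algH]
lemmas algTHH = tensor_nc_algebra[OF algT algHH]

text \<open>Places \<open>t (x) g\<close> in the first two legs as \<open>t (x) g (x) 1\<close>, so
  that both maps compared in \<open>can_Phi\<close> become products in the algebra
  \<open>THH\<close>.\<close>

definition "e12 v = assoc T H H (simple TH H v \<one>\<^bsub>H\<^esub>)"

lemma e12_lin: "e12 \<in> lin TH THH"
proof -
  have "e12 = assoc T H H \<circ> (\<lambda>v. simple TH H v \<one>\<^bsub>H\<^esub>)" by (simp add: e12_def fun_eq_iff)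
  then show ?thesis
    using lin_comp[OF simple_lin_left assoc_lin[OF modT modH modH]] one_H by simp
qed

lemma e12_simple: "t \<in> carrier T \<Longrightarrow> g \<in> carrier H \<Longrightarrow> e12 (simple T H t g) = simple T HH t (simple H H g \<one>\<^bsub>H\<^esub>)"
  using one_H by (simp add: e12_def)

text \<open>Since \<open>can (g (x) h) = (g (x) 1) \<Delta>(h)\<close>, the image of
  \<open>t z\<^sub>0 (x) g (x) z\<^sub>1\<close> factors as \<open>(t (x) g (x) 1)\<close> times
  \<open>z\<^sub>0 (x) \<Delta>(z\<^sub>1)\<close>.\<close>

lemma can_N13:
  assumes v: "v \<in> carrier TH" and z: "z \<in> carrier T"
  shows "tmap T HH id can (N13 (simple TH T v z)) = e12 v \<otimes>\<^bsub>THH\<^esub> tmap T HH id Delta (delta z)"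
proof -
  have ic: "tmap T HH id can \<in> lin THH THH" using can_lin by simp
  have iD: "tmap T HH id Delta \<in> lin TH THH" using Delta_lin by simp
  have sw: "tmap T HH id (swap H H) \<in> lin THH THH" by simp
  note bP = nc_algebraD(3)[OF algTHH]
  have dc: "tmap T HH id Delta (delta z) \<in> carrier THH" using lin_closed[OF iD] z by simp
  \<comment> \<open>\<open>delta z\<close> is replaced by a free \<open>w\<close>, which linearity
    allows to be a simple tensor.\<close>
  have 1: "tmap T HH id can (tmap T HH id (swap H H) (assoc T H H (simple TH H (left_mult T H t w) g))) =
    simple T HH t (simple H H g \<one>\<^bsub>H\<^esub>) \<otimes>\<^bsub>THH\<^esub> tmap T HH id Delta w"
    if t: "t \<in> carrier T" and g: "g \<in> carrier H" and w: "w \<in> carrier TH" for t g w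
  proof -
    let ?F = "tmap T HH id can \<circ> (tmap T HH id (swap H H) \<circ> (assoc T H H \<circ> ((\<lambda>w. simple TH H w g) \<circ> left_mult T H t)))" and ?G = "mult THH (simple T HH t (simple H H g \<one>\<^bsub>H\<^esub>)) \<circ> tmap T HH id Delta"
    have s: "simple T HH t (simple H H g \<one>\<^bsub>H\<^esub>) \<in> carrier THH" using t g one_H by simp
    have "\<forall>w\<in>carrier TH. ?F w =
      ?G w"
    proof (rule tensor_eqI[OF modT modH])
      show "?F \<in> lin TH THH"
        by (rule lin_comp[OF lin_comp[OF lin_comp[OF lin_comp[OF lm_lin simple_lin_left] assoc_lin] sw] ic]) (simp_all add: t g)
      show "?G \<in> lin TH THH"
        by (rule lin_comp[OF iD bilinD(1)[OF bP s]])
      fix a h assume a: "a \<in> carrier T" "h \<in> carrier H"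
      have o: "\<one>\<^bsub>H\<^esub> \<in> carrier H" using one_H by simp
      show "?F (simple T H a h) =
        ?G (simple T H a h)"
        using a t g o
        by (simp add: tmap_simple[OF _ _ lin_id can_lin] tmap_simple[OF _ _ lin_id swap_lin] tmap_simple[OF _ _ lin_id Delta_lin]
            can_simple tensor_mult_simple[OF algT algHH] left_mult_eq[OF algH algH] del: H_simps)
    qed simp
    then show ?thesis using w by simp
  qed
  have "\<forall>v\<in>carrier TH. (tmap T HH id can \<circ> (N13 \<circ> (\<lambda>v. simple TH T v z))) v =
    ((\<lambda>p. p \<otimes>\<^bsub>THH\<^esub> tmap T HH id Delta (delta z)) \<circ> e12) v"
  proof (rule tensor_eqI[OF modT modH lin_comp[OF lin_comp[OF simple_lin_left lin_isoD(1)[OF N13_iso]] ic] lin_comp[OF e12_lin bilinD(2)[OF bP dc]]])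
    fix t g assume tg: "t \<in> carrier T" "g \<in> carrier H"
    have "N13 (simple TH T (simple T H t g) z) = tmap T HH id (swap H H) (assoc T H H (simple TH H (left_mult T H t (delta z)) g))"
      using tg z by (simp add: N13_def tmap_simple[OF _ _ lin_id swap_lin] tmap_simple[OF _ _ beta_lin lin_id] beta_simple)
    then show "(tmap T HH id can \<circ> (N13 \<circ> (\<lambda>v. simple TH T v z))) (simple T H t g) =
      ((\<lambda>p. p \<otimes>\<^bsub>THH\<^esub> tmap T HH id Delta (delta z)) \<circ> e12) (simple T H t g)"
      using tg z by (simp add: e12_simple 1 del: H_simps)
  qed (simp_all add: z)
  then show ?thesis using v by simp
qed

text \<open>Both sides at \<open>x (x) y (x) z\<close> equal \<open>e12 (x \<delta>(y))\<close>
  times the twofold coaction of \<open>z\<close>. The left one involves \<open>\<Delta>\<close> by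
  \<open>can_N13\<close>, the right one \<open>\<delta>\<close> twice; \<open>delta_coassoc\<close>
  identifies these.\<close>

lemma can_Phi:
  assumes "w \<in> carrier T3"
  shows "tmap T HH id can (Phi w) = Psi w"
proof -
  have ic: "tmap T HH id can \<in> lin THH THH" using can_lin by simp
  note bP = nc_algebraD(3)[OF algTHH]
  note dm = algebra_homD[OF delta_hom] and am = algebra_homD(3)[OF assoc_algebra_hom[OF algT algH algH]]
  have o: "\<one>\<^bsub>H\<^esub> \<in> carrier H" using one_H by simp
  interpret TH: nc_algebra R "T \<boxtimes> H" by (rule algTH)
  interpret HA: nc_algebra R H by (rule algH)
  \<comment> \<open>Multiplicativity of \<open>delta\<close> splits \<open>\<delta>(y a)\<close>
    into \<open>\<delta>(y) \<delta>(a)\<close>; again a free \<open>w\<close> stands for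
    \<open>delta z\<close>.\<close>
  have 1: "assoc T H H (tmap TH H beta id (assoc_inv T T H (simple T TH x (left_mult T H y w)))) =
    e12 (left_mult T H x (delta y)) \<otimes>\<^bsub>THH\<^esub> assoc T H H (tmap TH H delta id w)"
    if xy: "x \<in> carrier T" "y \<in> carrier T" and w: "w \<in> carrier TH" for x y w
  proof -
    let ?F = "assoc T H H \<circ> (tmap TH H beta id \<circ> (assoc_inv T T H \<circ> (simple T TH x \<circ> left_mult T H y)))" and ?G = "mult THH (e12 (left_mult T H x (delta y))) \<circ> (assoc T H H \<circ> tmap TH H delta id)"
    have c: "e12 (left_mult T H x (delta y)) \<in> carrier THH" by (rule lin_closed[OF e12_lin]) (simp add: xy)
    have "\<forall>w\<in>carrier TH. ?F w =
      ?G w"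
    proof (rule tensor_eqI[OF modT modH])
      show "?F \<in> lin TH THH"
        by (rule lin_comp[OF lin_comp[OF lin_comp[OF lin_comp[OF lm_lin simple_lin_right] assoc_inv_lin] tmap_lin[OF beta_lin lin_id]] assoc_lin])
          (simp_all add: xy)
      show "?G \<in> lin TH THH"
        by (rule lin_comp[OF lin_comp[OF tmap_lin[OF delta_lin lin_id] assoc_lin] bilinD(1)[OF bP c]]) simp_all
      fix a h assume a: "a \<in> carrier T" "h \<in> carrier H"
      have "left_mult T H x (delta (y \<otimes>\<^bsub>T\<^esub> a)) = left_mult T H x (delta y) \<otimes>\<^bsub>TH\<^esub> delta a"
        using xy a by (simp add: dm(3) left_mult_mult_assoc[OF algT algH])
      then have "assoc T H H (simple TH H (left_mult T H x (delta (y \<otimes>\<^bsub>T\<^esub> a))) h) =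
        e12 (left_mult T H x (delta y)) \<otimes>\<^bsub>THH\<^esub> assoc T H H (simple TH H (delta a) h)"
        using xy a o am[of "simple TH H (left_mult T H x (delta y)) \<one>\<^bsub>H\<^esub>" "simple TH H (delta a) h"]
        by (simp add: e12_def tensor_mult_simple[OF algTH algH] del: H_simps)
      then show "?F (simple T H a h) =
        ?G (simple T H a h)"
        using xy a by (simp add: tmap_simple[OF _ _ beta_lin lin_id] tmap_simple[OF _ _ delta_lin lin_id] beta_simple)
    qed simp
    then show ?thesis using w by simp
  qed
  have "\<forall>w\<in>carrier T3. (tmap T HH id can \<circ> Phi) w = Psi w"
  proof (rule tensor_eqI_right[OF modT modT modT lin_comp[OF lin_isoD(1)[OF Phi_iso] ic] lin_isoD(1)[OF Psi_iso]])
    fix x y z assume xyz: "x \<in> carrier T" "y \<in> carrier T" "z \<in> carrier T"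
    then show "(tmap T HH id can \<circ> Phi) (simple T TT x (simple T T y z)) = Psi (simple T TT x (simple T T y z))"
      by (simp add: Phi_def Psi_def tmap_simple[OF _ _ beta_lin lin_id] tmap_simple[OF _ _ lin_id beta_lin] beta_simple
          can_N13 1 delta_coassoc)
  qed simp
  then show ?thesis using assms by simp
qed

lemma can_iso: "can \<in> lin_iso HH HH"
proof (rule faithfully_flat_iso[OF modT ff])
  show "tmap T HH id can \<in> lin_iso THH THH"
    by (rule lin_iso_cancel[OF Phi_iso Psi_iso tmap_lin[OF lin_id can_lin] _ can_Phi]) simp_all
qed (simp_all add: can_lin)

section \<open>The Hopf algebra, the coinvariants and the Galois object\<close>

lemma hopf: "hopf_algebra R H Delta eps"
proof (intro hopf_algebra.intro hopf_algebra_axioms.intro)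
  show "\<exists>S\<in>lin H H. \<forall>h\<in>carrier H.
      lift H (\<lambda>a b. S a \<otimes>\<^bsub>H\<^esub> b) (Delta h) = eps h \<odot>\<^bsub>H\<^esub> \<one>\<^bsub>H\<^esub> \<and>
      lift H (\<lambda>a b. a \<otimes>\<^bsub>H\<^esub> S b) (Delta h) = eps h \<odot>\<^bsub>H\<^esub> \<one>\<^bsub>H\<^esub>"
    by (rule antipode_of_galois[OF algH Delta_lin eps_lin Delta_coassoc eps_counit_left eps_counit_right can_iso])
qed (rule algH Delta_hom eps_hom Delta_coassoc eps_counit_left eps_counit_right, assumption?)+

text \<open>A coinvariant \<open>x\<close> has \<open>\<mu> x = x (x) 1 (x) 1\<close>, so
  \<open>torsor_left\<close> reads \<open>x (x) 1 = 1 (x) x\<close> and descent makes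
  \<open>x\<close> a scalar. Conversely \<open>delta\<close> is linear and unital.\<close>

lemma coinvariants_unit: "coinvariants R H T delta = unit ` carrier R"
proof (intro subset_antisym subsetI)
  have o: "\<one>\<^bsub>H\<^esub> \<in> carrier H" using one_H by simp
  fix x assume "x \<in> coinvariants R H T delta"
  then have x: "x \<in> carrier T" "delta x = simple T H x \<one>\<^bsub>H\<^esub>" by (simp_all add: coinvariants_def)
  have "\<mu> x = simple T TT x (simple T T \<one>\<^bsub>T\<^esub> \<one>\<^bsub>T\<^esub>)"
    using j_delta[OF x(1)] x o by simp
  then have "simple T T \<one>\<^bsub>T\<^esub> x = simple T T x \<one>\<^bsub>T\<^esub>"
    using torsor_left[OF x(1)] x(1) by (simp add: mf_simple)
  then show "x \<in> unit ` carrier R" using faithfully_flat_unit(2)[OF algT ff x(1)] by auto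
next
  have o: "\<one>\<^bsub>H\<^esub> \<in> carrier H" using one_H by simp
  fix x assume "x \<in> unit ` carrier R"
  then obtain r where r: "r \<in> carrier R" "x = r \<odot>\<^bsub>T\<^esub> \<one>\<^bsub>T\<^esub>" by auto
  have "delta x = r \<odot>\<^bsub>TH\<^esub> simple T H \<one>\<^bsub>T\<^esub> \<one>\<^bsub>H\<^esub>"
    using r lin_smult[OF delta_lin r(1) one_T] algebra_homD(2)[OF delta_hom] by (simp add: tensor_one[OF algT algH] del: H_simps)
  then show "x \<in> coinvariants R H T delta"
    using r o by (simp add: coinvariants_def simple_smult_left del: H_simps)
qed

lemma galois: "right_galois_object R H Delta eps T delta"
proof (intro right_galois_object.intro right_comodule_algebra.intro right_comodule_algebra_axioms.intro right_galois_object_axioms.intro)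
  show "bij_betw beta (carrier TT) (carrier TH)" by (rule lin_isoD(2)[OF beta_iso])
  show "bij_betw unit (carrier R) (coinvariants R H T delta)"
    unfolding coinvariants_unit using unit_inj by (simp add: bij_betw_def)
qed (rule hopf algT delta_hom delta_coassoc delta_counit, assumption?)+

end

text \<open>The formulas for the three structure maps are stated after the inclusions into tensor
  powers of \<open>T\<close>. The injectivity clauses justify treating these as inclusions and show
  that the maps are uniquely determined on the carriers.\<close>

theorem theorem3p4:
  fixes R :: "('r, 'x) ring_scheme" and T :: "('r, 'a, 'y) module_scheme"
    and \<mu> :: "'a \<Rightarrow> ('a \<times> ('a \<times> 'a) list set) list set"
  defines "H \<equiv> torsor_H R T \<mu>"
  assumes "torsor R T \<mu>"
    and "faithfully_flat TYPE(('r, 'a) small) R T"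
  shows
    "submodule (carrier H) R (tensor R (opposite T) T) \<and>
     subring (carrier H) (tensor R (opposite T) T) \<and>
     inj_on (HH_inclusion R T) (carrier (tensor R H H)) \<and>
     inj_on (\<lambda>r. r \<odot>\<^bsub>T\<^esub> \<one>\<^bsub>T\<^esub>) (carrier R) \<and>
     inj_on (TH_inclusion R T) (carrier (tensor R T H)) \<and>
     (\<exists>\<Delta> \<epsilon> \<delta>.
       (\<forall>h\<in>carrier H. \<Delta> h \<in> carrier (tensor R H H) \<and>
          HH_inclusion R T (\<Delta> h) = tensor_map R T (tensor R T (tensor R T T)) id \<mu> h) \<and>
       (\<forall>h\<in>carrier H. \<epsilon> h \<in> carrier R \<and> \<epsilon> h \<odot>\<^bsub>T\<^esub> \<one>\<^bsub>T\<^esub> = mult_map T h) \<and>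
       (\<forall>x\<in>carrier T. \<delta> x \<in> carrier (tensor R T H) \<and> TH_inclusion R T (\<delta> x) = \<mu> x) \<and>
       hopf_algebra R H \<Delta> \<epsilon> \<and>
       right_galois_object R H \<Delta> \<epsilon> T \<delta>)"
proof -
  interpret X: faithfully_flat_torsor R T \<mu>
    using assms(2,3) by (intro faithfully_flat_torsor.intro faithfully_flat_torsor_axioms.intro)
  show ?thesis
    unfolding H_def
    using X.submodule_H X.subring_H X.inj_HH_incl X.unit_inj X.inj_j X.hopf X.galois
    by (intro conjI exI[of _ X.Delta] exI[of _ X.eps] exI[of _ X.delta]) (simp_all add: X.unit_eps)
qed

end
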